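(* Let $Q:\mathbb{R}\to\mathbb{R}$ be a measurable function such that $Q(x)^2\le c_0^2+c_1^2x^2$ for all $x\in\mathbb{R}$, for some constants $c_0,c_1\ge0$. Let $\{\alpha_k\}_{k\ge0}$ be real numbers with $$\alpha_k\sim k^{d-1},\qquad k\to\infty,\qquad\text{for some } 0<d<1/2 .$$ Let $\{X_t\}$ be the solution of the projective equation $$X_t=\sum_{s\le t}\zeta_s\,\alpha_{t-s}\,Q\Big(\sum_{s<u\le t}\beta_{t-u,u-s}\big(\mathrm{E}_{[u,t]}X_t-\mathrm{E}_{[u+1,t]}X_t\big)\Big),\qquad t\in\mathbb{Z},$$ with $\beta_{i,j}=1$ for all $i=0,1,\dots$, $j=1,2,\dots$ (i.e. of $X_t=\sum_{s\le t}\alpha_{t-s}Q(\mathrm{E}_{[s+1,t]}X_t)\zeta_s$). In addition, assume that $$\mathrm{E}\big(Q(\mathrm{E}_{[s,0]}X_0)-Q(X_0)\big)^2\to0\qquad\text{as } s\to-\infty .$$ Then, as $t\to\infty$, $$\mathrm{E}X_0X_t\ \sim\ c_{Q,d}^2\,t^{2d-1},\qquad c_{Q,d}^2:=\big(\mathrm{E}[Q(X_0)]\big)^2B(d,1-2d),$$ where $B(\cdot,\cdot)$ is the beta function, and, as $n\to\infty$, $$n^{-1/2-d}\sum_{t=1}^{[n\tau]}X_t\ \longrightarrow_{D[0,1]}\ c'_{Q,d}\,B_H(\tau),\qquad c'_{Q,d}:=\frac{c_{Q,d}}{(d(1+2d))^{1/2}},$$ where $B_H$ is a fractional Brownian motion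 with parameter $H=d+\tfrac12$ and variance $\mathrm{E}B_H^2(t)=t^{2H}$.
   Context: $\{\zeta_t,\,t\in\mathbb{Z}\}$ is a sequence of i.i.d. real random variables with $\mathrm{E}\zeta_0=0$, $\mathrm{E}\zeta_0^2=1$. For integers $s\le t$, $\mathcal{F}_{[s,t]}:=\sigma\{\zeta_u:u\in[s,t]\}$; for $s>t$, $\mathcal{F}_{[s,t]}$ is the trivial sigma-algebra. $\mathrm{E}_{[s,t]}[\xi]:=\mathrm{E}[\xi\,|\,\mathcal{F}_{[s,t]}]$. A projective process is a random sequence $\{Y_t,\,t\in\mathbb{Z}\}$ of square integrable, $\sigma\{\zeta_u:u\le t\}$-measurable random variables of the form $Y_t=\mathrm{E}Y_t+\sum_{s\le t}g_{s,t}\zeta_s$, where $g_{s,t}$ is $\mathcal{F}_{[s+1,t]}$-measurable for $s<t$, $g_{t,t}$ is deterministic, and $\sum_{s\le t}\mathrm{E}g_{s,t}^2<\infty$ for all $t$. A solution of the projective equation is a projective process $\{X_t\}$ such that the sum over $s\le t$ of the second moments of the coefficients multiplying $\zeta_s$ on the right-hand side is finite and the equation holds for every $t\in\mathbb{Z}$. Under the stated growth condition on $Q$ and $\sum_i\alpha_i^2<\infty$ such a solution exists, is unique and is strictly stationary with zero mean. $f(t)\sim c\,h(t)$ means $f(t)/h(t)\to c$ (so it reads $f(t)=o(h(t))$ if $c=0$); $c_{Q,d}$ is the nonnegative square root of $c_{Q,d}^2$. $\longrightarrow_{D[0,1]}$ denotes weak convergence of random processes in the Skorohod space $D[0,1]$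 and $[\cdot]$ is the integer part. *)

theory Defs
  imports "HOL-Probability.Probability"
begin

section \<open>Projective processes and projective equations\<close>

text \<open>The sigma-algebra generated by the variables \<^term>\<open>\<zeta> u\<close>, \<^term>\<open>u \<in> U\<close>.
  For \<^term>\<open>U = {s..t}\<close> with \<^term>\<open>s > t\<close> it is the trivial one.\<close>

definition noise_algebra :: "'a measure \<Rightarrow> (int \<Rightarrow> 'a \<Rightarrow> real) \<Rightarrow> int set \<Rightarrow> 'a measure" where
  "noise_algebra M \<zeta> U =
     sigma (space M) (\<Union>u\<in>U. {\<zeta> u -` A \<inter> space M | A. A \<in> sets borel})"

definition noise_cond_exp ::
  "'a measure \<Rightarrow> (int \<Rightarrow> 'a \<Rightarrow> real) \<Rightarrow> int \<Rightarrow> int \<Rightarrow> ('a \<Rightarrow> real) \<Rightarrow> 'a \<Rightarrow> real" where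
  "noise_cond_exp M \<zeta> s t Y = real_cond_exp M (noise_algebra M \<zeta> {s..t}) Y"

text \<open>\<^term>\<open>S = (\<Sum>s\<le>t. f s)\<close> with convergence of the partial sums
  over \<^term>\<open>t - int n < s\<close>, \<^term>\<open>s \<le> t\<close> in mean square. For the series below
  the terms are pairwise orthogonal, so that the order of summation is irrelevant.\<close>

definition mean_square_sum ::
  "'a measure \<Rightarrow> int \<Rightarrow> (int \<Rightarrow> 'a \<Rightarrow> real) \<Rightarrow> ('a \<Rightarrow> real) \<Rightarrow> bool" where
  "mean_square_sum M t f S \<longleftrightarrow>
     (\<forall>n. integrable M (\<lambda>\<omega>. (S \<omega> - (\<Sum>s\<in>{t - int n<..t}. f s \<omega>))\<^sup>2)) \<and>
     (\<lambda>n. \<integral>\<omega>. (S \<omega> - (\<Sum>s\<in>{t - int n<..t}. f s \<omega>))\<^sup>2 \<partial>M) \<longlonglongrightarrow> 0"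

definition finite_second_moments :: "'a measure \<Rightarrow> int \<Rightarrow> (int \<Rightarrow> 'a \<Rightarrow> real) \<Rightarrow> bool" where
  "finite_second_moments M t g \<longleftrightarrow>
     (\<forall>s\<le>t. integrable M (\<lambda>\<omega>. (g s \<omega>)\<^sup>2)) \<and>
     (\<lambda>s. \<integral>\<omega>. (g s \<omega>)\<^sup>2 \<partial>M) summable_on {..t}"

definition projective_process ::
  "'a measure \<Rightarrow> (int \<Rightarrow> 'a \<Rightarrow> real) \<Rightarrow> (int \<Rightarrow> 'a \<Rightarrow> real) \<Rightarrow> bool" where
  "projective_process M \<zeta> Y \<longleftrightarrow>
     (\<forall>t. Y t \<in> borel_measurable (noise_algebra M \<zeta> {..t}) \<and> integrable M (\<lambda>\<omega>. (Y t \<omega>)\<^sup>2)) \<and>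
     (\<exists>g. \<forall>t.
        (\<forall>s<t. g s t \<in> borel_measurable (noise_algebra M \<zeta> {s + 1..t})) \<and>
        (\<exists>c. \<forall>\<omega>\<in>space M. g t t \<omega> = c) \<and>
        finite_second_moments M t (\<lambda>s. g s t) \<and>
        mean_square_sum M t (\<lambda>s \<omega>. g s t \<omega> * \<zeta> s \<omega>) (\<lambda>\<omega>. Y t \<omega> - (\<integral>\<omega>'. Y t \<omega>' \<partial>M)))"

definition projective_coeff ::
  "'a measure \<Rightarrow> (int \<Rightarrow> 'a \<Rightarrow> real) \<Rightarrow> (nat \<Rightarrow> real) \<Rightarrow> (nat \<Rightarrow> nat \<Rightarrow> real) \<Rightarrow>
   (real \<Rightarrow> real) \<Rightarrow> (int \<Rightarrow> 'a \<Rightarrow> real) \<Rightarrow> int \<Rightarrow> int \<Rightarrow> 'a \<Rightarrow> real" where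
  "projective_coeff M \<zeta> \<alpha> \<beta> Q X s t \<omega> =
     \<alpha> (nat (t - s)) *
     Q (\<Sum>u\<in>{s<..t}. \<beta> (nat (t - u)) (nat (u - s)) *
          (noise_cond_exp M \<zeta> u t (X t) \<omega> - noise_cond_exp M \<zeta> (u + 1) t (X t) \<omega>))"

definition projective_solution ::
  "'a measure \<Rightarrow> (int \<Rightarrow> 'a \<Rightarrow> real) \<Rightarrow> (nat \<Rightarrow> real) \<Rightarrow> (nat \<Rightarrow> nat \<Rightarrow> real) \<Rightarrow>
   (real \<Rightarrow> real) \<Rightarrow> (int \<Rightarrow> 'a \<Rightarrow> real) \<Rightarrow> bool" where
  "projective_solution M \<zeta> \<alpha> \<beta> Q X \<longleftrightarrow>
     projective_process M \<zeta> X \<and>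
     (\<forall>t. finite_second_moments M t (\<lambda>s. projective_coeff M \<zeta> \<alpha> \<beta> Q X s t) \<and>
          mean_square_sum M t (\<lambda>s \<omega>. \<zeta> s \<omega> * projective_coeff M \<zeta> \<alpha> \<beta> Q X s t \<omega>) (X t))"

section \<open>The Skorohod space on the unit interval\<close>

text \<open>Paths on the unit interval are represented by extensional functions, so that
  two paths are equal if and only if they agree on \<^term>\<open>{0..1::real}\<close>.\<close>

definition skorohod_space :: "(real \<Rightarrow> real) set" where
  "skorohod_space = {f \<in> extensional {0..1}.
     (\<forall>t\<in>{0..<1}. (f \<longlongrightarrow> f t) (at_right t)) \<and>
     (\<forall>t\<in>{0<..1}. \<exists>l. (f \<longlongrightarrow> l) (at_left t))}"

definition time_changes :: "(real \<Rightarrow> real) set" where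
  "time_changes = {l. strict_mono_on {0..1} l \<and> continuous_on {0..1} l \<and> l ` {0..1} = {0..1}}"

text \<open>The library's metric spaces require a distance to be symmetric and nonnegative outside
  the carrier as well; this is the only purpose of the default value \<^term>\<open>0\<close>.\<close>

definition skorohod_dist :: "(real \<Rightarrow> real) \<Rightarrow> (real \<Rightarrow> real) \<Rightarrow> real" where
  "skorohod_dist f g =
     (if f \<in> skorohod_space \<and> g \<in> skorohod_space
      then Inf {e. 0 \<le> e \<and>
        (\<exists>l\<in>time_changes. \<forall>t\<in>{0..1}. \<bar>l t - t\<bar> \<le> e \<and> \<bar>f t - g (l t)\<bar> \<le> e)}
      else 0)"

definition skorohod_topology :: "(real \<Rightarrow> real) topology" where
  "skorohod_topology = Metric_space.mtopology skorohod_space skorohod_dist"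

subsection \<open>The Skorohod distance is a metric\<close>

definition skorohod_close :: "(real \<Rightarrow> real) \<Rightarrow> (real \<Rightarrow> real) \<Rightarrow> real \<Rightarrow> bool" where
  "skorohod_close f g e \<longleftrightarrow> 0 \<le> e \<and>
     (\<exists>l\<in>time_changes. \<forall>t\<in>{0..1}. \<bar>l t - t\<bar> \<le> e \<and> \<bar>f t - g (l t)\<bar> \<le> e)"

lemma skorohod_dist_eq:
  "f \<in> skorohod_space \<Longrightarrow> g \<in> skorohod_space \<Longrightarrow>
    skorohod_dist f g = Inf {e. skorohod_close f g e}"
  by (simp add: skorohod_dist_def skorohod_close_def)

lemma id_time_change: "(\<lambda>t. t) \<in> time_changes"
  by (auto simp: time_changes_def strict_mono_on_def)

lemma time_change_mem: "l \<in> time_changes \<Longrightarrow> t \<in> {0..1} \<Longrightarrow> l t \<in> {0..1}"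
  unfolding time_changes_def by blast

lemma time_change_comp:
  assumes "l \<in> time_changes" "m \<in> time_changes"
  shows "(\<lambda>t. m (l t)) \<in> time_changes"
proof -
  have "strict_mono_on {0..1} (\<lambda>t. m (l t))"
    using assms time_change_mem[OF assms(1)] unfolding time_changes_def strict_mono_on_def by blast
  moreover have "continuous_on {0..1} (\<lambda>t. m (l t))"
    by (rule continuous_on_compose2[of "{0..1}" m]) (use assms in \<open>auto simp: time_changes_def\<close>)
  moreover have "(\<lambda>t. m (l t)) ` {0..1} = m ` (l ` {0..1})"
    by auto
  ultimately show ?thesis
    using assms by (simp add: time_changes_def)
qed

lemma time_change_inv:
  assumes "l \<in> time_changes"
  shows "inv_into {0..1} l \<in> time_changes"
    and "\<And>t. t \<in> {0..1} \<Longrightarrow> l (inv_into {0..1} l t) = t"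
proof -
  have l: "strict_mono_on {0..1} l" "continuous_on {0..1} l" "l ` {0..1} = {0..1}"
    using assms by (auto simp: time_changes_def)
  have inj: "inj_on l {0..1}"
    using l(1) by (rule strict_mono_on_imp_inj_on)
  show r: "l (inv_into {0..1} l t) = t" if "t \<in> {0..1}" for t
    using that l(3) by (simp add: f_inv_into_f)
  have mem: "inv_into {0..1} l t \<in> {0..1}" if "t \<in> {0..1}" for t
    using that l(3) by (metis inv_into_into)
  have "inv_into {0..1} l s < inv_into {0..1} l t" if "s \<in> {0..1}" "t \<in> {0..1}" "s < t" for s t
  proof (rule ccontr)
    assume "\<not> ?thesis"
    then have "l (inv_into {0..1} l t) \<le> l (inv_into {0..1} l s)"
      using mem that l(1) by (metis linorder_not_less order.order_iff_strict strict_mono_on_def)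
    then show False
      using r that by simp
  qed
  moreover have "continuous_on (l ` {0..1}) (inv_into {0..1} l)"
    by (rule continuous_on_inv) (use l inj in \<open>auto simp: inv_into_f_f\<close>)
  moreover have "inv_into {0..1} l ` {0..1} = {0..1}"
    using inv_into_image_cancel[OF inj, of "{0..1}"] l(3) by simp
  ultimately show "inv_into {0..1} l \<in> time_changes"
    using l(3) by (simp add: time_changes_def strict_mono_on_def)
qed

lemma time_change_1:
  assumes "l \<in> time_changes"
  shows "l 1 = 1"
proof -
  have "(1::real) \<in> l ` {0..1}"
    using assms by (simp add: time_changes_def)
  then obtain x where x: "x \<in> {0..1}" "l x = 1"
    by auto
  have "l 1 \<in> {0..1}"
    using time_change_mem[OF assms, of 1] by simp
  moreover have "l x < l 1" if "x < 1"
  proof -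
    have "strict_mono_on {0..1} l"
      using assms unfolding time_changes_def by blast
    then show ?thesis
      using x(1) that by (auto elim: strict_mono_onD)
  qed
  ultimately show ?thesis
    using x by (cases "x = 1") auto
qed

lemma skorohod_space_bounded:
  assumes "f \<in> skorohod_space"
  shows "\<exists>B. \<forall>t\<in>{0..1}. \<bar>f t\<bar> \<le> B"
proof -
  have "(0::real) \<le> 1" by simp
  then have "0 \<le> (0::real) \<and> (1::real) \<le> 1 \<longrightarrow> (\<exists>B. \<forall>t\<in>{0..1}. \<bar>f t\<bar> \<le> B)"
  proof (rule Bolzano[where P = "\<lambda>a b. 0 \<le> a \<and> b \<le> 1 \<longrightarrow> (\<exists>B. \<forall>t\<in>{a..b}. \<bar>f t\<bar> \<le> B)"], goal_cases)
    case trans: (1 a b c)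
    show ?case
    proof
      assume "0 \<le> a \<and> c \<le> 1"
      then have "0 \<le> a \<and> b \<le> 1" "0 \<le> b \<and> c \<le> 1"
        using trans(3,4) by auto
      then obtain B C where B: "\<forall>t\<in>{a..b}. \<bar>f t\<bar> \<le> B" and C: "\<forall>t\<in>{b..c}. \<bar>f t\<bar> \<le> C"
        using trans(1,2) by blast
      have "\<bar>f t\<bar> \<le> max B C" if "t \<in> {a..c}" for t
        using bspec[OF B, of t] bspec[OF C, of t] that by (cases "t \<le> b") auto
      then have "\<forall>t\<in>{a..c}. \<bar>f t\<bar> \<le> max B C" ..
      then show "\<exists>B. \<forall>t\<in>{a..c}. \<bar>f t\<bar> \<le> B" ..
    qed
  next
    case local: (2 x)
    obtain d1 B1 where left: "\<And>t. t < x \<Longrightarrow> x - d1 < t \<Longrightarrow> 0 \<le> t \<Longrightarrow> \<bar>f t\<bar> \<le> B1"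
        and d1: "d1 > 0"
    proof (cases "x = 0")
      case True
      then show ?thesis using that[of 1 0] by auto
    next
      case False
      then have "x \<in> {0<..1}" using local by auto
      then obtain l where "(f \<longlongrightarrow> l) (at_left x)"
        using assms unfolding skorohod_space_def by blast
      then have "eventually (\<lambda>t. dist (f t) l < 1) (at_left x)"
        by (rule tendstoD) simp
      then obtain b where b: "b < x" "\<forall>t>b. t < x \<longrightarrow> dist (f t) l < 1"
        unfolding eventually_at_left_field by blast
      have "\<bar>f t\<bar> \<le> \<bar>l\<bar> + 1" if "t < x" "x - (x - b) < t" for t
      proof -
        have "dist (f t) l < 1" using b that by simp
        then show ?thesis by (simp add: dist_real_def)
      qed
      then show ?thesis using that[of "x - b" "\<bar>l\<bar> + 1"] b(1) by auto
    qed
    obtain d2 B2 where right: "\<And>t. x < t \<Longrightarrow> t < x + d2 \<Longrightarrow> t \<le> 1 \<Longrightarrow> \<bar>f t\<bar> \<le> B2"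
        and d2: "d2 > 0"
    proof (cases "x = 1")
      case True
      then show ?thesis using that[of 1 0] by auto
    next
      case False
      then have "x \<in> {0..<1}" using local by auto
      then have "(f \<longlongrightarrow> f x) (at_right x)"
        using assms unfolding skorohod_space_def by blast
      then have "eventually (\<lambda>t. dist (f t) (f x) < 1) (at_right x)"
        by (rule tendstoD) simp
      then obtain b where b: "x < b" "\<forall>t>x. t < b \<longrightarrow> dist (f t) (f x) < 1"
        unfolding eventually_at_right_field by blast
      have "\<bar>f t\<bar> \<le> \<bar>f x\<bar> + 1" if "x < t" "t < x + (b - x)" for t
      proof -
        have "dist (f t) (f x) < 1" using b that by simp
        then show ?thesis by (simp add: dist_real_def)
      qed
      then show ?thesis using that[of "b - x" "\<bar>f x\<bar> + 1"] b(1) by auto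
    qed
    show ?case
    proof (rule exI[of _ "min d1 d2"], intro conjI allI impI)
      fix a b assume ab: "a \<le> x \<and> x \<le> b \<and> b - a < min d1 d2" "0 \<le> a \<and> b \<le> 1"
      have "\<bar>f t\<bar> \<le> max \<bar>f x\<bar> (max B1 B2)" if t: "t \<in> {a..b}" for t
      proof -
        consider "t < x" | "t = x" | "x < t" by linarith
        then show ?thesis
        proof cases
          case 1
          then have "\<bar>f t\<bar> \<le> B1" using ab t by (intro left) auto
          then show ?thesis by simp
        next
          case 3
          then have "\<bar>f t\<bar> \<le> B2" using ab t by (intro right) auto
          then show ?thesis by simp
        qed simp
      qed
      then have "\<forall>t\<in>{a..b}. \<bar>f t\<bar> \<le> max \<bar>f x\<bar> (max B1 B2)" ..
      then show "\<exists>B. \<forall>t\<in>{a..b}. \<bar>f t\<bar> \<le> B" ..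
    qed (use d1 d2 in auto)
  qed
  then show ?thesis by simp
qed

lemma skorohod_close_ex:
  assumes "f \<in> skorohod_space" "g \<in> skorohod_space"
  shows "\<exists>e. skorohod_close f g e"
proof -
  obtain B C where BC: "\<forall>t\<in>{0..1}. \<bar>f t\<bar> \<le> B" "\<forall>t\<in>{0..1}. \<bar>g t\<bar> \<le> C"
    using skorohod_space_bounded[OF assms(1)] skorohod_space_bounded[OF assms(2)] by blast
  have "\<forall>t\<in>{0..1}. \<bar>t - t\<bar> \<le> \<bar>B\<bar> + \<bar>C\<bar> \<and> \<bar>f t - g t\<bar> \<le> \<bar>B\<bar> + \<bar>C\<bar>"
    using BC by fastforce
  then have "skorohod_close f g (\<bar>B\<bar> + \<bar>C\<bar>)"
    unfolding skorohod_close_def by (intro conjI bexI[OF _ id_time_change]) auto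
  then show ?thesis ..
qed

lemma skorohod_dist_le:
  assumes "f \<in> skorohod_space" "g \<in> skorohod_space" "skorohod_close f g e"
  shows "skorohod_dist f g \<le> e"
  unfolding skorohod_dist_eq[OF assms(1,2)] using assms(3)
  by (intro cInf_lower) (auto simp: skorohod_close_def intro!: bdd_belowI[of _ 0])

lemma skorohod_dist_lessD:
  assumes "f \<in> skorohod_space" "g \<in> skorohod_space" "skorohod_dist f g < a"
  shows "\<exists>e<a. skorohod_close f g e"
  using assms cInf_lessD[of "{e. skorohod_close f g e}" a] skorohod_close_ex[of f g]
  by (auto simp: skorohod_dist_eq)

lemma skorohod_close_commute:
  assumes "skorohod_close f g e"
  shows "skorohod_close g f e"
proof -
  obtain l where l: "0 \<le> e" "l \<in> time_changes"
      "\<forall>t\<in>{0..1}. \<bar>l t - t\<bar> \<le> e \<and> \<bar>f t - g (l t)\<bar> \<le> e"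
    using assms by (auto simp: skorohod_close_def)
  let ?m = "inv_into {0..1} l"
  note m = time_change_inv[OF l(2)]
  have "\<bar>?m t - t\<bar> \<le> e \<and> \<bar>g t - f (?m t)\<bar> \<le> e" if t: "t \<in> {0..1}" for t
    using l(3) time_change_mem[OF m(1) t] m(2)[OF t] by (metis abs_minus_commute)
  then show ?thesis
    using l(1) m(1) unfolding skorohod_close_def by blast
qed

lemma skorohod_close_trans:
  assumes "skorohod_close f g a" "skorohod_close g h b"
  shows "skorohod_close f h (a + b)"
proof -
  obtain l where l: "0 \<le> a" "l \<in> time_changes"
      "\<And>t. t\<in>{0..1} \<Longrightarrow> \<bar>l t - t\<bar> \<le> a \<and> \<bar>f t - g (l t)\<bar> \<le> a"
    using assms(1) by (auto simp: skorohod_close_def)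
  obtain m where m: "0 \<le> b" "m \<in> time_changes"
      "\<And>t. t\<in>{0..1} \<Longrightarrow> \<bar>m t - t\<bar> \<le> b \<and> \<bar>g t - h (m t)\<bar> \<le> b"
    using assms(2) by (auto simp: skorohod_close_def)
  have "\<bar>m (l t) - t\<bar> \<le> a + b \<and> \<bar>f t - h (m (l t))\<bar> \<le> a + b" if "t \<in> {0..1}" for t
    using l(3)[OF that] m(3)[OF time_change_mem[OF l(2) that]] by linarith
  then show ?thesis
    using l(1) m(1) time_change_comp[OF l(2) m(2)] unfolding skorohod_close_def by fastforce
qed

lemma skorohod_dist_nonneg:
  assumes "f \<in> skorohod_space" "g \<in> skorohod_space"
  shows "0 \<le> skorohod_dist f g"
  using skorohod_dist_lessD[OF assms, of 0] by (force simp: skorohod_close_def)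

lemma skorohod_dist_0D:
  assumes f: "f \<in> skorohod_space" and g: "g \<in> skorohod_space" and "skorohod_dist f g = 0"
  shows "f = g"
proof (rule extensionalityI[of _ "{0..1}"])
  show "f \<in> extensional {0..1}" "g \<in> extensional {0..1}"
    using f g by (auto simp: skorohod_space_def)
  fix t :: real assume t: "t \<in> {0..1}"
  have close: "\<exists>l\<in>time_changes. \<forall>s\<in>{0..1}. \<bar>l s - s\<bar> < e \<and> \<bar>f s - g (l s)\<bar> < e" if "e > 0" for e
  proof -
    obtain e' where "e' < e" "skorohod_close f g e'"
      using skorohod_dist_lessD[OF f g, of e] assms(3) \<open>e > 0\<close> by auto
    then show ?thesis
      unfolding skorohod_close_def by (meson le_less_trans)
  qed
  have le: "\<bar>f t - g t\<bar> \<le> 3 * e" if "e > 0" for e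
  proof (cases "t = 1")
    case True
    obtain l where "l \<in> time_changes" "\<forall>s\<in>{0..1}. \<bar>l s - s\<bar> < e \<and> \<bar>f s - g (l s)\<bar> < e"
      using close[OF \<open>e > 0\<close>] by blast
    then have "\<bar>f 1 - g 1\<bar> < e"
      using time_change_1[of l] by (metis atLeastAtMost_iff order_refl zero_le_one)
    then show ?thesis using True \<open>e > 0\<close> by simp
  next
    case False
    with t have "t \<in> {0..<1}" by auto
    then have "(f \<longlongrightarrow> f t) (at_right t)" "(g \<longlongrightarrow> g t) (at_right t)"
      using f g unfolding skorohod_space_def by blast+
    then have "eventually (\<lambda>s. dist (f s) (f t) < e) (at_right t)"
        "eventually (\<lambda>s. dist (g s) (g t) < e) (at_right t)"
      using \<open>e > 0\<close> by (auto intro: tendstoD)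
    then obtain b c where bc: "t < b" "\<forall>s>t. s < b \<longrightarrow> dist (f s) (f t) < e"
        "t < c" "\<forall>s>t. s < c \<longrightarrow> dist (g s) (g t) < e"
      unfolding eventually_at_right_field by blast
    define m where "m = min 1 (min b c)"
    have m: "t < m" "m \<le> 1" "m \<le> b" "m \<le> c"
      using bc(1,3) t False by (auto simp: m_def)
    define r where "r = (m - t) / 2"
    have r: "r > 0" "t + 2 * r \<le> 1" "t + 2 * r \<le> b" "t + 2 * r \<le> c"
    proof -
      have "2 * r = m - t" by (simp add: r_def)
      then show "r > 0" "t + 2 * r \<le> 1" "t + 2 * r \<le> b" "t + 2 * r \<le> c"
        using m by linarith+
    qed
    obtain l where l: "l \<in> time_changes"
        "\<forall>s\<in>{0..1}. \<bar>l s - s\<bar> < min e r \<and> \<bar>f s - g (l s)\<bar> < min e r"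
      using close[of "min e r"] \<open>e > 0\<close> r by auto
    have s: "t + r \<in> {0..1}" using t r by auto
    have *: "\<bar>l (t + r) - (t + r)\<bar> < r" "\<bar>f (t + r) - g (l (t + r))\<bar> < e"
      using l(2) s by (simp_all del: atLeastAtMost_iff)
    have "dist (f (t + r)) (f t) < e" using bc(2) r by simp
    moreover have "dist (g (l (t + r))) (g t) < e" using bc(4) r *(1) by auto
    ultimately show ?thesis using *(2) unfolding dist_real_def by linarith
  qed
  have "\<bar>f t - g t\<bar> \<le> 0"
  proof (rule field_le_epsilon)
    fix e :: real assume "e > 0"
    then show "\<bar>f t - g t\<bar> \<le> 0 + e" using le[of "e / 3"] by simp
  qed
  then show "f t = g t" by simp
qed

lemma Metric_space_skorohod: "Metric_space skorohod_space skorohod_dist"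
proof -
  have comm: "skorohod_dist f g = skorohod_dist g f" for f g
  proof -
    have "skorohod_close f g = skorohod_close g f"
      using skorohod_close_commute by blast
    then show ?thesis
      by (cases "f \<in> skorohod_space \<and> g \<in> skorohod_space")
        (simp add: skorohod_dist_eq, auto simp: skorohod_dist_def)
  qed
  have refl: "skorohod_dist f f = 0" if f: "f \<in> skorohod_space" for f
  proof -
    have "skorohod_close f f 0"
      using id_time_change unfolding skorohod_close_def by fastforce
    then show ?thesis
      using skorohod_dist_le[OF f f] skorohod_dist_nonneg[OF f f] by fastforce
  qed
  have tri: "skorohod_dist f h \<le> skorohod_dist f g + skorohod_dist g h"
    if f: "f \<in> skorohod_space" and g: "g \<in> skorohod_space" and h: "h \<in> skorohod_space" for f g h
  proof (rule field_le_epsilon)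
    fix e :: real assume "e > 0"
    obtain a where a: "a < skorohod_dist f g + e / 2" "skorohod_close f g a"
      using skorohod_dist_lessD[OF f g, of "skorohod_dist f g + e / 2"] \<open>e > 0\<close> by auto
    obtain b where b: "b < skorohod_dist g h + e / 2" "skorohod_close g h b"
      using skorohod_dist_lessD[OF g h, of "skorohod_dist g h + e / 2"] \<open>e > 0\<close> by auto
    show "skorohod_dist f h \<le> skorohod_dist f g + skorohod_dist g h + e"
      using skorohod_dist_le[OF f h skorohod_close_trans[OF a(2) b(2)]] a(1) b(1) by linarith
  qed
  have nonneg: "0 \<le> skorohod_dist f g" for f g
  proof (cases "f \<in> skorohod_space \<and> g \<in> skorohod_space")
    case True
    then show ?thesis by (blast intro: skorohod_dist_nonneg)
  next
    case False
    then have "skorohod_dist f g = 0" unfolding skorohod_dist_def by (rule if_not_P)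
    then show ?thesis by simp
  qed
  show ?thesis
  proof
    show "0 \<le> skorohod_dist f g" for f g by (rule nonneg)
    show "skorohod_dist f g = skorohod_dist g f" for f g by (rule comm)
    show "skorohod_dist f g = 0 \<longleftrightarrow> f = g" if "f \<in> skorohod_space" "g \<in> skorohod_space" for f g
      using skorohod_dist_0D[OF that] refl[OF that(1)] by blast
    show "skorohod_dist f h \<le> skorohod_dist f g + skorohod_dist g h"
      if "f \<in> skorohod_space" "g \<in> skorohod_space" "h \<in> skorohod_space" for f g h
      using that by (rule tri)
  qed
qed

section \<open>Convergence in distribution\<close>

text \<open>Convergence in distribution of random elements of a topological space, which may live on
  different probability spaces.\<close>

definition borel_algebra :: "'b topology \<Rightarrow> 'b measure" where
  "borel_algebra T = sigma (topspace T) {U. openin T U}"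

definition converges_in_distribution ::
  "'b topology \<Rightarrow> 'a measure \<Rightarrow> (nat \<Rightarrow> 'a \<Rightarrow> 'b) \<Rightarrow> 'c measure \<Rightarrow> ('c \<Rightarrow> 'b) \<Rightarrow> bool" where
  "converges_in_distribution T M Y N Z \<longleftrightarrow>
     (\<forall>n. Y n \<in> M \<rightarrow>\<^sub>M borel_algebra T) \<and> Z \<in> N \<rightarrow>\<^sub>M borel_algebra T \<and>
     (\<forall>\<phi>. continuous_map T euclideanreal \<phi> \<and> bounded (\<phi> ` topspace T) \<longrightarrow>
        (\<lambda>n. \<integral>\<omega>. \<phi> (Y n \<omega>) \<partial>M) \<longlonglongrightarrow> (\<integral>\<omega>. \<phi> (Z \<omega>) \<partial>N))"

section \<open>Fractional Brownian motion\<close>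

text \<open>Constants count as (degenerate) Gaussian variables.\<close>

definition gaussian_variable :: "'a measure \<Rightarrow> ('a \<Rightarrow> real) \<Rightarrow> bool" where
  "gaussian_variable M Y \<longleftrightarrow>
     (\<exists>\<mu> \<sigma>. 0 < \<sigma> \<and> distributed M lborel Y (normal_density \<mu> \<sigma>)) \<or>
     (Y \<in> borel_measurable M \<and> (\<exists>c. AE \<omega> in M. Y \<omega> = c))"

text \<open>Normalised so that \<^term>\<open>B t\<close> has variance \<^term>\<open>t powr (2 * H)\<close>; the time set
  is \<^term>\<open>{0..} :: real set\<close>.\<close>

definition fractional_brownian_motion ::
  "'a measure \<Rightarrow> real \<Rightarrow> (real \<Rightarrow> 'a \<Rightarrow> real) \<Rightarrow> bool" where
  "fractional_brownian_motion M H B \<longleftrightarrow>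
     prob_space M \<and> 0 < H \<and> H < 1 \<and>
     (\<forall>T a. finite T \<and> T \<subseteq> {0..} \<longrightarrow> gaussian_variable M (\<lambda>\<omega>. \<Sum>t\<in>T. a t * B t \<omega>)) \<and>
     (\<forall>t\<ge>0. (\<integral>\<omega>. B t \<omega> \<partial>M) = 0) \<and>
     (\<forall>s\<ge>0. \<forall>t\<ge>0. (\<integral>\<omega>. B s \<omega> * B t \<omega> \<partial>M) =
        (s powr (2 * H) + t powr (2 * H) - \<bar>t - s\<bar> powr (2 * H)) / 2) \<and>
     (\<forall>\<omega>\<in>space M. continuous_on {0..} (\<lambda>t. B t \<omega>))"

end

theory Submission
  imports Defs "HOL-Real_Asymp.Real_Asymp"
begin

text \<open>Telescoping the coefficients shows that the conditional expectation of \<open>X\<^sub>t\<close> given its last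
  \<open>k\<close> innovations is a fixed recursive function of these innovations, so \<open>X\<^sub>t\<close> is the mean square limit of
  \<open>\<Sum>\<^sub>i \<alpha>\<^sub>i q\<^sub>i \<zeta>\<^sub>t\<^sub>-\<^sub>i\<close>, where \<open>q\<^sub>i\<close> depends on the last \<open>i\<close> innovations only and converges in mean
  square to \<open>Q(X\<^sub>t)\<close>. The covariance at lag \<open>h\<close> is \<open>\<Sum>\<^sub>i \<alpha>\<^sub>i \<alpha>\<^sub>h\<^sub>+\<^sub>i E[q\<^sub>i q\<^sub>h\<^sub>+\<^sub>i]\<close>, and for large \<open>i\<close> and
  \<open>h\<close> the two factors are almost independent, so the expectation tends to \<open>(E Q(X\<^sub>0))\<^sup>2\<close>; a Riemann sum
  then produces the beta integral. By the same estimate the difference between \<open>X\<^sub>t\<close> and the linear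
  process \<open>E Q(X\<^sub>0) \<Sum>\<^sub>i \<alpha>\<^sub>i \<zeta>\<^sub>t\<^sub>-\<^sub>i\<close> has covariance \<open>o(h\<^sup>2\<^sup>d\<^sup>-\<^sup>1)\<close>, so it does not contribute to the normalised
  partial sums, and the finite-dimensional limits follow from the central limit theorem for weighted
  sums of the innovations. Tightness needs second moments only, because the variance of a
  sum of \<open>n\<close> terms is of order \<open>n\<^sup>1\<^sup>+\<^sup>2\<^sup>d\<close> with exponent greater than 1.\<close>

section \<open>Weighted autocovariances of regularly varying coefficients\<close>

text \<open>The obstacle is that, apart from the weights \<alpha>, the coefficients of the
  difference between X and the linear process do not become small: in mean square they approach
  Q(X_t) - E Q(X_0). What decays is the correlation of two of them that belong to distant times and
  to the same innovation, and no rate is available for this. The difference is therefore estimated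
  only through double sums of covariances, with bounds that hold for all truncations at once.
  Likewise, the linear process is not constructed as an infinite series: with n fixed, everything is
  done for sums over k past innovations, and k tends to infinity inside the estimates. The Skorohod
  space enters only through bounded Lipschitz functionals. On paths that are constant between the
  points of a grid with mesh 1 / m such a functional is a Lipschitz function of m + 1 real numbers,
  so that convergence becomes a question about random vectors, and tightness turns into a bound for
  the distance between a path and its grid version. If E Q(X_0) = 0, the same argument yields the
  zero path as limit.\<close>

lemma stolz_cesaro:
  fixes a b :: "nat \<Rightarrow> real"
  assumes pos: "\<And>k. 0 < b k" and top: "filterlim (\<lambda>n. \<Sum>k<n. b k) at_top sequentially"
    and lim: "(\<lambda>k. a k / b k) \<longlonglongrightarrow> l"
  shows "(\<lambda>n. (\<Sum>k<n. a k) / (\<Sum>k<n. b k)) \<longlonglongrightarrow> l"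
proof (rule LIMSEQ_I)
  fix e :: real assume e: "0 < e"
  from LIMSEQ_D[OF lim, of "e / 2"] e obtain N where
    N: "\<And>k. k \<ge> N \<Longrightarrow> \<bar>a k / b k - l\<bar> < e / 2" by auto
  have N': "\<bar>a k - l * b k\<bar> \<le> e / 2 * b k" if "k \<ge> N" for k
  proof -
    have "\<bar>a k - l * b k\<bar> = \<bar>a k / b k - l\<bar> * b k"
      using pos[of k] by (simp add: abs_mult_pos' [symmetric] abs_mult field_simps flip: abs_mult_pos)
    then show ?thesis using N[OF that] pos[of k] by simp
  qed
  \<comment> \<open>The first N terms contribute a fixed amount. It is absorbed once the denominator
    exceeds 2 * C / e + 1, where the + 1 also keeps the denominator positive.\<close>
  define C where "C = (\<Sum>k<N. \<bar>a k - l * b k\<bar>)"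
  have bound: "\<bar>(\<Sum>k<n. a k) - l * (\<Sum>k<n. b k)\<bar> \<le> C + e / 2 * (\<Sum>k<n. b k)" for n
  proof -
    have "\<bar>(\<Sum>k<n. a k) - l * (\<Sum>k<n. b k)\<bar> = \<bar>\<Sum>k<n. a k - l * b k\<bar>"
      by (simp add: sum_subtractf sum_distrib_left)
    also have "\<dots> \<le> (\<Sum>k<n. \<bar>a k - l * b k\<bar>)" by (rule sum_abs)
    also have "\<dots> \<le> (\<Sum>k<n. (if k < N then \<bar>a k - l * b k\<bar> else 0) + e / 2 * b k)"
    proof (rule sum_mono)
      fix k assume "k \<in> {..<n}"
      have "0 < e / 2 * b k" using pos[of k] e by simp
      then show "\<bar>a k - l * b k\<bar> \<le> (if k < N then \<bar>a k - l * b k\<bar> else 0) + e / 2 * b k"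
        using N'[of k] by (cases "k < N") (auto simp: not_less)
    qed
    also have "\<dots> = (\<Sum>k<n. if k < N then \<bar>a k - l * b k\<bar> else 0) + e / 2 * (\<Sum>k<n. b k)"
      by (simp add: sum.distrib sum_distrib_left)
    also have "(\<Sum>k<n. if k < N then \<bar>a k - l * b k\<bar> else 0) = (\<Sum>k\<in>{..<n} \<inter> {..<N}. \<bar>a k - l * b k\<bar>)"
      by (subst sum.inter_restrict) (auto intro: sum.cong)
    also have "\<dots> \<le> C" unfolding C_def by (rule sum_mono2) auto
    finally show ?thesis by simp
  qed
  have "\<forall>\<^sub>F n in sequentially. (\<Sum>k<n. b k) > 2 * C / e + 1"
    using top unfolding filterlim_at_top_dense by blast
  then obtain n0 where n0: "\<And>n. n \<ge> n0 \<Longrightarrow> (\<Sum>k<n. b k) > 2 * C / e + 1"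
    unfolding eventually_sequentially by blast
  have C0: "C \<ge> 0" unfolding C_def by (rule sum_nonneg) simp
  show "\<exists>n0. \<forall>n\<ge>n0. norm ((\<Sum>k<n. a k) / (\<Sum>k<n. b k) - l) < e"
  proof (intro exI allI impI)
    fix n assume "n \<ge> n0"
    define B where "B = (\<Sum>k<n. b k)"
    have B: "B > 2 * C / e + 1" unfolding B_def using n0 \<open>n \<ge> n0\<close> by blast
    have B0: "B > 0" using B C0 e by (smt (verit) divide_nonneg_pos)
    have "C < e / 2 * B" using B e by (simp add: field_simps)
    then have "\<bar>(\<Sum>k<n. a k) - l * B\<bar> < e * B" using bound[of n] unfolding B_def[symmetric] by simp
    then show "norm ((\<Sum>k<n. a k) / (\<Sum>k<n. b k) - l) < e"
      unfolding B_def[symmetric] using B0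
      by (simp add: abs_less_iff field_simps)
  qed
qed

text \<open>Stolz-Cesaro with the telescoping weights (k + 1)^p - k^p, which sum exactly to n^p and
  are equivalent to p k^(p - 1).\<close>

lemma sum_asymp_powr:
  fixes a :: "nat \<Rightarrow> real"
  assumes p: "0 < p" and lim: "(\<lambda>k. a k / real k powr (p - 1)) \<longlonglongrightarrow> \<kappa>"
  shows "(\<lambda>n. (\<Sum>k<n. a k) / real n powr p) \<longlonglongrightarrow> \<kappa> / p"
proof -
  define b where "b k = real (Suc k) powr p - real k powr p" for k
  have sum_b: "(\<Sum>k<n. b k) = real n powr p" for n
    unfolding b_def by (subst sum_lessThan_telescope) (use p in simp)
  have "(\<lambda>n. (\<Sum>k<n. a k) / (\<Sum>k<n. b k)) \<longlonglongrightarrow> \<kappa> / p"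
  proof (rule stolz_cesaro)
    show "0 < b k" for k unfolding b_def using p by (simp add: powr_less_mono2)
    show "filterlim (\<lambda>n. \<Sum>k<n. b k) at_top sequentially"
      unfolding sum_b using p by real_asymp
    have "(\<lambda>k. real k powr (p - 1) / b k) \<longlonglongrightarrow> 1 / p"
      unfolding b_def using p by real_asymp (simp add: field_simps)
    from tendsto_mult[OF lim this]
    have *: "(\<lambda>k. a k / real k powr (p - 1) * (real k powr (p - 1) / b k)) \<longlonglongrightarrow> \<kappa> / p" by simp
    \<comment> \<open>At k = 0 the power \<open>real k powr (p - 1)\<close> is 0, so that it cancels
      only from k = 1 on.\<close>
    show "(\<lambda>k. a k / b k) \<longlonglongrightarrow> \<kappa> / p"
      by (rule Lim_transform_eventually[OF *], rule eventually_sequentiallyI[of 1]) simp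
  qed
  then show ?thesis unfolding sum_b .
qed

text \<open>Enlarging a symmetric Toeplitz matrix adds one row and one column. Each carries r(0),
  ..., r(n), and they share the corner r(0), which explains the correction.\<close>

lemma toeplitz_sum_Suc:
  fixes r :: "nat \<Rightarrow> real"
  shows "(\<Sum>t<Suc n. \<Sum>u<Suc n. r (nat \<bar>int t - int u\<bar>)) =
    (\<Sum>t<n. \<Sum>u<n. r (nat \<bar>int t - int u\<bar>)) + (2 * (\<Sum>h<Suc n. r h) - r 0)"
proof -
  have 1: "(\<Sum>t<n. r (nat \<bar>int t - int n\<bar>)) = (\<Sum>h<Suc n. r h) - r 0"
  proof -
    have "(\<Sum>t<n. r (nat \<bar>int t - int n\<bar>)) = (\<Sum>t<n. r (Suc t))"
      by (rule sum.reindex_bij_witness[of _ "\<lambda>i. n - Suc i" "\<lambda>i. n - Suc i"])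
        (auto intro!: arg_cong[where f=r])
    then show ?thesis by (simp add: sum.lessThan_Suc_shift del: sum.lessThan_Suc)
  qed
  have 2: "(\<Sum>u<n. r (nat \<bar>int n - int u\<bar>)) = (\<Sum>h<Suc n. r h) - r 0"
    unfolding 1[symmetric] by (simp add: abs_minus_commute)
  show ?thesis by (simp only: sum.lessThan_Suc[of _ n] sum.distrib 1 2) simp
qed

text \<open>The double sum is the variance of a sum of n stationary terms with autocovariance r. Its
  increment in n is twice a partial sum of r up to a constant, so power summation is applied twice.
  The factors 2, 1 / (2 d) and 1 / (1 + 2 d) produce the constant of the limit theorem.\<close>

lemma toeplitz_sum_asymp:
  fixes r :: "nat \<Rightarrow> real"
  assumes d: "0 < d" and lim: "(\<lambda>h. r h / real h powr (2 * d - 1)) \<longlonglongrightarrow> \<kappa>"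
  shows "(\<lambda>n. (\<Sum>t<n. \<Sum>u<n. r (nat \<bar>int t - int u\<bar>)) / real n powr (1 + 2 * d))
    \<longlonglongrightarrow> \<kappa> / (d * (1 + 2 * d))"
proof -
  have R: "(\<lambda>n. (\<Sum>h<n. r h) / real n powr (2 * d)) \<longlonglongrightarrow> \<kappa> / (2 * d)"
    using d by (intro sum_asymp_powr lim) auto
  define a where "a n = 2 * (\<Sum>h<Suc n. r h) - r 0" for n
  have V: "(\<Sum>t<n. \<Sum>u<n. r (nat \<bar>int t - int u\<bar>)) = (\<Sum>k<n. a k)" for n
  proof (induction n)
    case (Suc n)
    then show ?case unfolding toeplitz_sum_Suc sum.lessThan_Suc[of a] a_def by simp
  qed simp
  have "(\<lambda>n. real (Suc n) powr (2 * d) / real n powr (2 * d)) \<longlonglongrightarrow> 1"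
    using d by real_asymp
  moreover have "(\<lambda>n. r 0 / real n powr (2 * d)) \<longlonglongrightarrow> 0" using d by real_asymp
  ultimately have "(\<lambda>n. 2 * ((\<Sum>h<Suc n. r h) / real (Suc n) powr (2 * d) *
      (real (Suc n) powr (2 * d) / real n powr (2 * d))) - r 0 / real n powr (2 * d))
      \<longlonglongrightarrow> 2 * (\<kappa> / (2 * d) * 1) - 0"
    by (intro tendsto_intros LIMSEQ_Suc[OF R])
  also have "2 * (\<kappa> / (2 * d) * 1) - 0 = \<kappa> / d" by simp
  finally have "(\<lambda>n. a n / real n powr (2 * d)) \<longlonglongrightarrow> \<kappa> / d"
    by (simp add: a_def diff_divide_distrib del: sum.lessThan_Suc of_nat_Suc)
  then have "(\<lambda>n. (\<Sum>k<n. a k) / real n powr (1 + 2 * d)) \<longlonglongrightarrow> (\<kappa> / d) / (1 + 2 * d)"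
    using d by (intro sum_asymp_powr) auto
  then show ?thesis unfolding V by simp
qed

text \<open>The substitution y = x / (1 + x), with 1 - y = 1 / (1 + x) and Jacobian (1 + x)^(-2),
  turns f into the integrand of the beta function. Convergence at 0 is d > 0, convergence at
  infinity is d < 1 / 2.\<close>

lemma beta_integral_half_line:
  fixes d :: real
  assumes d: "0 < d" "d < 1 / 2"
  defines "f \<equiv> \<lambda>x::real. x powr (d - 1) * (1 + x) powr (d - 1)"
  shows "set_integrable lborel {0<..} f" "(LINT x:{0<..}|lborel. f x) = Beta d (1 - 2 * d)"
proof -
  define g where "g x = x / (1 + x)" for x :: real
  define k where "k y = y powr (d - 1) * (1 - y) powr ((1 - 2 * d) - 1)" for y :: real
  have img: "g ` {0<..} = {0<..<1}"
  proof (intro equalityI subsetI)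
    fix y :: real assume "y \<in> {0<..<1}"
    then have "g (y / (1 - y)) = y" "y / (1 - y) > 0" by (auto simp: g_def field_simps)
    then show "y \<in> g ` {0<..}" by (metis greaterThan_iff image_eqI)
  qed (auto simp: g_def)
  have inj: "inj_on g {0<..}" by (auto simp: inj_on_def g_def field_simps)
  have der: "(g has_field_derivative (1 / (1 + x)^2)) (at x within {0<..})" if "x \<in> {0<..}" for x
    unfolding g_def using that
    by (auto intro!: derivative_eq_intros simp: field_simps power2_eq_square)
  have beta: "(k has_integral Beta d (1 - 2 * d)) {0<..<1}"
  proof -
    have "(k has_integral Beta d (1 - 2 * d)) {0..1}"
      unfolding k_def by (rule has_integral_Beta_real) (use d in auto)
    then show ?thesis using has_integral_open_interval[of k _ 0 1] by simp
  qed
  have kabs: "k absolutely_integrable_on {0<..<1}"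
    using beta by (intro nonnegative_absolutely_integrable_1) (auto simp: k_def integrable_on_def)
  have cv: "\<bar>1 / (1 + x)^2\<bar> * k (g x) = f x" if "x \<in> {0<..}" for x
  proof -
    have x: "x > 0" using that by simp
    have "1 - x / (1 + x) = 1 / (1 + x)" using x by (simp add: field_simps)
    then have "k (g x) = (x / (1 + x)) powr (d - 1) * (1 / (1 + x)) powr (- (2 * d))"
      by (simp add: k_def g_def)
    then have "k (g x) = x powr (d - 1) / (1 + x) powr (d - 1) * (1 + x) powr (2 * d)"
      using x by (simp add: powr_divide powr_minus)
    moreover have "(1 + x) powr (2 * d) / (1 + x) powr (d - 1) / (1 + x)^2 = (1 + x) powr (d - 1)"
    proof -
      have "(1 + x)^2 = (1 + x) powr 2" using x by simp
      then show ?thesis by (simp only: powr_diff[symmetric]) (simp add: algebra_simps)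
    qed
    moreover have "\<bar>1 / (1 + x)^2\<bar> * (a / P * R) = a * (R / P / (1 + x)^2)" for a P R :: real
      by simp
    ultimately show ?thesis unfolding f_def by (simp only:)
  qed
  have "f absolutely_integrable_on {0<..} \<and> integral {0<..} f = Beta d (1 - 2 * d)"
  proof -
    have *: "(\<lambda>x. \<bar>1 / (1 + x)^2\<bar> * k (g x)) absolutely_integrable_on {0<..} \<and>
      integral {0<..} (\<lambda>x. \<bar>1 / (1 + x)^2\<bar> * k (g x)) = Beta d (1 - 2 * d)"
      by (subst has_absolute_integral_change_of_variables_1'[OF _ der inj])
        (use kabs integral_unique[OF beta] in \<open>simp_all add: img\<close>)
    have "(\<lambda>x. \<bar>1 / (1 + x)^2\<bar> * k (g x)) absolutely_integrable_on {0<..} \<longleftrightarrow> f absolutely_integrable_on {0<..}"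
      unfolding set_integrable_def by (rule Bochner_Integration.integrable_cong) (auto simp: cv[simplified] indicator_def)
    moreover have "integral {0<..} (\<lambda>x. \<bar>1 / (1 + x)^2\<bar> * k (g x)) = integral {0<..} f"
      by (rule integral_cong) (use cv in auto)
    ultimately show ?thesis using * by simp
  qed
  note f_abs = this
  \<comment> \<open>The change of variables yields integrability for the completed measure; Borel
    measurability of the integrand brings it back to \<open>lborel\<close>.\<close>
  have m: "(\<lambda>x. indicat_real {0<..} x *\<^sub>R f x) \<in> borel_measurable borel"
    unfolding f_def by measurable
  from f_abs have "integrable lebesgue (\<lambda>x. indicat_real {0<..} x *\<^sub>R f x)"
    by (simp add: set_integrable_def)
  then show 1: "set_integrable lborel {0<..} f"
    unfolding set_integrable_def using m by (simp add: integrable_completion)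
  show "(LINT x:{0<..}|lborel. f x) = Beta d (1 - 2 * d)"
    using set_borel_integral_eq_integral(2)[OF 1] f_abs by simp
qed

text \<open>The map x |-> floor (h x) sends h times Lebesgue measure on the half-line to counting
  measure, because each index owns an interval of length 1 / h.\<close>

lemma suminf_eq_step_integral:
  fixes f :: "nat \<Rightarrow> real"
  assumes h: "0 < h" and f: "summable (\<lambda>i. \<bar>f i\<bar>)"
  shows "(LINT x:{0<..}|lborel. h * f (nat \<lfloor>h * x\<rfloor>)) = (\<Sum>i. f i)"
proof -
  define D :: "real measure" where "D = density lborel (\<lambda>x. ennreal (h * indicator {0<..} x))"
  define \<phi> where "\<phi> x = nat \<lfloor>h * x\<rfloor>" for x :: real
  have [measurable]: "\<phi> \<in> borel \<rightarrow>\<^sub>M count_space UNIV"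
    unfolding \<phi>_def by measurable
  then have [measurable]: "\<phi> \<in> D \<rightarrow>\<^sub>M count_space UNIV"
    by (simp add: D_def)
  have "distr D (count_space UNIV) \<phi> = count_space UNIV"
  proof (rule measure_eqI_countable[of _ UNIV])
    fix i :: nat
    \<comment> \<open>The cell of index 0 lacks its left endpoint, since only x > 0 is integrated;
      its length is still 1 / h.\<close>
    have set: "\<phi> -` {i} \<inter> {0<..} = (if i = 0 then {0<..<1/h} else {i/h..<(i+1)/h})"
    proof -
      have "\<phi> x = i \<and> 0 < x \<longleftrightarrow> x \<in> (if i = 0 then {0<..<1/h} else {i/h..<(i+1)/h})" for x
      proof (cases "0 < x")
        case True
        then have "\<phi> x = i \<longleftrightarrow> \<lfloor>h * x\<rfloor> = int i" unfolding \<phi>_def using h by (auto simp: nat_eq_iff)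
        also have "\<dots> \<longleftrightarrow> i \<le> h * x \<and> h * x < i + 1" by (auto simp: floor_eq_iff)
        finally show ?thesis
          using True h by (auto simp: pos_divide_le_eq pos_less_divide_eq mult.commute[of x h])
      next
        case False
        have "i / h > 0" if "i \<noteq> 0" using that h by simp
        then have "x \<notin> {i/h..<(i+1)/h}" if "i \<noteq> 0" using that False by force
        then show ?thesis using False by auto
      qed
      then show ?thesis by (intro set_eqI) (simp only: Int_iff vimage_eq singleton_iff greaterThan_iff)
    qed
    have "emeasure (distr D (count_space UNIV) \<phi>) {i} = emeasure D (\<phi> -` {i})"
      by (subst emeasure_distr) (auto simp: D_def)
    also have "\<dots> = (\<integral>\<^sup>+x. ennreal h * indicator (\<phi> -` {i} \<inter> {0<..}) x \<partial>lborel)"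
    proof -
      have "\<phi> -` {i} \<in> sets lborel"
        using measurable_sets[of \<phi> D "count_space UNIV" "{i}"] by (simp add: D_def)
      then show ?thesis
        unfolding D_def by (subst emeasure_density)
          (auto intro!: nn_integral_cong simp: indicator_def ennreal_mult' h)
    qed
    also have "\<dots> = ennreal h * emeasure lborel (\<phi> -` {i} \<inter> {0<..})"
      unfolding set by (subst nn_integral_cmult_indicator) auto
    also have "\<dots> = 1"
    proof -
      have "real (i + 1) / h - real i / h = 1 / h" by (simp add: diff_divide_distrib[symmetric])
      moreover have "real i / h \<le> real (i + 1) / h" using h by (simp add: divide_right_mono)
      ultimately have "emeasure lborel (\<phi> -` {i} \<inter> {0<..}) = ennreal (1 / h)"
        unfolding set using h by simp
      then show ?thesis using h by (simp add: ennreal_mult'[symmetric])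
    qed
    finally show "emeasure (distr D (count_space UNIV) \<phi>) {i} = emeasure (count_space UNIV) {i}" by simp
  qed auto
  then have "(\<Sum>i. f i) = (\<integral>i. f i \<partial>distr D (count_space UNIV) \<phi>)"
    using f by (simp add: integral_count_space_nat integrable_count_space_nat_iff)
  also have "\<dots> = (\<integral>x. f (\<phi> x) \<partial>D)"
    by (rule integral_distr) auto
  also have "\<dots> = (\<integral>x. h * indicator {0<..} x * f (\<phi> x) \<partial>lborel)"
  proof -
    have "(\<lambda>x. f (\<phi> x)) \<in> borel_measurable D" by measurable
    then have "(\<lambda>x. f (\<phi> x)) \<in> borel_measurable lborel" by (simp add: D_def)
    then show ?thesis unfolding D_def using h by (subst integral_density) auto
  qed
  finally show ?thesis
    by (simp add: set_lebesgue_integral_def \<phi>_def mult_ac)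
qed

text \<open>The shift to \<open>Suc i\<close> makes the bound meaningful at i = 0, where
  \<open>0 powr (d - 1)\<close> is 0 and would force the coefficient to vanish.\<close>

lemma regular_coeff_bound:
  fixes \<alpha> :: "nat \<Rightarrow> real"
  assumes "(\<lambda>k. \<alpha> k / real k powr (d - 1)) \<longlonglongrightarrow> 1"
  obtains C where "0 \<le> C" "\<And>i. \<bar>\<alpha> i\<bar> \<le> C * real (Suc i) powr (d - 1)"
proof -
  have "(\<lambda>k. real k powr (d - 1) / real (Suc k) powr (d - 1)) \<longlonglongrightarrow> 1" by real_asymp
  from tendsto_mult[OF assms this]
  have *: "(\<lambda>k. \<alpha> k / real k powr (d - 1) * (real k powr (d - 1) / real (Suc k) powr (d - 1))) \<longlonglongrightarrow> 1"
    by simp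
  have "(\<lambda>k. \<alpha> k / real (Suc k) powr (d - 1)) \<longlonglongrightarrow> 1"
    by (rule Lim_transform_eventually[OF *], rule eventually_sequentiallyI[of 1]) simp
  then have "Bseq (\<lambda>k. \<alpha> k / real (Suc k) powr (d - 1))" by (intro convergent_imp_Bseq convergentI)
  then obtain C where C: "0 < C" "\<And>k. \<bar>\<alpha> k / real (Suc k) powr (d - 1)\<bar> \<le> C"
    by (auto elim!: BseqE)
  have "\<bar>\<alpha> k\<bar> \<le> C * real (Suc k) powr (d - 1)" for k
    using C(2)[of k] by (simp add: abs_divide divide_le_eq del: of_nat_Suc)
  with C(1) show ?thesis by (intro that[of C]) auto
qed

text \<open>As d - 1 is negative, the shift by h only decreases the bound for the second
  coefficient, so (i + 1)^(2 d - 2) dominates uniformly in h. The exponent is below -1 because d < 1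
  / 2.\<close>

lemma autocov_bound_summable:
  fixes \<alpha> :: "nat \<Rightarrow> real" and e :: "nat \<Rightarrow> nat \<Rightarrow> real"
  assumes d: "d < 1 / 2" and C: "0 \<le> C" "\<And>i. \<bar>\<alpha> i\<bar> \<le> C * real (Suc i) powr (d - 1)"
    and K: "\<And>i h. \<bar>e i h\<bar> \<le> K"
  shows "summable (\<lambda>i. \<bar>\<alpha> i * \<alpha> (h + i) * e i h\<bar>)"
proof (rule summable_comparison_test')
  have "summable (\<lambda>i. real i powr (2 * d - 2))"
    using d by (simp add: summable_real_powr_iff)
  then have "summable (\<lambda>i. real (Suc i) powr (2 * d - 2))"
    by (subst summable_Suc_iff)
  then show "summable (\<lambda>i. C * C * K * real (Suc i) powr (2 * d - 2))"
    by (rule summable_mult)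
  fix i
  have "\<bar>\<alpha> (h + i)\<bar> \<le> C * real (Suc i) powr (d - 1)"
    using C(2)[of "h + i"]
    by (rule order_trans) (use d C(1) in \<open>auto intro!: mult_left_mono powr_mono2'\<close>)
  then have "\<bar>\<alpha> i\<bar> * \<bar>\<alpha> (h + i)\<bar> * \<bar>e i h\<bar> \<le>
      (C * real (Suc i) powr (d - 1)) * (C * real (Suc i) powr (d - 1)) * K"
    by (intro mult_mono C(2) K) (use C(1) in auto)
  also have "\<dots> = C * C * K * real (Suc i) powr (2 * d - 2)"
  proof -
    have "real (Suc i) powr (2 * d - 2) = real (Suc i) powr (d - 1) * real (Suc i) powr (d - 1)"
      by (subst powr_add[symmetric]) simp
    then show ?thesis by simp
  qed
  finally show "norm \<bar>\<alpha> i * \<alpha> (h + i) * e i h\<bar> \<le> C * C * K * real (Suc i) powr (2 * d - 2)"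
    by (simp add: abs_mult)
qed

text \<open>After rescaling by \<open>h\<close> the series is the integral of a step function over the half-line, to which
  dominated convergence applies.\<close>

lemma weighted_autocov_asymp:
  fixes \<alpha> :: "nat \<Rightarrow> real" and e :: "nat \<Rightarrow> nat \<Rightarrow> real"
  assumes d: "0 < d" "d < 1 / 2" and \<alpha>: "(\<lambda>k. \<alpha> k / real k powr (d - 1)) \<longlonglongrightarrow> 1"
    and K: "\<And>i h. \<bar>e i h\<bar> \<le> K"
    and e: "\<And>\<epsilon>. 0 < \<epsilon> \<Longrightarrow> \<exists>m. \<forall>i\<ge>m. \<forall>h\<ge>m. \<bar>e i h - \<kappa>\<bar> < \<epsilon>"
  shows "(\<lambda>h. (\<Sum>i. \<alpha> i * \<alpha> (h + i) * e i h) / real h powr (2 * d - 1))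
    \<longlonglongrightarrow> \<kappa> * Beta d (1 - 2 * d)"
proof -
  obtain C where C: "0 \<le> C" "\<And>i. \<bar>\<alpha> i\<bar> \<le> C * real (Suc i) powr (d - 1)"
    using regular_coeff_bound[OF \<alpha>] by blast
  define N where "N h x = nat \<lfloor>real h * x\<rfloor>" for h and x :: real
  define G where "G h x = real h powr (2 - 2 * d) * (\<alpha> (N h x) * \<alpha> (h + N h x) * e (N h x) h)" for h x
  define f where "f x = x powr (d - 1) * (1 + x) powr (d - 1)" for x :: real
  have f_int: "set_integrable lborel {0<..} f" "(LINT x:{0<..}|lborel. f x) = Beta d (1 - 2 * d)"
    using beta_integral_half_line[OF d] unfolding f_def by auto
  have scale: "(\<Sum>i. \<alpha> i * \<alpha> (h + i) * e i h) / real h powr (2 * d - 1) = (LINT x:{0<..}|lborel. G h x)"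
    if "h > 0" for h
  proof -
    have "(\<Sum>i. \<alpha> i * \<alpha> (h + i) * e i h) =
      (LINT x:{0<..}|lborel. real h * (\<alpha> (N h x) * \<alpha> (h + N h x) * e (N h x) h))"
      unfolding N_def
      by (rule suminf_eq_step_integral[symmetric, where f="\<lambda>i. \<alpha> i * \<alpha> (h + i) * e i h"])
        (use that autocov_bound_summable[of d C \<alpha> e K h] d C K in auto)
    then have *: "(\<Sum>i. \<alpha> i * \<alpha> (h + i) * e i h) / real h powr (2 * d - 1) =
      (LINT x:{0<..}|lborel. (1 / real h powr (2 * d - 1)) * (real h * (\<alpha> (N h x) * \<alpha> (h + N h x) * e (N h x) h)))"
      by simp
    have "(\<lambda>y. 1 / real h powr (2 * d - 1) * (real h * y)) = (\<lambda>y. real h powr (2 - 2 * d) * y)"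
    proof
      fix y
      have "1 / real h powr (2 * d - 1) * real h = real h powr (- (2 * d - 1)) * real h powr 1"
        using that by (simp only: powr_minus_divide powr_one)
      also have "\<dots> = real h powr (2 - 2 * d)" unfolding powr_add[symmetric] by simp
      finally show "1 / real h powr (2 * d - 1) * (real h * y) = real h powr (2 - 2 * d) * y"
        by (simp only: mult.assoc[symmetric])
    qed
    note this[THEN fun_cong]
    then show ?thesis using * unfolding G_def by (simp only:)
  qed
  \<comment> \<open>Since floor (h x) + 1 is at least h x, the decreasing powers may be evaluated at
    h x and h (1 + x). All powers of h then cancel, which leaves a majorant free of h.\<close>
  have dom: "\<bar>G h x\<bar> \<le> C * C * K * f x" if h: "h > 0" and x: "x > 0" for h x
  proof -
    have n1: "real h * x \<le> real (Suc (N h x))" unfolding N_def using h x by (simp add: le_floor_iff) linarith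
    have hx: "0 < real h * x" using h x by simp
    have "\<bar>\<alpha> (N h x)\<bar> \<le> C * (real h * x) powr (d - 1)"
      by (rule order_trans[OF C(2)]) (use n1 hx d C(1) in \<open>auto intro!: mult_left_mono powr_mono2'\<close>)
    moreover have "\<bar>\<alpha> (h + N h x)\<bar> \<le> C * (real h * (1 + x)) powr (d - 1)"
      by (rule order_trans[OF C(2)])
        (use n1 hx d C(1) h x in \<open>auto intro!: mult_left_mono powr_mono2' add_pos_pos simp: algebra_simps\<close>)
    ultimately have "\<bar>\<alpha> (N h x)\<bar> * \<bar>\<alpha> (h + N h x)\<bar> * \<bar>e (N h x) h\<bar> \<le>
      (C * (real h * x) powr (d - 1)) * (C * (real h * (1 + x)) powr (d - 1)) * K"
      by (intro mult_mono K) (use C(1) in auto)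
    then have "\<bar>G h x\<bar> \<le> real h powr (2 - 2 * d) *
      ((C * (real h * x) powr (d - 1)) * (C * (real h * (1 + x)) powr (d - 1)) * K)"
      unfolding G_def abs_mult by (auto intro!: mult_left_mono)
    also have "\<dots> = (real h powr (2 - 2 * d) * real h powr (d - 1) * real h powr (d - 1)) * (C * C * K * f x)"
      using h x by (simp add: powr_mult f_def)
    also have "real h powr (2 - 2 * d) * real h powr (d - 1) * real h powr (d - 1) = 1"
      using h by (simp flip: powr_add)
    finally show ?thesis by simp
  qed
  have lim: "(\<lambda>h. G h x) \<longlonglongrightarrow> \<kappa> * f x" if x: "x > 0" for x
  proof -
    have Nh: "(\<lambda>h. real (N h x) / real h) \<longlonglongrightarrow> x"
    proof (rule LIMSEQ_I)
      fix r :: real assume "0 < r"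
      then obtain n0 where n0: "1 / r < real n0" using reals_Archimedean2 by blast
      have "norm (real (N h x) / real h - x) < r" if "h \<ge> Suc n0" for h
      proof -
        have h: "1 / r < real h" "0 < real h" using n0 that by auto
        have "real (N h x) = of_int \<lfloor>real h * x\<rfloor>" unfolding N_def using x by simp
        then have "real (N h x) \<le> real h * x" "real h * x < real (N h x) + 1" by linarith+
        then have "\<bar>real (N h x) / real h - x\<bar> \<le> 1 / real h"
        proof -
          have "real (N h x) / real h - x = (real (N h x) - real h * x) / real h"
            using h(2) by (simp add: diff_divide_distrib)
          then show ?thesis
            using \<open>real (N h x) \<le> real h * x\<close> \<open>real h * x < real (N h x) + 1\<close> h(2)
            by (simp only: abs_divide) (auto intro!: divide_right_mono)
        qed
        also have "\<dots> < r" using h \<open>0 < r\<close> by (simp add: field_simps)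
        finally show ?thesis by simp
      qed
      then show "\<exists>n0. \<forall>h\<ge>n0. norm (real (N h x) / real h - x) < r" by blast
    qed
    have Ntop: "filterlim (\<lambda>h. N h x) at_top sequentially"
    proof (subst filterlim_at_top, intro allI)
      fix m :: nat
      obtain n0 where n0: "real m / x < real n0" using reals_Archimedean2 by blast
      have "m \<le> N h x" if "h \<ge> n0" for h
      proof -
        have "real m / x \<le> real h" using n0 that by linarith
        then have "real m \<le> real h * x" using x by (simp add: field_simps)
        then show ?thesis unfolding N_def by (simp add: le_nat_iff le_floor_iff)
      qed
      then show "\<forall>\<^sub>F h in sequentially. m \<le> N h x" unfolding eventually_sequentially by blast
    qed
    have Nh1: "(\<lambda>h. real (h + N h x) / real h) \<longlonglongrightarrow> 1 + x"
    proof -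
      have "(\<lambda>h. 1 + real (N h x) / real h) \<longlonglongrightarrow> 1 + x" by (intro tendsto_intros Nh)
      then show ?thesis
        by (rule Lim_transform_eventually, intro eventually_sequentiallyI[of 1])
          (simp add: add_divide_distrib)
    qed
    have Ntop1: "filterlim (\<lambda>h. h + N h x) at_top sequentially"
      by (rule filterlim_at_top_mono[OF filterlim_ident]) auto
    have a1: "(\<lambda>h. \<alpha> (N h x) / real (N h x) powr (d - 1)) \<longlonglongrightarrow> 1"
      by (rule filterlim_compose[OF \<alpha> Ntop])
    have a2: "(\<lambda>h. \<alpha> (h + N h x) / real (h + N h x) powr (d - 1)) \<longlonglongrightarrow> 1"
      by (rule filterlim_compose[OF \<alpha> Ntop1])
    have eN: "(\<lambda>h. e (N h x) h) \<longlonglongrightarrow> \<kappa>"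
    proof (rule LIMSEQ_I)
      fix \<epsilon> :: real assume "0 < \<epsilon>"
      then obtain m where m: "\<forall>i\<ge>m. \<forall>h\<ge>m. \<bar>e i h - \<kappa>\<bar> < \<epsilon>" using e by blast
      have "\<forall>\<^sub>F h in sequentially. N h x \<ge> m \<and> h \<ge> m"
        by (rule eventually_conj[OF filterlim_at_top[THEN iffD1, OF Ntop, rule_format] eventually_ge_at_top])
      then show "\<exists>n0. \<forall>n\<ge>n0. norm (e (N n x) n - \<kappa>) < \<epsilon>"
        unfolding eventually_sequentially using m by (metis real_norm_def)
    qed
    \<comment> \<open>Each coefficient is split into its ratio to the power N^(d - 1), which tends
      to 1, and (N / h)^(d - 1), which converges because N / h tends to x.\<close>
    have *: "(\<lambda>h. (\<alpha> (N h x) / real (N h x) powr (d - 1) * (real (N h x) / real h) powr (d - 1)) *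
        (\<alpha> (h + N h x) / real (h + N h x) powr (d - 1) * (real (h + N h x) / real h) powr (d - 1)) * e (N h x) h)
      \<longlonglongrightarrow> (1 * x powr (d - 1)) * (1 * (1 + x) powr (d - 1)) * \<kappa>"
      by (intro tendsto_intros a1 a2 Nh Nh1 eN) (use x in auto)
    have "\<forall>\<^sub>F h in sequentially. N h x \<ge> 1 \<and> h \<ge> 1"
      by (rule eventually_conj[OF filterlim_at_top[THEN iffD1, OF Ntop, rule_format] eventually_ge_at_top])
    then have ev: "\<forall>\<^sub>F h in sequentially.
        (\<alpha> (N h x) / real (N h x) powr (d - 1) * (real (N h x) / real h) powr (d - 1)) *
        (\<alpha> (h + N h x) / real (h + N h x) powr (d - 1) * (real (h + N h x) / real h) powr (d - 1)) * e (N h x) h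
        = G h x"
    proof (rule eventually_mono)
      fix h assume h: "N h x \<ge> 1 \<and> h \<ge> 1"
      have "real h powr (2 - 2 * d) = (1 / real h powr (d - 1)) * (1 / real h powr (d - 1))"
        using h unfolding powr_minus_divide[symmetric] powr_add[symmetric] by simp
      then show "(\<alpha> (N h x) / real (N h x) powr (d - 1) * (real (N h x) / real h) powr (d - 1)) *
        (\<alpha> (h + N h x) / real (h + N h x) powr (d - 1) * (real (h + N h x) / real h) powr (d - 1)) * e (N h x) h
        = G h x"
        unfolding G_def using h by (simp add: powr_divide)
    qed
    show ?thesis
      using Lim_transform_eventually[OF * ev] by (simp add: f_def mult_ac)
  qed
  have meas: "(\<lambda>x. G h x) \<in> borel_measurable borel" for h
  proof -
    have [measurable]: "(\<lambda>x. N h x) \<in> borel \<rightarrow>\<^sub>M count_space UNIV"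
      unfolding N_def by measurable
    show ?thesis unfolding G_def by measurable
  qed
  \<comment> \<open>The sequence runs along \<open>Suc h\<close>, as the majorant is available for
    positive h.\<close>
  have "(\<lambda>h. LINT x|lborel. indicator {0<..} x *\<^sub>R G (Suc h) x) \<longlonglongrightarrow> (LINT x|lborel. indicator {0<..} x *\<^sub>R (\<kappa> * f x))"
  proof (rule integral_dominated_convergence[where w="\<lambda>x. indicator {0<..} x *\<^sub>R (C * C * K * f x)"])
    show "integrable lborel (\<lambda>x. indicat_real {0<..} x *\<^sub>R (C * C * K * f x))"
      using set_integrable_mult_right[OF f_int(1), of "C * C * K"] unfolding set_integrable_def
      by (simp add: mult_ac)
    show "AE x in lborel. (\<lambda>h. indicat_real {0<..} x *\<^sub>R G (Suc h) x) \<longlonglongrightarrow> indicat_real {0<..} x *\<^sub>R (\<kappa> * f x)"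
    proof (rule AE_I2)
      fix x :: real
      show "(\<lambda>h. indicat_real {0<..} x *\<^sub>R G (Suc h) x) \<longlonglongrightarrow> indicat_real {0<..} x *\<^sub>R (\<kappa> * f x)"
        using LIMSEQ_Suc[OF lim[of x]] by (cases "x > 0") (auto simp: indicator_def)
    qed
    show "AE x in lborel. norm (indicat_real {0<..} x *\<^sub>R G (Suc h) x) \<le> indicat_real {0<..} x *\<^sub>R (C * C * K * f x)" for h
      using dom[of "Suc h"] by (intro AE_I2) (auto simp: indicator_def)
  qed (use meas in \<open>auto simp: f_def\<close>)
  then have "(\<lambda>h. LINT x:{0<..}|lborel. G (Suc h) x) \<longlonglongrightarrow> (LINT x:{0<..}|lborel. \<kappa> * f x)"
    unfolding set_lebesgue_integral_def .
  then have "(\<lambda>h. LINT x:{0<..}|lborel. G (Suc h) x) \<longlonglongrightarrow> \<kappa> * Beta d (1 - 2 * d)"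
    by (simp add: f_int(2))
  then have "(\<lambda>h. (\<Sum>i. \<alpha> i * \<alpha> (Suc h + i) * e i (Suc h)) / real (Suc h) powr (2 * d - 1)) \<longlonglongrightarrow> \<kappa> * Beta d (1 - 2 * d)"
    by (simp only: scale[OF zero_less_Suc])
  then show ?thesis by (rule LIMSEQ_imp_Suc)
qed

section \<open>Square integrable functions and the innovations\<close>

definition sqint :: "'a measure \<Rightarrow> ('a \<Rightarrow> real) set" where
  "sqint M = {f \<in> borel_measurable M. integrable M (\<lambda>x. (f x)\<^sup>2)}"

lemma sqintI: "f \<in> borel_measurable M \<Longrightarrow> integrable M (\<lambda>x. (f x)\<^sup>2) \<Longrightarrow> f \<in> sqint M"
  by (simp add: sqint_def)

lemma sqintD:
  assumes "f \<in> sqint M"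
  shows "f \<in> borel_measurable M" "integrable M (\<lambda>x. (f x)\<^sup>2)"
  using assms by (auto simp: sqint_def)

lemma sqint_mult:
  assumes "f \<in> sqint M" "g \<in> sqint M"
  shows "integrable M (\<lambda>x. f x * g x)"
proof (rule Bochner_Integration.integrable_bound)
  show "integrable M (\<lambda>x. (f x)\<^sup>2 + (g x)\<^sup>2)"
    using assms by (auto dest: sqintD)
  show "(\<lambda>x. f x * g x) \<in> borel_measurable M"
    using assms by (auto dest: sqintD intro!: borel_measurable_times)
  show "AE x in M. norm (f x * g x) \<le> norm ((f x)\<^sup>2 + (g x)\<^sup>2)"
  proof (rule AE_I2)
    fix x
    have "0 \<le> (\<bar>f x\<bar> - \<bar>g x\<bar>)\<^sup>2" by simp
    then have "2 * (\<bar>f x\<bar> * \<bar>g x\<bar>) \<le> (f x)\<^sup>2 + (g x)\<^sup>2" by (simp add: power2_diff)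
    moreover have "0 \<le> \<bar>f x\<bar> * \<bar>g x\<bar>" by simp
    ultimately have "\<bar>f x\<bar> * \<bar>g x\<bar> \<le> (f x)\<^sup>2 + (g x)\<^sup>2" by linarith
    then show "norm (f x * g x) \<le> norm ((f x)\<^sup>2 + (g x)\<^sup>2)" by (simp add: abs_mult)
  qed
qed

lemma sqint_cmult: "f \<in> sqint M \<Longrightarrow> (\<lambda>x. c * f x) \<in> sqint M"
  by (auto simp: sqint_def power_mult_distrib)

lemma sqint_uminus: "f \<in> sqint M \<Longrightarrow> (\<lambda>x. - f x) \<in> sqint M"
  by (auto simp: sqint_def)

lemma sqint_add:
  assumes "f \<in> sqint M" "g \<in> sqint M"
  shows "(\<lambda>x. f x + g x) \<in> sqint M"
  using assms sqint_mult[OF assms]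
  by (auto simp: sqint_def power2_sum mult.assoc intro!: Bochner_Integration.integrable_add)

lemma sqint_diff: "f \<in> sqint M \<Longrightarrow> g \<in> sqint M \<Longrightarrow> (\<lambda>x. f x - g x) \<in> sqint M"
  using sqint_add[of f M "\<lambda>x. - g x"] sqint_uminus[of g M] by simp

lemma sqint_0: "(\<lambda>x. 0) \<in> sqint M"
  by (simp add: sqint_def)

lemma sqint_sum: "(\<And>i. i \<in> I \<Longrightarrow> f i \<in> sqint M) \<Longrightarrow> (\<lambda>x. \<Sum>i\<in>I. f i x) \<in> sqint M"
  by (induction I rule: infinite_finite_induct) (auto intro: sqint_add sqint_0)

lemma (in finite_measure) sqint_const: "(\<lambda>x. c) \<in> sqint M"
  by (simp add: sqint_def)

lemma (in finite_measure) sqint_integrable: "f \<in> sqint M \<Longrightarrow> integrable M f"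
  by (auto dest: sqintD intro: square_integrable_imp_integrable)

lemma sqint_linear_growth:
  assumes "finite_measure M" "f \<in> sqint M" "Q \<in> borel_measurable borel"
    "\<And>x. (Q x)\<^sup>2 \<le> a + b * x\<^sup>2"
  shows "(\<lambda>x. Q (f x)) \<in> sqint M"
proof (rule sqintI)
  interpret finite_measure M by fact
  show "(\<lambda>x. Q (f x)) \<in> borel_measurable M"
    using assms(2,3) by (auto dest: sqintD)
  then show "integrable M (\<lambda>x. (Q (f x))\<^sup>2)"
    by (rule Bochner_Integration.integrable_bound[where f="\<lambda>x. a + b * (f x)\<^sup>2", rotated, OF borel_measurable_power])
      (use assms in \<open>auto dest!: sqintD intro!: AE_I2 order_trans[OF assms(4)]\<close>)
qed

text \<open>The integral of (s f - t g)^2 is a nonnegative quadratic form in s and t. The choice s =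
  b, t = c turns it into b (a b - c^2), which settles the case b > 0.\<close>

lemma sqint_Cauchy_Schwarz_power2:
  assumes f: "f \<in> sqint M" and g: "g \<in> sqint M"
  shows "(LINT x|M. f x * g x)\<^sup>2 \<le> (LINT x|M. (f x)\<^sup>2) * (LINT x|M. (g x)\<^sup>2)"
proof -
  define a b c where "a = (LINT x|M. (f x)\<^sup>2)" and "b = (LINT x|M. (g x)\<^sup>2)"
    and "c = (LINT x|M. f x * g x)"
  have quad: "0 \<le> s\<^sup>2 * a - 2 * s * t * c + t\<^sup>2 * b" for s t
  proof -
    have "0 \<le> (LINT x|M. (s * f x - t * g x)\<^sup>2)" by simp
    also have "\<dots> = (LINT x|M. s\<^sup>2 * (f x)\<^sup>2 - 2 * s * t * (f x * g x) + t\<^sup>2 * (g x)\<^sup>2)"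
      by (intro Bochner_Integration.integral_cong refl) (simp add: power2_diff power_mult_distrib)
    also have "\<dots> = s\<^sup>2 * a - 2 * s * t * c + t\<^sup>2 * b"
      unfolding a_def b_def c_def using sqintD(2)[OF f] sqintD(2)[OF g] sqint_mult[OF f g]
      by (subst Bochner_Integration.integral_add Bochner_Integration.integral_diff;
        (intro Bochner_Integration.integrable_diff integrable_mult_right)?; simp)+
    finally show ?thesis .
  qed
  have b0: "0 \<le> b" unfolding b_def by simp
  show ?thesis
  proof (cases "b = 0")
    case True
    have "c = 0"
    proof (rule ccontr)
      assume "c \<noteq> 0"
      \<comment> \<open>With b = 0 the form is affine in t; at this t its value is -1.\<close>
      then show False using quad[of 1 "(a + 1) / (2 * c)"] True by (simp add: field_simps)
    qed
    then show ?thesis using True unfolding a_def b_def c_def by simp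
  next
    case False
    have "0 \<le> b * (a * b - c\<^sup>2)"
      using quad[of b c] by (simp add: power2_eq_square algebra_simps)
    then have "0 \<le> a * b - c\<^sup>2" using False b0 by (simp add: zero_le_mult_iff)
    then show ?thesis unfolding a_def b_def c_def by simp
  qed
qed

lemma sqint_Cauchy_Schwarz:
  assumes f: "f \<in> sqint M" and g: "g \<in> sqint M"
  shows "\<bar>LINT x|M. f x * g x\<bar> \<le> sqrt (LINT x|M. (f x)\<^sup>2) * sqrt (LINT x|M. (g x)\<^sup>2)"
  using real_sqrt_le_mono[OF sqint_Cauchy_Schwarz_power2[OF assms]]
  by (simp add: real_sqrt_mult)

lemma (in prob_space) expectation_abs_le_sqrt:
  assumes f: "f \<in> sqint M"
  shows "expectation (\<lambda>x. \<bar>f x\<bar>) \<le> sqrt (expectation (\<lambda>x. (f x)\<^sup>2))"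
proof -
  have "(\<lambda>x. \<bar>f x\<bar>) \<in> sqint M" using f by (auto simp: sqint_def)
  from sqint_Cauchy_Schwarz[OF this sqint_const[of 1]] show ?thesis by (simp add: prob_space)
qed

text \<open>The difference of the two inner products splits into three terms, each with a factor
  that is small in mean square. Covariances of X are obtained from those of its truncations in this
  way.\<close>

lemma sqint_inner_tendsto:
  assumes f: "\<And>n. f n \<in> sqint M" "f' \<in> sqint M" "(\<lambda>n. LINT x|M. (f' x - f n x)\<^sup>2) \<longlonglongrightarrow> 0"
    and g: "\<And>n. g n \<in> sqint M" "g' \<in> sqint M" "(\<lambda>n. LINT x|M. (g' x - g n x)\<^sup>2) \<longlonglongrightarrow> 0"
  shows "(\<lambda>n. LINT x|M. f n x * g n x) \<longlonglongrightarrow> (LINT x|M. f' x * g' x)"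
proof -
  define A B where "A n = (LINT x|M. (f' x - f n x)\<^sup>2)" and "B n = (LINT x|M. (g' x - g n x)\<^sup>2)" for n
  have fd: "(\<lambda>x. f' x - f n x) \<in> sqint M" and gd: "(\<lambda>x. g' x - g n x) \<in> sqint M" for n
    using f g by (auto intro: sqint_diff)
  have "(\<lambda>n. (LINT x|M. f n x * g n x) - (LINT x|M. f' x * g' x)) \<longlonglongrightarrow> 0"
  proof (rule Lim_null_comparison)
    show "(\<lambda>n. sqrt (A n) * sqrt (B n) + sqrt (LINT x|M. (f' x)\<^sup>2) * sqrt (B n) + sqrt (A n) * sqrt (LINT x|M. (g' x)\<^sup>2)) \<longlonglongrightarrow> 0"
      using f(3) g(3) unfolding A_def[symmetric] B_def[symmetric]
      by (auto intro!: tendsto_eq_intros)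
    have "norm ((LINT x|M. f n x * g n x) - (LINT x|M. f' x * g' x))
      \<le> sqrt (A n) * sqrt (B n) + sqrt (LINT x|M. (f' x)\<^sup>2) * sqrt (B n) + sqrt (A n) * sqrt (LINT x|M. (g' x)\<^sup>2)" for n
    proof -
      have "(LINT x|M. f n x * g n x) - (LINT x|M. f' x * g' x) = (LINT x|M. f n x * g n x - f' x * g' x)"
        by (intro Bochner_Integration.integral_diff[symmetric] sqint_mult f g)
      also have "\<dots> = (LINT x|M. ((f' x - f n x) * (g' x - g n x) - f' x * (g' x - g n x)) - (f' x - f n x) * g' x)"
        by (intro Bochner_Integration.integral_cong refl) (simp add: algebra_simps)
      also have "\<dots> = (LINT x|M. (f' x - f n x) * (g' x - g n x)) - (LINT x|M. f' x * (g' x - g n x)) - (LINT x|M. (f' x - f n x) * g' x)"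
        by (intro trans[OF Bochner_Integration.integral_diff] arg_cong2[where f="(-)"] Bochner_Integration.integral_diff refl
            Bochner_Integration.integrable_diff sqint_mult fd gd f(2) g(2))
      finally show ?thesis
        using sqint_Cauchy_Schwarz[OF fd[of n] gd[of n]] sqint_Cauchy_Schwarz[OF f(2) gd[of n]]
          sqint_Cauchy_Schwarz[OF fd[of n] g(2)]
        unfolding A_def B_def real_norm_def by linarith
    qed
    then show "\<forall>\<^sub>F n in sequentially. norm ((LINT x|M. f n x * g n x) - (LINT x|M. f' x * g' x))
      \<le> sqrt (A n) * sqrt (B n) + sqrt (LINT x|M. (f' x)\<^sup>2) * sqrt (B n) + sqrt (A n) * sqrt (LINT x|M. (g' x)\<^sup>2)"
      by simp
  qed
  then show ?thesis by (rule LIM_zero_cancel)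
qed

lemma integral_sum_power2:
  fixes f :: "'i \<Rightarrow> 'a \<Rightarrow> real"
  assumes "\<And>i. i \<in> I \<Longrightarrow> f i \<in> sqint M"
  shows "(LINT x|M. (\<Sum>i\<in>I. f i x)\<^sup>2) = (\<Sum>i\<in>I. \<Sum>j\<in>I. LINT x|M. f i x * f j x)"
  unfolding power2_eq_square sum_product using assms
  by (simp add: Bochner_Integration.integral_sum Bochner_Integration.integrable_sum sqint_mult)

lemma sqint_sum_tendsto_0:
  fixes f :: "'i \<Rightarrow> nat \<Rightarrow> 'a \<Rightarrow> real"
  assumes f: "\<And>i n. i \<in> I \<Longrightarrow> f i n \<in> sqint M"
    and lim: "\<And>i. i \<in> I \<Longrightarrow> (\<lambda>n. LINT x|M. (f i n x)\<^sup>2) \<longlonglongrightarrow> 0"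
  shows "(\<lambda>n. LINT x|M. (\<Sum>i\<in>I. f i n x)\<^sup>2) \<longlonglongrightarrow> 0"
proof -
  have "(\<lambda>n. \<Sum>i\<in>I. \<Sum>j\<in>I. LINT x|M. f i n x * f j n x) \<longlonglongrightarrow> (\<Sum>i\<in>I. \<Sum>j\<in>I. 0)"
  proof (intro tendsto_sum)
    fix i j assume ij: "i \<in> I" "j \<in> I"
    have "(\<lambda>n. LINT x|M. f i n x * f j n x) \<longlonglongrightarrow> (LINT x|M. 0 * 0)"
      using f[OF ij(1)] f[OF ij(2)] lim[OF ij(1)] lim[OF ij(2)] sqint_0
      by (intro sqint_inner_tendsto) auto
    then show "(\<lambda>n. LINT x|M. f i n x * f j n x) \<longlonglongrightarrow> 0" by simp
  qed
  then show ?thesis using f by (simp add: integral_sum_power2)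
qed

section \<open>The innovations, the sigma-algebras they generate, and products over disjoint blocks
  of times\<close>

locale iid_noise = prob_space M for M :: "'a measure" +
  fixes \<zeta> :: "int \<Rightarrow> 'a \<Rightarrow> real"
  assumes indep: "indep_vars (\<lambda>_. borel) \<zeta> UNIV"
    and ident: "\<And>t. distr M borel (\<zeta> t) = distr M borel (\<zeta> 0)"
    and square_integrable_0: "integrable M (\<lambda>\<omega>. (\<zeta> 0 \<omega>)\<^sup>2)"
    and mean_0: "(\<integral>\<omega>. \<zeta> 0 \<omega> \<partial>M) = 0"
    and variance_1: "(\<integral>\<omega>. (\<zeta> 0 \<omega>)\<^sup>2 \<partial>M) = 1"
begin

abbreviation noise :: "int set \<Rightarrow> 'a measure" where
  "noise U \<equiv> noise_algebra M \<zeta> U"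

lemma zeta_measurable [measurable]: "\<zeta> t \<in> borel_measurable M"
  using indep by (simp add: indep_vars_def)

lemma expectation_zeta_transfer:
  assumes [measurable]: "h \<in> borel_measurable borel"
  shows "expectation (\<lambda>\<omega>. h (\<zeta> t \<omega>)) = expectation (\<lambda>\<omega>. (h :: real \<Rightarrow> real) (\<zeta> 0 \<omega>))"
    and "integrable M (\<lambda>\<omega>. h (\<zeta> t \<omega>)) \<longleftrightarrow> integrable M (\<lambda>\<omega>. h (\<zeta> 0 \<omega>))"
  using ident[of t]
  by (simp_all add: integral_distr[symmetric, where N=borel and f=h and M=M] integrable_distr_eq[symmetric, where N=borel and f=h and M=M])

lemma zeta_sqint: "\<zeta> t \<in> sqint M"
  using expectation_zeta_transfer(2)[of "\<lambda>x. x\<^sup>2" t] square_integrable_0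
  by (auto simp: sqint_def)

lemma expectation_zeta: "expectation (\<zeta> t) = 0"
  using expectation_zeta_transfer(1)[of "\<lambda>x. x" t] mean_0 by simp

lemma expectation_zeta2: "expectation (\<lambda>\<omega>. (\<zeta> t \<omega>)\<^sup>2) = 1"
  using expectation_zeta_transfer(1)[of "\<lambda>x. x\<^sup>2" t] variance_1 by simp

lemma space_noise [simp]: "space (noise U) = space M"
  by (simp add: noise_algebra_def space_measure_of_conv)

lemma sets_noise:
  "sets (noise U) = sigma_sets (space M) (\<Union>u\<in>U. {\<zeta> u -` A \<inter> space M | A. A \<in> sets borel})"
  unfolding noise_algebra_def by (rule sets_measure_of) auto

lemma subalgebra_noise: "subalgebra M (noise U)"
proof -
  have "sigma_sets (space M) (\<Union>u\<in>U. {\<zeta> u -` A \<inter> space M | A. A \<in> sets borel}) \<subseteq> sets M"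
    by (rule sets.sigma_sets_subset) (blast intro: measurable_sets zeta_measurable)
  then show ?thesis by (simp add: subalgebra_def sets_noise)
qed

lemma noise_measurable_M: "f \<in> borel_measurable (noise U) \<Longrightarrow> f \<in> borel_measurable M"
  by (rule measurable_from_subalg[OF subalgebra_noise])

lemma noise_measurable_mono:
  assumes "U \<subseteq> V" "f \<in> measurable (noise U) N"
  shows "f \<in> measurable (noise V) N"
proof -
  have "sets (noise U) \<subseteq> sets (noise V)"
    unfolding sets_noise using assms(1) by (intro sigma_sets_mono') auto
  then show ?thesis using assms(2) by (auto simp: measurable_def)
qed

lemma zeta_noise_measurable:
  assumes "u \<in> U"
  shows "\<zeta> u \<in> borel_measurable (noise U)"
proof (rule measurableI)
  fix A :: "real set" assume "A \<in> sets borel"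
  then show "\<zeta> u -` A \<inter> space (noise U) \<in> sets (noise U)"
    unfolding sets_noise space_noise using assms by (intro sigma_sets.Basic) auto
qed auto

text \<open>The events of a single innovation are stable under intersection, so independence of the
  innovations passes to the sigma-algebras generated by disjoint blocks.\<close>

lemma noise_indep_var:
  assumes "U \<inter> V = {}" "f \<in> borel_measurable (noise U)" "g \<in> borel_measurable (noise V)"
  shows "indep_var borel f borel g"
proof -
  define E where "E u = {\<zeta> u -` A \<inter> space M | A. A \<in> sets (borel :: real measure)}" for u
  have "indep_sets E UNIV"
    using indep unfolding indep_vars_def2 E_def by blast
  then have 1: "indep_sets E (\<Union>j\<in>UNIV. case_bool U V j)"
    by (rule indep_sets_mono_index[rotated]) simp
  have "indep_sets (\<lambda>j. sigma_sets (space M) (\<Union>i\<in>case_bool U V j. E i)) UNIV"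
  proof (rule indep_sets_collect_sigma[OF 1])
    show "Int_stable (E i)" for i
    proof (rule Int_stableI)
      fix a b assume "a \<in> E i" "b \<in> E i"
      then obtain A B where "a = \<zeta> i -` A \<inter> space M" "b = \<zeta> i -` B \<inter> space M" "A \<in> sets borel" "B \<in> sets borel"
        unfolding E_def by blast
      then show "a \<inter> b \<in> E i" unfolding E_def by (auto intro!: exI[of _ "A \<inter> B"])
    qed
    show "disjoint_family_on (case_bool U V) UNIV"
      using assms(1) by (auto simp: disjoint_family_on_def split: bool.split)
  qed
  then have 2: "indep_sets (\<lambda>j. sets (noise (case_bool U V j))) UNIV"
    unfolding sets_noise E_def .
  show ?thesis
    unfolding indep_var_eq
  proof (intro conjI)
    show "random_variable borel f" "random_variable borel g"
      using assms noise_measurable_M by auto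
    have "{f -` A \<inter> space M |A. A \<in> sets borel} \<subseteq> sets (noise U)"
      using measurable_sets[OF assms(2)] by auto
    then have f: "sigma_sets (space M) {f -` A \<inter> space M |A. A \<in> sets borel} \<subseteq> sets (noise U)"
      using sets.sigma_sets_subset[of _ "noise U"] by simp
    have "{g -` A \<inter> space M |A. A \<in> sets borel} \<subseteq> sets (noise V)"
      using measurable_sets[OF assms(3)] by auto
    then have g: "sigma_sets (space M) {g -` A \<inter> space M |A. A \<in> sets borel} \<subseteq> sets (noise V)"
      using sets.sigma_sets_subset[of _ "noise V"] by simp
    show "indep_set (sigma_sets (space M) {f -` A \<inter> space M |A. A \<in> sets borel})
       (sigma_sets (space M) {g -` A \<inter> space M |A. A \<in> sets borel})"
      unfolding indep_set_def
      by (rule indep_sets_mono_sets[OF 2]) (use f g in \<open>auto split: bool.split\<close>)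
  qed
qed

lemma noise_indep_mult:
  fixes f g :: "'a \<Rightarrow> real"
  assumes "U \<inter> V = {}" "f \<in> borel_measurable (noise U)" "g \<in> borel_measurable (noise V)"
    "integrable M f" "integrable M g"
  shows "integrable M (\<lambda>\<omega>. f \<omega> * g \<omega>)"
    "expectation (\<lambda>\<omega>. f \<omega> * g \<omega>) = expectation f * expectation g"
  using indep_var_integrable[OF noise_indep_var[OF assms(1-3)] assms(4,5)]
    indep_var_lebesgue_integral[OF noise_indep_var[OF assms(1-3)] assms(4,5)] by auto

text \<open>A product of square integrable functions is in general only integrable. Independence
  improves this, because the squares are independent and integrable.\<close>

lemma noise_indep_sqint:
  assumes "U \<inter> V = {}" "f \<in> borel_measurable (noise U)" "g \<in> borel_measurable (noise V)"
    "f \<in> sqint M" "g \<in> sqint M"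
  shows "(\<lambda>\<omega>. f \<omega> * g \<omega>) \<in> sqint M"
proof (rule sqintI)
  show "(\<lambda>\<omega>. f \<omega> * g \<omega>) \<in> borel_measurable M"
    using assms(4,5) by (intro borel_measurable_times) (auto dest: sqintD)
  show "integrable M (\<lambda>\<omega>. (f \<omega> * g \<omega>)\<^sup>2)"
    unfolding power_mult_distrib using assms
    by (intro noise_indep_mult(1)[of U V] borel_measurable_power) (auto dest: sqintD)
qed

end

section \<open>The solution as a function of past innovations\<close>

text \<open>The conditional expectation of \<open>X\<^sub>t\<close> given the last \<open>k\<close> innovations, as a function of
  these innovations listed backwards in time.\<close>

primrec past_sum :: "(nat \<Rightarrow> real) \<Rightarrow> (real \<Rightarrow> real) \<Rightarrow> nat \<Rightarrow> (nat \<Rightarrow> real) \<Rightarrow> real" where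
  "past_sum \<alpha> Q 0 z = 0"
| "past_sum \<alpha> Q (Suc k) z = past_sum \<alpha> Q k z + \<alpha> k * Q (past_sum \<alpha> Q k z) * z k"

lemma past_sum_eq_sum: "past_sum \<alpha> Q k z = (\<Sum>i<k. \<alpha> i * Q (past_sum \<alpha> Q i z) * z i)"
  by (induction k) auto

lemma measurable_past_sum:
  assumes Q[measurable]: "Q \<in> borel_measurable borel"
    and f: "\<And>j. j < k \<Longrightarrow> f j \<in> borel_measurable N"
  shows "(\<lambda>x. past_sum \<alpha> Q k (\<lambda>j. f j x)) \<in> borel_measurable N"
  using f
proof (induction k)
  case (Suc k)
  have [measurable]: "(\<lambda>x. past_sum \<alpha> Q k (\<lambda>j. f j x)) \<in> borel_measurable N" "f k \<in> borel_measurable N"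
    using Suc by auto
  show ?case unfolding past_sum.simps by measurable
qed simp

context iid_noise
begin

text \<open>The reversed past from any time t has as law the same product measure, namely that of
  the common law of the innovations. This is the source of stationarity for
  \<open>q\<close>.\<close>

lemma expectation_past_shift:
  fixes h :: "(nat \<Rightarrow> real) \<Rightarrow> real"
  assumes h[measurable]: "h \<in> borel_measurable (PiM UNIV (\<lambda>_. borel))"
  shows "expectation (\<lambda>\<omega>. h (\<lambda>i. \<zeta> (t - int i) \<omega>)) = expectation (\<lambda>\<omega>. h (\<lambda>i. \<zeta> (- int i) \<omega>))"
proof -
  have law: "distr M (PiM UNIV (\<lambda>_. borel)) (\<lambda>\<omega>. \<lambda>i\<in>UNIV. \<zeta> (u - int i) \<omega>) =
      PiM UNIV (\<lambda>_::nat. distr M borel (\<zeta> 0))" for u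
  proof -
    define E where "E v = {\<zeta> v -` A \<inter> space M | A. A \<in> sets (borel :: real measure)}" for v
    have E: "indep_sets E UNIV" using indep unfolding indep_vars_def2 E_def by blast
    have "indep_sets (\<lambda>i::nat. E (u - int i)) UNIV"
    proof (rule indep_setsI)
      fix A and J :: "nat set" assume J: "J \<noteq> {}" "finite J" "\<forall>j\<in>J. A j \<in> E (u - int j)"
      define J' where "J' = (\<lambda>j. u - int j) ` J"
      \<comment> \<open>The events are transported along the injection j |-> u - j, so that
        independence over J is read off over its image.\<close>
      define B where "B v = A (nat (u - v))" for v
      have B: "B (u - int j) = A j" for j by (simp add: B_def)
      have "prob (\<Inter>v\<in>J'. B v) = (\<Prod>v\<in>J'. prob (B v))"
        by (rule indep_setsD[OF E]) (use J in \<open>auto simp: J'_def B\<close>)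
      moreover have "inj_on (\<lambda>j. u - int j) J" by (auto simp: inj_on_def)
      ultimately show "prob (\<Inter>j\<in>J. A j) = (\<Prod>j\<in>J. prob (A j))"
        unfolding J'_def by (simp add: prod.reindex B)
    qed (auto simp: E_def)
    then have "indep_vars (\<lambda>_. borel) (\<lambda>i::nat. \<zeta> (u - int i)) UNIV"
      unfolding indep_vars_def2 E_def by simp
    then show ?thesis
      by (subst (asm) indep_vars_iff_distr_eq_PiM) (simp_all add: ident[of "u - int _"])
  qed
  have "expectation (\<lambda>\<omega>. h (\<lambda>i. \<zeta> (u - int i) \<omega>)) =
      (\<integral>z. h z \<partial>PiM UNIV (\<lambda>_::nat. distr M borel (\<zeta> 0)))" for u
    unfolding law[of u, symmetric] by (subst integral_distr) (auto intro!: measurable_PiM_single' simp: restrict_UNIV)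
  from this[of t] this[of 0] show ?thesis by simp
qed

text \<open>For s < s' the innovation at s has mean 0 and is independent of the rest of the product,
  which involves later times only. For s = s' its square factors out with expectation 1.\<close>

lemma orthogonal_terms:
  assumes f: "f \<in> borel_measurable (noise {s<..})" "f \<in> sqint M"
    and g: "g \<in> borel_measurable (noise {s'<..})" "g \<in> sqint M"
  shows "expectation (\<lambda>\<omega>. (f \<omega> * \<zeta> s \<omega>) * (g \<omega> * \<zeta> s' \<omega>)) =
    (if s = s' then expectation (\<lambda>\<omega>. f \<omega> * g \<omega>) else 0)"
proof -
  have lt: "expectation (\<lambda>\<omega>. (f \<omega> * \<zeta> s \<omega>) * (g \<omega> * \<zeta> s' \<omega>)) = 0"
    if "s < s'" and f: "f \<in> borel_measurable (noise {s<..})" "f \<in> sqint M"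
      and g: "g \<in> borel_measurable (noise {s'<..})" "g \<in> sqint M" for s s' f g
  proof -
    have gz: "(\<lambda>\<omega>. g \<omega> * \<zeta> s' \<omega>) \<in> sqint M"
      by (rule noise_indep_sqint[of "{s'<..}" "{s'}"]) (auto intro: g zeta_sqint zeta_noise_measurable)
    have m: "(\<lambda>\<omega>. f \<omega> * (g \<omega> * \<zeta> s' \<omega>)) \<in> borel_measurable (noise {s<..})"
      using that(1) noise_measurable_mono[OF _ g(1), of "{s<..}"]
      by (intro borel_measurable_times f zeta_noise_measurable) auto
    have "expectation (\<lambda>\<omega>. \<zeta> s \<omega> * (f \<omega> * (g \<omega> * \<zeta> s' \<omega>))) = expectation (\<zeta> s) * expectation (\<lambda>\<omega>. f \<omega> * (g \<omega> * \<zeta> s' \<omega>))"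
      by (rule noise_indep_mult(2)[where U="{s}", OF _ _ m])
        (auto intro: zeta_noise_measurable sqint_integrable zeta_sqint sqint_mult f gz)
    then show ?thesis by (simp add: expectation_zeta mult_ac)
  qed
  consider "s < s'" | "s' < s" | "s = s'" by linarith
  then show ?thesis
  proof cases
    case 1 then show ?thesis using lt[OF _ f g] by simp
  next
    case 2 then show ?thesis using lt[OF _ g f] by (simp add: mult.commute)
  next
    case 3
    have "expectation (\<lambda>\<omega>. (f \<omega> * g \<omega>) * (\<zeta> s \<omega>)\<^sup>2) = expectation (\<lambda>\<omega>. f \<omega> * g \<omega>) * expectation (\<lambda>\<omega>. (\<zeta> s \<omega>)\<^sup>2)"
      by (rule noise_indep_mult(2)[of "{s<..}" "{s}"])
        (use 3 f g zeta_sqint[of s] in \<open>auto intro!: borel_measurable_times borel_measurable_power zeta_noise_measurable sqint_mult dest: sqintD\<close>)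
    then show ?thesis using 3 expectation_zeta2[of s'] by (simp add: mult_ac power2_eq_square)
  qed
qed

section \<open>Orthogonal expansions along the reversed past\<close>

definition chaos_sum :: "(nat \<Rightarrow> 'a \<Rightarrow> real) \<Rightarrow> int \<Rightarrow> nat \<Rightarrow> 'a \<Rightarrow> real" where
  "chaos_sum p t k \<omega> = (\<Sum>i<k. p i \<omega> * \<zeta> (t - int i) \<omega>)"

text \<open>The coefficient of an innovation may depend on strictly later innovations only, so that
  the terms are martingale differences in reversed time. No upper end is imposed on the times,
  because orthogonality looks only backwards.\<close>

definition adapted_coeff :: "(nat \<Rightarrow> 'a \<Rightarrow> real) \<Rightarrow> int \<Rightarrow> bool" where
  "adapted_coeff p t \<longleftrightarrow> (\<forall>i. p i \<in> borel_measurable (noise {t - int i<..}) \<and> p i \<in> sqint M)"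

lemma chaos_term_sqint:
  assumes "adapted_coeff p t"
  shows "(\<lambda>\<omega>. p i \<omega> * \<zeta> (t - int i) \<omega>) \<in> sqint M"
  by (rule noise_indep_sqint[of "{t - int i<..}" "{t - int i}"])
    (use assms in \<open>auto intro: zeta_sqint zeta_noise_measurable simp: adapted_coeff_def\<close>)

lemma chaos_sum_sqint: "adapted_coeff p t \<Longrightarrow> chaos_sum p t k \<in> sqint M"
  unfolding chaos_sum_def by (intro sqint_sum chaos_term_sqint)

text \<open>Only terms with a common innovation survive: lag i before u is lag h + i before u + h,
  and both lags are below k exactly for i < k - h.\<close>

lemma expectation_chaos_sum_mult:
  assumes p: "adapted_coeff p u" and q: "adapted_coeff q (u + int h)"
  shows "expectation (\<lambda>\<omega>. chaos_sum p u k \<omega> * chaos_sum q (u + int h) k \<omega>) =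
    (\<Sum>i<k - h. expectation (\<lambda>\<omega>. p i \<omega> * q (h + i) \<omega>))"
proof -
  have "expectation (\<lambda>\<omega>. chaos_sum p u k \<omega> * chaos_sum q (u + int h) k \<omega>) =
    (\<Sum>i<k. \<Sum>j<k. expectation (\<lambda>\<omega>. (p i \<omega> * \<zeta> (u - int i) \<omega>) * (q j \<omega> * \<zeta> (u + int h - int j) \<omega>)))"
    unfolding chaos_sum_def sum_product
    by (simp add: Bochner_Integration.integral_sum Bochner_Integration.integrable_sum sqint_mult
        chaos_term_sqint[OF p] chaos_term_sqint[OF q])
  also have "\<dots> = (\<Sum>i<k. \<Sum>j<k. if j = h + i then expectation (\<lambda>\<omega>. p i \<omega> * q (h + i) \<omega>) else 0)"
  proof (intro sum.cong refl)
    fix i j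
    have "u - int i = u + int h - int j \<longleftrightarrow> j = h + i" by auto
    then show "expectation (\<lambda>\<omega>. (p i \<omega> * \<zeta> (u - int i) \<omega>) * (q j \<omega> * \<zeta> (u + int h - int j) \<omega>)) =
        (if j = h + i then expectation (\<lambda>\<omega>. p i \<omega> * q (h + i) \<omega>) else 0)"
      using p q by (subst orthogonal_terms) (auto simp: adapted_coeff_def)
  qed
  also have "\<dots> = (\<Sum>i<k. if i < k - h then expectation (\<lambda>\<omega>. p i \<omega> * q (h + i) \<omega>) else 0)"
    by (intro sum.cong refl) (auto simp: sum.delta)
  also have "\<dots> = (\<Sum>i\<in>{..<k} \<inter> {..<k - h}. expectation (\<lambda>\<omega>. p i \<omega> * q (h + i) \<omega>))"
    by (subst sum.inter_restrict) (auto intro: sum.cong)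
  also have "{..<k} \<inter> {..<k - h} = {..<k - h}" by auto
  finally show ?thesis .
qed

definition past :: "(nat \<Rightarrow> real) \<Rightarrow> (real \<Rightarrow> real) \<Rightarrow> int \<Rightarrow> nat \<Rightarrow> 'a \<Rightarrow> real" where
  "past \<alpha> Q t k \<omega> = past_sum \<alpha> Q k (\<lambda>i. \<zeta> (t - int i) \<omega>)"

lemma past_noise_measurable:
  assumes "Q \<in> borel_measurable borel"
  shows "past \<alpha> Q t k \<in> borel_measurable (noise {t - int k<..t})"
  unfolding past_def by (rule measurable_past_sum[OF assms]) (auto intro: zeta_noise_measurable)

text \<open>Conditioning on the last k innovations annihilates all terms of the series from lag k
  on, because each contains an earlier innovation of mean 0 as an independent factor. The
  conditional expectation is thus the k-th partial sum, and inserting this into the coefficients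
  yields the recursion of \<open>past_sum\<close>.\<close>

lemma projective_solution_past:
  assumes sol: "projective_solution M \<zeta> \<alpha> (\<lambda>i j. 1) Q X"
    and Q: "Q \<in> borel_measurable borel"
  shows "X t \<in> sqint M" "past \<alpha> Q t k \<in> sqint M"
    "(\<lambda>k. expectation (\<lambda>\<omega>. (X t \<omega> - past \<alpha> Q t k \<omega>)\<^sup>2)) \<longlonglongrightarrow> 0"
    "AE \<omega> in M. noise_cond_exp M \<zeta> (t - int k + 1) t (X t) \<omega> = past \<alpha> Q t k \<omega>"
proof -
  define G where "G k = noise_cond_exp M \<zeta> (t - int k + 1) t (X t)" for k
  define g where "g i = projective_coeff M \<zeta> \<alpha> (\<lambda>i j. 1) Q X (t - int i) t" for i
  have fin: "finite_second_moments M t (\<lambda>s. projective_coeff M \<zeta> \<alpha> (\<lambda>i j. 1) Q X s t)"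
    and ms: "mean_square_sum M t (\<lambda>s \<omega>. \<zeta> s \<omega> * projective_coeff M \<zeta> \<alpha> (\<lambda>i j. 1) Q X s t \<omega>) (X t)"
    and proc: "projective_process M \<zeta> X"
    using sol unfolding projective_solution_def by auto
  show X: "X t \<in> sqint M"
    using proc noise_measurable_M unfolding projective_process_def sqint_def by blast
  \<comment> \<open>The telescoping sum leaves \<open>G 0\<close>, the conditional expectation given
    the trivial sigma-algebra. It disappears later, almost surely, when it is identified with the
    empty partial sum.\<close>
  have gG: "g i \<omega> = \<alpha> i * Q (G i \<omega> - G 0 \<omega>)" for i \<omega>
  proof -
    define F where "F u = noise_cond_exp M \<zeta> u t (X t) \<omega>" for u
    have "(\<Sum>u\<in>{t - int i<..t}. F u - F (u + 1)) = F (t - int i + 1) - F (t + 1)"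
    proof (induction i)
      case (Suc i)
      have "{t - int (Suc i)<..t} = insert (t - int i) {t - int i<..t}" by auto
      then show ?case using Suc by simp
    qed simp
    then show ?thesis unfolding g_def projective_coeff_def G_def F_def by simp
  qed
  have G_meas: "G k \<in> borel_measurable (noise {t - int k + 1..t})" for k
    unfolding G_def noise_cond_exp_def by simp
  have g_meas: "g i \<in> borel_measurable (noise {t - int i<..t})" for i
  proof -
    have "G i \<in> borel_measurable (noise {t - int i<..t})" "G 0 \<in> borel_measurable (noise {t - int i<..t})"
      by (rule noise_measurable_mono[OF _ G_meas]; auto)+
    then show ?thesis unfolding gG[abs_def] using Q by measurable
  qed
  have g: "adapted_coeff g t"
    unfolding adapted_coeff_def
  proof (intro allI conjI)
    fix i
    show "g i \<in> borel_measurable (noise {t - int i<..})"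
      by (rule noise_measurable_mono[OF _ g_meas]) auto
    show "g i \<in> sqint M"
      using fin noise_measurable_M[OF g_meas[of i]] unfolding finite_second_moments_def g_def
      by (auto intro!: sqintI)
  qed
  have P: "(\<Sum>s\<in>{t - int n<..t}. \<zeta> s \<omega> * projective_coeff M \<zeta> \<alpha> (\<lambda>i j. 1) Q X s t \<omega>) = chaos_sum g t n \<omega>" for n \<omega>
    unfolding chaos_sum_def g_def
    by (rule sum.reindex_bij_witness[of _ "\<lambda>i. t - int i" "\<lambda>s. nat (t - s)"]) auto
  have P_lim: "(\<lambda>n. expectation (\<lambda>\<omega>. (X t \<omega> - chaos_sum g t n \<omega>)\<^sup>2)) \<longlonglongrightarrow> 0"
    using ms unfolding mean_square_sum_def P by blast
  have P_sqint: "chaos_sum g t n \<in> sqint M" for n by (rule chaos_sum_sqint[OF g])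
  have P_meas: "chaos_sum g t k \<in> borel_measurable (noise {t - int k + 1..t})" for k
    unfolding chaos_sum_def
    by (intro borel_measurable_sum borel_measurable_times zeta_noise_measurable noise_measurable_mono[OF _ g_meas]) auto
  have G_eq: "AE \<omega> in M. G k \<omega> = chaos_sum g t k \<omega>" for k
  proof -
    interpret sigma_finite_subalgebra M "noise {t - int k + 1..t}"
      by (rule finite_measure_subalgebra_is_sigma_finite, unfold_locales, rule subalgebra_noise)
    show ?thesis
      unfolding G_def noise_cond_exp_def
    proof (rule real_cond_exp_charact)
      fix A assume A: "A \<in> sets (noise {t - int k + 1..t})"
      then have AM: "A \<in> sets M" using subalgebra_noise unfolding subalgebra_def by blast
      then have ind: "indicat_real A \<in> sqint M"
        by (intro sqintI integrable_const_bound[where B=1]) (auto simp: indicator_def)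
      have ind_meas: "indicat_real A \<in> borel_measurable (noise {t - int k + 1..t})" using A by measurable
      \<comment> \<open>Testing against A, every term added beyond k contains the innovation at t -
        n with n at least k, which is independent of A and of its own coefficient.\<close>
      have step: "expectation (\<lambda>\<omega>. indicat_real A \<omega> * chaos_sum g t n \<omega>) = expectation (\<lambda>\<omega>. indicat_real A \<omega> * chaos_sum g t k \<omega>)"
        if "n \<ge> k" for n
        using that
      proof (induction n rule: dec_induct)
        case (step n)
        have gn: "g n \<in> borel_measurable (noise {t - int n<..})" "g n \<in> sqint M"
          using g by (auto simp: adapted_coeff_def)
        have "expectation (\<lambda>\<omega>. \<zeta> (t - int n) \<omega> * (indicat_real A \<omega> * g n \<omega>)) =
          expectation (\<zeta> (t - int n)) * expectation (\<lambda>\<omega>. indicat_real A \<omega> * g n \<omega>)"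
          by (rule noise_indep_mult(2)[of "{t - int n}" "{t - int n<..}"])
            (use step(1) in \<open>auto intro!: zeta_noise_measurable borel_measurable_times gn
              noise_measurable_mono[OF _ ind_meas] sqint_integrable[OF zeta_sqint] sqint_mult ind\<close>)
        then have "expectation (\<lambda>\<omega>. indicat_real A \<omega> * (g n \<omega> * \<zeta> (t - int n) \<omega>)) = 0"
          by (simp add: expectation_zeta mult_ac)
        then show ?case
          using step.IH sqint_mult[OF ind chaos_term_sqint[OF g, of n]] sqint_mult[OF ind P_sqint[of n]]
          by (simp add: chaos_sum_def distrib_left)
      qed simp
      have "(\<lambda>n. expectation (\<lambda>\<omega>. indicat_real A \<omega> * chaos_sum g t n \<omega>)) \<longlonglongrightarrow> expectation (\<lambda>\<omega>. indicat_real A \<omega> * X t \<omega>)"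
        by (rule sqint_inner_tendsto) (use ind X P_sqint P_lim in auto)
      moreover have "(\<lambda>n. expectation (\<lambda>\<omega>. indicat_real A \<omega> * chaos_sum g t n \<omega>)) \<longlonglongrightarrow> expectation (\<lambda>\<omega>. indicat_real A \<omega> * chaos_sum g t k \<omega>)"
        by (rule tendsto_eventually, rule eventually_sequentiallyI[of k], rule step)
      ultimately show "(\<integral>x\<in>A. X t x \<partial>M) = (\<integral>x\<in>A. chaos_sum g t k x \<partial>M)"
        using LIMSEQ_unique by (auto simp: set_lebesgue_integral_def)
    qed (auto intro: sqint_integrable X P_sqint P_meas)
  qed
  \<comment> \<open>A single null set must serve all k, because the induction on k evaluates the
    identity for all smaller indices at the same point.\<close>
  have past_eq: "AE \<omega> in M. \<forall>k. chaos_sum g t k \<omega> = past \<alpha> Q t k \<omega>"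
  proof -
    have "AE \<omega> in M. \<forall>k. G k \<omega> = chaos_sum g t k \<omega>" using G_eq by (subst AE_all_countable) simp
    then show ?thesis
    proof (rule AE_mp, intro AE_I2 impI allI)
      fix \<omega> k assume *: "\<forall>k. G k \<omega> = chaos_sum g t k \<omega>"
      show "chaos_sum g t k \<omega> = past \<alpha> Q t k \<omega>"
      proof (induction k)
        case (Suc k)
        have "g k \<omega> = \<alpha> k * Q (chaos_sum g t k \<omega>)"
          using gG[of k \<omega>] *[rule_format, of k] *[rule_format, of 0] by (simp add: chaos_sum_def)
        then show ?case using Suc by (simp add: chaos_sum_def past_def)
      qed (simp add: chaos_sum_def past_def)
    qed
  qed
  have past_M: "past \<alpha> Q t k \<in> borel_measurable M" for k
    by (rule noise_measurable_M[OF past_noise_measurable[OF Q]])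
  show "past \<alpha> Q t k \<in> sqint M"
  proof (rule sqintI[OF past_M])
    have "AE \<omega> in M. (chaos_sum g t k \<omega>)\<^sup>2 = (past \<alpha> Q t k \<omega>)\<^sup>2" using past_eq by auto
    then show "integrable M (\<lambda>\<omega>. (past \<alpha> Q t k \<omega>)\<^sup>2)"
      using past_M sqintD[OF P_sqint[of k]]
      by (subst Bochner_Integration.integrable_cong_AE[symmetric]) auto
  qed
  have "expectation (\<lambda>\<omega>. (X t \<omega> - chaos_sum g t k \<omega>)\<^sup>2) = expectation (\<lambda>\<omega>. (X t \<omega> - past \<alpha> Q t k \<omega>)\<^sup>2)" for k
    using past_eq sqintD(1)[OF X] sqintD(1)[OF P_sqint[of k]] past_M[of k]
    by (intro integral_cong_AE) auto
  then show "(\<lambda>k. expectation (\<lambda>\<omega>. (X t \<omega> - past \<alpha> Q t k \<omega>)\<^sup>2)) \<longlonglongrightarrow> 0"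
    using P_lim by simp
  show "AE \<omega> in M. noise_cond_exp M \<zeta> (t - int k + 1) t (X t) \<omega> = past \<alpha> Q t k \<omega>"
    using G_eq[of k] past_eq unfolding G_def by auto
qed

end

section \<open>Covariances\<close>

locale projective_model = iid_noise M \<zeta> for M :: "'a measure" and \<zeta> +
  fixes X :: "int \<Rightarrow> 'a \<Rightarrow> real" and \<alpha> :: "nat \<Rightarrow> real" and Q :: "real \<Rightarrow> real" and c0 c1 d :: real
  assumes Q_measurable [measurable]: "Q \<in> borel_measurable borel"
    and Q_growth: "\<And>x. (Q x)\<^sup>2 \<le> c0\<^sup>2 + c1\<^sup>2 * x\<^sup>2"
    and d_pos: "0 < d" and d_less: "d < 1 / 2"
    and \<alpha>_asymp: "(\<lambda>k. \<alpha> k / real k powr (d - 1)) \<longlonglongrightarrow> 1"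
    and solution: "projective_solution M \<zeta> \<alpha> (\<lambda>i j. 1) Q X"
    and Q_approx: "((\<lambda>s. \<integral>\<omega>. (Q (noise_cond_exp M \<zeta> s 0 (X 0) \<omega>) - Q (X 0 \<omega>))\<^sup>2 \<partial>M) \<longlongrightarrow> 0) at_bot"
begin

lemmas X_sqint = projective_solution_past(1)[OF solution Q_measurable]
  and past_sqint = projective_solution_past(2)[OF solution Q_measurable]
  and past_tendsto = projective_solution_past(3)[OF solution Q_measurable]

definition q :: "int \<Rightarrow> nat \<Rightarrow> 'a \<Rightarrow> real" where
  "q t i \<omega> = Q (past \<alpha> Q t i \<omega>)"

definition mean_Q :: real where
  "mean_Q = expectation (\<lambda>\<omega>. Q (X 0 \<omega>))"

lemma sqint_Q: "f \<in> sqint M \<Longrightarrow> (\<lambda>\<omega>. Q (f \<omega>)) \<in> sqint M"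
  by (rule sqint_linear_growth[OF _ _ Q_measurable Q_growth]) unfold_locales

lemma q_sqint: "q t i \<in> sqint M"
  unfolding q_def[abs_def] by (rule sqint_Q[OF past_sqint])

lemma q_noise_measurable: "q t i \<in> borel_measurable (noise {t - int i<..t})"
  unfolding q_def[abs_def] using past_noise_measurable[OF Q_measurable] by measurable

lemma adapted_coeff_q:
  "adapted_coeff (\<lambda>i \<omega>. \<alpha> i * q t i \<omega>) t"
  "adapted_coeff (\<lambda>i \<omega>. \<alpha> i * (q t i \<omega> - c)) t"
  "adapted_coeff (\<lambda>i \<omega>. \<alpha> i) t"
proof -
  have q: "q t i \<in> borel_measurable (noise {t - int i<..})" for i
    by (rule noise_measurable_mono[OF _ q_noise_measurable]) auto
  show "adapted_coeff (\<lambda>i \<omega>. \<alpha> i * q t i \<omega>) t"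
    "adapted_coeff (\<lambda>i \<omega>. \<alpha> i * (q t i \<omega> - c)) t"
    "adapted_coeff (\<lambda>i \<omega>. \<alpha> i) t"
    unfolding adapted_coeff_def using q
    by (auto intro!: sqint_cmult sqint_diff q_sqint sqint_const)
qed

lemma past_eq_chaos_sum: "past \<alpha> Q t k = chaos_sum (\<lambda>i \<omega>. \<alpha> i * q t i \<omega>) t k"
  unfolding past_def chaos_sum_def q_def by (subst past_sum_eq_sum) (simp add: fun_eq_iff)

text \<open>Both values are functions of one reversed noise path started at the later time u + h;
  the earlier value reads this path from index h on. Leaving H open covers means, products and
  squared differences.\<close>

lemma q_stationary:
  fixes H :: "real \<Rightarrow> real \<Rightarrow> real"
  assumes H: "(\<lambda>z. H (fst z) (snd z)) \<in> borel_measurable (borel \<Otimes>\<^sub>M borel)"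
  shows "expectation (\<lambda>\<omega>. H (q u i \<omega>) (q (u + int h) j \<omega>)) = expectation (\<lambda>\<omega>. H (q (- int h) i \<omega>) (q 0 j \<omega>))"
proof -
  define f where "f z = H (Q (past_sum \<alpha> Q i (\<lambda>k. z (h + k)))) (Q (past_sum \<alpha> Q j (\<lambda>k. z k)))" for z
  have "(\<lambda>z. past_sum \<alpha> Q i (\<lambda>k. z (h + k))) \<in> borel_measurable (PiM UNIV (\<lambda>_. borel))"
    "(\<lambda>z. past_sum \<alpha> Q j (\<lambda>k. z k)) \<in> borel_measurable (PiM UNIV (\<lambda>_. borel))"
    by (rule measurable_past_sum[OF Q_measurable]; simp)+
  then have "(\<lambda>z. (Q (past_sum \<alpha> Q i (\<lambda>k. z (h + k))), Q (past_sum \<alpha> Q j (\<lambda>k. z k))))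
      \<in> PiM UNIV (\<lambda>_. borel) \<rightarrow>\<^sub>M borel \<Otimes>\<^sub>M borel"
    by (intro measurable_Pair measurable_compose[OF _ Q_measurable])
  from measurable_compose[OF this H] have f: "f \<in> borel_measurable (PiM UNIV (\<lambda>_. borel))"
    by (simp add: f_def[abs_def])
  have eq: "H (q u i \<omega>) (q (u + int h) j \<omega>) = f (\<lambda>k. \<zeta> (u + int h - int k) \<omega>)" for u \<omega>
  proof -
    have "u + int h - int (h + k) = u - int k" for k by simp
    then show ?thesis unfolding f_def q_def past_def by presburger
  qed
  show ?thesis
    using expectation_past_shift[OF f, of "u + int h"] eq[of u] eq[of "- int h"] by simp
qed

text \<open>This is the hypothesis on Q along s = 1 - k: conditioning on the times 1 - k, ..., 0
  uses exactly k innovations, so the conditional expectation is the past sum of length k.\<close>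

lemma q_tendsto: "(\<lambda>k. expectation (\<lambda>\<omega>. (Q (X 0 \<omega>) - q 0 k \<omega>)\<^sup>2)) \<longlonglongrightarrow> 0"
proof -
  have "filterlim (\<lambda>k::nat. 0 - int k + 1) at_bot sequentially"
    unfolding filterlim_at_bot
  proof
    fix Z :: int
    show "\<forall>\<^sub>F k in sequentially. 0 - int k + 1 \<le> Z"
      by (rule eventually_sequentiallyI[of "nat (1 - Z)"]) auto
  qed
  from filterlim_compose[OF Q_approx this]
  have "(\<lambda>k. expectation (\<lambda>\<omega>. (Q (noise_cond_exp M \<zeta> (0 - int k + 1) 0 (X 0) \<omega>) - Q (X 0 \<omega>))\<^sup>2)) \<longlonglongrightarrow> 0" .
  moreover have "expectation (\<lambda>\<omega>. (Q (noise_cond_exp M \<zeta> (0 - int k + 1) 0 (X 0) \<omega>) - Q (X 0 \<omega>))\<^sup>2)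
      = expectation (\<lambda>\<omega>. (Q (X 0 \<omega>) - q 0 k \<omega>)\<^sup>2)" for k
  proof (rule integral_cong_AE)
    have "noise_cond_exp M \<zeta> (0 - int k + 1) 0 (X 0) \<in> borel_measurable (noise {0 - int k + 1..0})"
      unfolding noise_cond_exp_def by simp
    then have [measurable]: "noise_cond_exp M \<zeta> (0 - int k + 1) 0 (X 0) \<in> borel_measurable M"
      by (rule noise_measurable_M)
    have [measurable]: "X 0 \<in> borel_measurable M" "q 0 k \<in> borel_measurable M"
      using X_sqint q_sqint by (auto dest: sqintD)
    show "(\<lambda>\<omega>. (Q (noise_cond_exp M \<zeta> (0 - int k + 1) 0 (X 0) \<omega>) - Q (X 0 \<omega>))\<^sup>2) \<in> borel_measurable M"
      "(\<lambda>\<omega>. (Q (X 0 \<omega>) - q 0 k \<omega>)\<^sup>2) \<in> borel_measurable M" by measurable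
    show "AE \<omega> in M. (Q (noise_cond_exp M \<zeta> (0 - int k + 1) 0 (X 0) \<omega>) - Q (X 0 \<omega>))\<^sup>2 = (Q (X 0 \<omega>) - q 0 k \<omega>)\<^sup>2"
      using projective_solution_past(4)[OF solution Q_measurable, of 0 k]
      by eventually_elim (simp add: q_def power2_commute)
  qed
  ultimately show ?thesis by simp
qed

lemma expectation_q_tendsto: "(\<lambda>k. expectation (q 0 k)) \<longlonglongrightarrow> mean_Q"
proof -
  have "(\<lambda>k. expectation (\<lambda>\<omega>. q 0 k \<omega> * 1)) \<longlonglongrightarrow> expectation (\<lambda>\<omega>. Q (X 0 \<omega>) * 1)"
    by (rule sqint_inner_tendsto[OF q_sqint sqint_Q[OF X_sqint] q_tendsto sqint_const sqint_const]) simp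
  then show ?thesis by (simp add: mean_Q_def)
qed

lemma expectation_q_shift: "expectation (q t k) = expectation (q 0 k)"
  using q_stationary[of "\<lambda>x y. x" t k 0 0] by simp

lemma q_second_moment_bound:
  obtains K where "0 \<le> K" "\<And>t k. expectation (\<lambda>\<omega>. (q t k \<omega>)\<^sup>2) \<le> K"
proof -
  have "(\<lambda>k. expectation (\<lambda>\<omega>. q 0 k \<omega> * q 0 k \<omega>)) \<longlonglongrightarrow> expectation (\<lambda>\<omega>. Q (X 0 \<omega>) * Q (X 0 \<omega>))"
    by (intro sqint_inner_tendsto q_sqint sqint_Q X_sqint q_tendsto)
  then have "Bseq (\<lambda>k. expectation (\<lambda>\<omega>. q 0 k \<omega> * q 0 k \<omega>))"
    by (intro convergent_imp_Bseq convergentI)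
  then obtain K where K: "0 < K" "\<And>k. norm (expectation (\<lambda>\<omega>. q 0 k \<omega> * q 0 k \<omega>)) \<le> K"
    by (auto elim!: BseqE)
  have "expectation (\<lambda>\<omega>. (q t k \<omega>)\<^sup>2) \<le> K" for t k
    using q_stationary[of "\<lambda>x y. x * x" t k 0 0] K(2)[of k]
    by (simp add: power2_eq_square)
  with K(1) show ?thesis by (intro that[of K]) auto
qed

text \<open>Uniformity in t is gained because the statement involves \<open>q\<close> only:
  stationarity moves every t to 0, where Q(X_0) serves as the limit.\<close>

lemma q_Cauchy:
  assumes "0 < \<epsilon>"
  shows "\<exists>m. \<forall>i\<ge>m. \<forall>t. expectation (\<lambda>\<omega>. (q t i \<omega> - q t m \<omega>)\<^sup>2) < \<epsilon>"
proof -
  obtain m where m: "\<And>i. i \<ge> m \<Longrightarrow> expectation (\<lambda>\<omega>. (Q (X 0 \<omega>) - q 0 i \<omega>)\<^sup>2) < \<epsilon> / 4"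
    using LIMSEQ_D[OF q_tendsto, of "\<epsilon> / 4"] assms by auto
  have "expectation (\<lambda>\<omega>. (q t i \<omega> - q t m \<omega>)\<^sup>2) < \<epsilon>" if i: "i \<ge> m" for i t
  proof -
    have s: "(\<lambda>\<omega>. Q (X 0 \<omega>) - q 0 i \<omega>) \<in> sqint M" for i
      by (intro sqint_diff sqint_Q X_sqint q_sqint)
    have "expectation (\<lambda>\<omega>. (q t i \<omega> - q t m \<omega>)\<^sup>2) = expectation (\<lambda>\<omega>. (q 0 i \<omega> - q 0 m \<omega>)\<^sup>2)"
      using q_stationary[of "\<lambda>x y. (x - y)\<^sup>2" t i 0 m] by simp
    also have "\<dots> \<le> expectation (\<lambda>\<omega>. 2 * (Q (X 0 \<omega>) - q 0 m \<omega>)\<^sup>2 + 2 * (Q (X 0 \<omega>) - q 0 i \<omega>)\<^sup>2)"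
    proof (rule integral_mono)
      show "integrable M (\<lambda>\<omega>. (q 0 i \<omega> - q 0 m \<omega>)\<^sup>2)"
        by (intro sqintD sqint_diff q_sqint)
      show "integrable M (\<lambda>\<omega>. 2 * (Q (X 0 \<omega>) - q 0 m \<omega>)\<^sup>2 + 2 * (Q (X 0 \<omega>) - q 0 i \<omega>)\<^sup>2)"
        using sqintD(2)[OF s] by auto
      fix \<omega>
      have "0 \<le> ((Q (X 0 \<omega>) - q 0 m \<omega>) + (Q (X 0 \<omega>) - q 0 i \<omega>))\<^sup>2" by simp
      then show "(q 0 i \<omega> - q 0 m \<omega>)\<^sup>2 \<le> 2 * (Q (X 0 \<omega>) - q 0 m \<omega>)\<^sup>2 + 2 * (Q (X 0 \<omega>) - q 0 i \<omega>)\<^sup>2"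
        by (simp add: power2_eq_square algebra_simps)
    qed
    also have "\<dots> = 2 * expectation (\<lambda>\<omega>. (Q (X 0 \<omega>) - q 0 m \<omega>)\<^sup>2) + 2 * expectation (\<lambda>\<omega>. (Q (X 0 \<omega>) - q 0 i \<omega>)\<^sup>2)"
      using sqintD(2)[OF s] by simp
    finally show ?thesis using m[of m] m[OF i] assms by simp
  qed
  then show ?thesis by blast
qed

text \<open>Lag i before time -h and lag h + i before time 0 point to the same innovation; these are
  the pairs that survive in the covariance of X at distance h.\<close>

definition cov_q :: "nat \<Rightarrow> nat \<Rightarrow> real" where
  "cov_q i h = expectation (\<lambda>\<omega>. q (- int h) i \<omega> * q 0 (h + i) \<omega>)"

lemma expectation_q_mult: "expectation (\<lambda>\<omega>. q u i \<omega> * q (u + int h) (h + i) \<omega>) = cov_q i h"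
  unfolding cov_q_def using q_stationary[of "\<lambda>x y. x * y" u i h "h + i"] by simp

lemma cov_q_bound:
  assumes "0 \<le> K" "\<And>t k. expectation (\<lambda>\<omega>. (q t k \<omega>)\<^sup>2) \<le> K"
  shows "\<bar>cov_q i h\<bar> \<le> K"
proof -
  have "\<bar>cov_q i h\<bar> \<le> sqrt (expectation (\<lambda>\<omega>. (q (- int h) i \<omega>)\<^sup>2)) * sqrt (expectation (\<lambda>\<omega>. (q 0 (h + i) \<omega>)\<^sup>2))"
    unfolding cov_q_def by (rule sqint_Cauchy_Schwarz[OF q_sqint q_sqint])
  also have "\<dots> \<le> sqrt K * sqrt K"
    using assms by (intro mult_mono) auto
  finally show ?thesis using assms by simp
qed

text \<open>Both factors are replaced by their versions with m innovations, at a cost uniform in i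
  and h. For h at least m the replacements live on the disjoint windows (-h - m, -h] and (-m, 0], so
  their product moment factors.\<close>

lemma cov_q_tendsto:
  assumes "0 < \<epsilon>"
  shows "\<exists>m. \<forall>i\<ge>m. \<forall>h\<ge>m. \<bar>cov_q i h - mean_Q\<^sup>2\<bar> < \<epsilon>"
proof -
  obtain K where K: "0 \<le> K" "\<And>t k. expectation (\<lambda>\<omega>. (q t k \<omega>)\<^sup>2) \<le> K"
    using q_second_moment_bound by blast
  \<comment> \<open>Chosen such that each replacement error, at most sqrt \<delta> * sqrt K, is at
    most a third of \<epsilon>. The + 1 covers K = 0.\<close>
  define \<delta> where "\<delta> = (\<epsilon> / (3 * (sqrt K + 1)))\<^sup>2"
  have \<delta>: "0 < \<delta>" "sqrt \<delta> * sqrt K \<le> \<epsilon> / 3"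
  proof -
    have sK: "0 < sqrt K + 1" using real_sqrt_ge_zero[OF K(1)] by linarith
    then show "0 < \<delta>" unfolding \<delta>_def using assms by simp
    have "sqrt \<delta> = \<epsilon> / (3 * (sqrt K + 1))"
      unfolding \<delta>_def using assms sK by simp
    then have "sqrt \<delta> * sqrt K = \<epsilon> / 3 * (sqrt K / (sqrt K + 1))" by simp
    also have "\<dots> \<le> \<epsilon> / 3 * 1"
      using assms sK by (intro mult_left_mono) auto
    finally show "sqrt \<delta> * sqrt K \<le> \<epsilon> / 3" by simp
  qed
  obtain m0 where m0: "\<And>i t. i \<ge> m0 \<Longrightarrow> expectation (\<lambda>\<omega>. (q t i \<omega> - q t m0 \<omega>)\<^sup>2) < \<delta> / 4"
    using q_Cauchy[of "\<delta> / 4"] \<delta>(1) by auto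
  have "(\<lambda>k. (expectation (q 0 k))\<^sup>2) \<longlonglongrightarrow> mean_Q\<^sup>2"
    by (intro tendsto_intros expectation_q_tendsto)
  then obtain m1 where m1: "\<And>k. k \<ge> m1 \<Longrightarrow> \<bar>(expectation (q 0 k))\<^sup>2 - mean_Q\<^sup>2\<bar> < \<epsilon> / 3"
    using LIMSEQ_D[of _ "mean_Q\<^sup>2" "\<epsilon> / 3"] assms by auto
  define m where "m = max m0 m1"
  \<comment> \<open>Moving the reference index from m0 to m costs a factor 4 in the squared
    distance, which is why \<open>m0\<close> was chosen for \<delta> / 4.\<close>
  have near: "expectation (\<lambda>\<omega>. (q t i \<omega> - q t m \<omega>)\<^sup>2) \<le> \<delta>" if "i \<ge> m" for t i
  proof -
    have "expectation (\<lambda>\<omega>. (q t i \<omega> - q t m \<omega>)\<^sup>2)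
      \<le> expectation (\<lambda>\<omega>. 2 * (q t i \<omega> - q t m0 \<omega>)\<^sup>2 + 2 * (q t m \<omega> - q t m0 \<omega>)\<^sup>2)"
    proof (rule integral_mono)
      show "integrable M (\<lambda>\<omega>. (q t i \<omega> - q t m \<omega>)\<^sup>2)"
        by (intro sqintD sqint_diff q_sqint)
      show "integrable M (\<lambda>\<omega>. 2 * (q t i \<omega> - q t m0 \<omega>)\<^sup>2 + 2 * (q t m \<omega> - q t m0 \<omega>)\<^sup>2)"
        by (intro Bochner_Integration.integrable_add integrable_mult_right sqintD sqint_diff q_sqint)
      fix \<omega>
      have "0 \<le> ((q t i \<omega> - q t m0 \<omega>) + (q t m \<omega> - q t m0 \<omega>))\<^sup>2" by simp
      then show "(q t i \<omega> - q t m \<omega>)\<^sup>2 \<le> 2 * (q t i \<omega> - q t m0 \<omega>)\<^sup>2 + 2 * (q t m \<omega> - q t m0 \<omega>)\<^sup>2"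
        by (simp add: power2_eq_square algebra_simps)
    qed
    also have "\<dots> = 2 * expectation (\<lambda>\<omega>. (q t i \<omega> - q t m0 \<omega>)\<^sup>2) + 2 * expectation (\<lambda>\<omega>. (q t m \<omega> - q t m0 \<omega>)\<^sup>2)"
      using sqintD(2)[OF sqint_diff[OF q_sqint q_sqint]] by simp
    finally show ?thesis using m0[of i t] m0[of m t] that by (simp add: m_def)
  qed
  have "\<bar>cov_q i h - mean_Q\<^sup>2\<bar> < \<epsilon>" if i: "i \<ge> m" and h: "h \<ge> m" for i h
  proof -
    define a am b bm where "a = q (- int h) i" and "am = q (- int h) m" and "b = q 0 (h + i)" and "bm = q 0 m"
    have s: "a \<in> sqint M" "am \<in> sqint M" "b \<in> sqint M" "bm \<in> sqint M"
      unfolding a_def am_def b_def bm_def by (rule q_sqint)+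
    have ind: "expectation (\<lambda>\<omega>. am \<omega> * bm \<omega>) = (expectation (q 0 m))\<^sup>2"
    proof -
      have "expectation (\<lambda>\<omega>. am \<omega> * bm \<omega>) = expectation am * expectation bm"
        unfolding am_def bm_def
        by (rule noise_indep_mult(2)[OF _ q_noise_measurable q_noise_measurable])
          (use h in \<open>auto intro: sqint_integrable q_sqint\<close>)
      then show ?thesis
        unfolding am_def bm_def expectation_q_shift[of "- int h"] by (simp add: power2_eq_square)
    qed
    have "cov_q i h = expectation (\<lambda>\<omega>. (a \<omega> - am \<omega>) * b \<omega> + (am \<omega> * (b \<omega> - bm \<omega>) + am \<omega> * bm \<omega>))"
      unfolding cov_q_def a_def b_def by (intro Bochner_Integration.integral_cong refl) (simp add: algebra_simps)
    also have "\<dots> = expectation (\<lambda>\<omega>. (a \<omega> - am \<omega>) * b \<omega>) + (expectation (\<lambda>\<omega>. am \<omega> * (b \<omega> - bm \<omega>)) + expectation (\<lambda>\<omega>. am \<omega> * bm \<omega>))"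
      using s by (subst Bochner_Integration.integral_add, auto intro!: sqint_mult sqint_diff)+
    finally have *: "cov_q i h - (expectation (q 0 m))\<^sup>2 = expectation (\<lambda>\<omega>. (a \<omega> - am \<omega>) * b \<omega>) + expectation (\<lambda>\<omega>. am \<omega> * (b \<omega> - bm \<omega>))"
      unfolding ind by simp
    have "\<bar>expectation (\<lambda>\<omega>. (a \<omega> - am \<omega>) * b \<omega>)\<bar> \<le> sqrt \<delta> * sqrt K"
      by (rule order_trans[OF sqint_Cauchy_Schwarz[OF sqint_diff[OF s(1,2)] s(3)]])
        (use near[OF i] K \<delta> in \<open>auto intro!: mult_mono simp: a_def am_def b_def\<close>)
    moreover have "\<bar>expectation (\<lambda>\<omega>. am \<omega> * (b \<omega> - bm \<omega>))\<bar> \<le> sqrt K * sqrt \<delta>"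
      by (rule order_trans[OF sqint_Cauchy_Schwarz[OF s(2) sqint_diff[OF s(3,4)]]])
        (use near[of "h + i" 0] i K \<delta> in \<open>auto intro!: mult_mono simp: am_def b_def bm_def\<close>)
    moreover have "\<bar>(expectation (q 0 m))\<^sup>2 - mean_Q\<^sup>2\<bar> < \<epsilon> / 3" using m1 by (simp add: m_def)
    moreover have "sqrt K * sqrt \<delta> \<le> \<epsilon> / 3" using \<delta>(2) by (simp only: mult.commute)
    ultimately show ?thesis using \<delta>(2) * by linarith
  qed
  then show ?thesis by blast
qed

text \<open>An expanded product moment of \<open>q\<close> minus \<open>mean_Q\<close>, so that its
  limit follows from those of \<open>cov_q\<close> and of the means. The centring constant is the
  limit of the means, not the mean of each factor.\<close>

definition centred_cov_q :: "nat \<Rightarrow> nat \<Rightarrow> real" where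
  "centred_cov_q i h = cov_q i h - mean_Q * expectation (q 0 i) - mean_Q * expectation (q 0 (h + i)) + mean_Q\<^sup>2"

lemma expectation_centred_q_mult:
  "expectation (\<lambda>\<omega>. (q u i \<omega> - mean_Q) * (q (u + int h) (h + i) \<omega> - mean_Q)) = centred_cov_q i h"
proof -
  have "expectation (\<lambda>\<omega>. (q u i \<omega> - mean_Q) * (q (u + int h) (h + i) \<omega> - mean_Q)) =
    expectation (\<lambda>\<omega>. q u i \<omega> * q (u + int h) (h + i) \<omega> - mean_Q * q u i \<omega> - mean_Q * q (u + int h) (h + i) \<omega> + mean_Q\<^sup>2)"
    by (intro Bochner_Integration.integral_cong refl) (simp add: algebra_simps power2_eq_square)
  also have "\<dots> = expectation (\<lambda>\<omega>. q u i \<omega> * q (u + int h) (h + i) \<omega>) - mean_Q * expectation (q u i)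
      - mean_Q * expectation (q (u + int h) (h + i)) + mean_Q\<^sup>2"
    using sqint_mult[OF q_sqint q_sqint, of u i "u + int h" "h + i"] sqint_integrable[OF q_sqint]
    by (simp add: prob_space)
  finally show ?thesis
    unfolding centred_cov_q_def expectation_q_mult expectation_q_shift[of u] expectation_q_shift[of "u + int h"] .
qed

lemma centred_cov_q_bound: obtains K where "\<And>i h. \<bar>centred_cov_q i h\<bar> \<le> K"
proof -
  obtain K where K: "0 \<le> K" "\<And>t k. expectation (\<lambda>\<omega>. (q t k \<omega>)\<^sup>2) \<le> K"
    using q_second_moment_bound by blast
  have "Bseq (\<lambda>k. expectation (q 0 k))"
    using expectation_q_tendsto by (intro convergent_imp_Bseq convergentI)
  then obtain B where B: "0 < B" "\<And>k. \<bar>expectation (q 0 k)\<bar> \<le> B"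
    by (auto elim!: BseqE)
  have "\<bar>centred_cov_q i h\<bar> \<le> K + \<bar>mean_Q\<bar> * B + \<bar>mean_Q\<bar> * B + mean_Q\<^sup>2" for i h
  proof -
    have mB: "\<bar>mean_Q * expectation (q 0 k)\<bar> \<le> \<bar>mean_Q\<bar> * B" for k
      unfolding abs_mult by (intro mult_left_mono B) simp
    then show ?thesis
      unfolding centred_cov_q_def using cov_q_bound[OF K, of i h] zero_le_power2[of mean_Q] mB[of i] mB[of "h + i"]
      by linarith
  qed
  then show ?thesis by (rule that)
qed

lemma centred_cov_q_tendsto:
  assumes "0 < \<epsilon>"
  shows "\<exists>m. \<forall>i\<ge>m. \<forall>h\<ge>m. \<bar>centred_cov_q i h\<bar> < \<epsilon>"
proof -
  obtain m0 where m0: "\<And>i h. i \<ge> m0 \<Longrightarrow> h \<ge> m0 \<Longrightarrow> \<bar>cov_q i h - mean_Q\<^sup>2\<bar> < \<epsilon> / 3"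
    using cov_q_tendsto[of "\<epsilon> / 3"] assms by auto
  have "(\<lambda>k. mean_Q * expectation (q 0 k)) \<longlonglongrightarrow> mean_Q * mean_Q"
    by (intro tendsto_intros expectation_q_tendsto)
  then obtain m1 where m1: "\<And>k. k \<ge> m1 \<Longrightarrow> \<bar>mean_Q * expectation (q 0 k) - mean_Q * mean_Q\<bar> < \<epsilon> / 3"
    using LIMSEQ_D[of _ "mean_Q * mean_Q" "\<epsilon> / 3"] assms by auto
  have "\<bar>centred_cov_q i h\<bar> < \<epsilon>" if "i \<ge> max m0 m1" "h \<ge> max m0 m1" for i h
  proof -
    have "\<bar>cov_q i h - mean_Q\<^sup>2\<bar> < \<epsilon> / 3" "\<bar>mean_Q * expectation (q 0 i) - mean_Q * mean_Q\<bar> < \<epsilon> / 3"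
      "\<bar>mean_Q * expectation (q 0 (h + i)) - mean_Q * mean_Q\<bar> < \<epsilon> / 3"
      by (rule m0 m1; use that in simp)+
    then show ?thesis unfolding centred_cov_q_def power2_eq_square by linarith
  qed
  then show ?thesis by blast
qed

section \<open>Autocovariances of the solution, of the linear process and of their
  difference\<close>

definition autocov_X :: "nat \<Rightarrow> real" where
  "autocov_X h = (\<Sum>i. \<alpha> i * \<alpha> (h + i) * cov_q i h)"

text \<open>Absolute values inside the series make it a majorant for every finite truncation, and
  allow weights of either sign.\<close>

definition error_bound :: "nat \<Rightarrow> real" where
  "error_bound h = (\<Sum>i. \<bar>\<alpha> i\<bar> * \<bar>\<alpha> (h + i)\<bar> * \<bar>centred_cov_q i h\<bar>)"

definition autocov_linear :: "nat \<Rightarrow> real" where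
  "autocov_linear h = (\<Sum>i. \<alpha> i * \<alpha> (h + i))"

lemma summable_autocov:
  assumes "\<And>i h. \<bar>f i h\<bar> \<le> K"
  shows "summable (\<lambda>i. \<bar>\<alpha> i * \<alpha> (h + i) * f i h\<bar>)"
proof -
  obtain C where "0 \<le> C" "\<And>i. \<bar>\<alpha> i\<bar> \<le> C * real (Suc i) powr (d - 1)"
    using regular_coeff_bound[OF \<alpha>_asymp] by blast
  then show ?thesis by (rule autocov_bound_summable[OF d_less _ _ assms])
qed

lemma autocov_X_asymp:
  "(\<lambda>h. autocov_X h / real h powr (2 * d - 1)) \<longlonglongrightarrow> mean_Q\<^sup>2 * Beta d (1 - 2 * d)"
proof -
  obtain K where "0 \<le> K" "\<And>t k. expectation (\<lambda>\<omega>. (q t k \<omega>)\<^sup>2) \<le> K"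
    using q_second_moment_bound by blast
  from weighted_autocov_asymp[OF d_pos d_less \<alpha>_asymp cov_q_bound[OF this] cov_q_tendsto]
  show ?thesis unfolding autocov_X_def .
qed

lemma autocov_linear_asymp:
  "(\<lambda>h. autocov_linear h / real h powr (2 * d - 1)) \<longlonglongrightarrow> Beta d (1 - 2 * d)"
  using weighted_autocov_asymp[OF d_pos d_less \<alpha>_asymp, of "\<lambda>i h. 1" 1 1]
  unfolding autocov_linear_def by simp

text \<open>The absolute values of the coefficients have the same asymptotics as the coefficients,
  while the centred moments tend to 0 when i and h are both large.\<close>

lemma error_bound_asymp: "(\<lambda>h. error_bound h / real h powr (2 * d - 1)) \<longlonglongrightarrow> 0"
proof -
  obtain K where K: "\<And>i h. \<bar>centred_cov_q i h\<bar> \<le> K" using centred_cov_q_bound by blast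
  have "(\<lambda>k. \<bar>\<alpha> k\<bar> / real k powr (d - 1)) \<longlonglongrightarrow> 1"
    using tendsto_rabs[OF \<alpha>_asymp] by (simp add: abs_divide)
  from weighted_autocov_asymp[OF d_pos d_less this, of "\<lambda>i h. \<bar>centred_cov_q i h\<bar>" K 0]
  show ?thesis using K centred_cov_q_tendsto unfolding error_bound_def by simp
qed

lemma expectation_X_mult: "expectation (\<lambda>\<omega>. X u \<omega> * X (u + int h) \<omega>) = autocov_X h"
proof -
  obtain K where K: "0 \<le> K" "\<And>t k. expectation (\<lambda>\<omega>. (q t k \<omega>)\<^sup>2) \<le> K"
    using q_second_moment_bound by blast
  have "(\<lambda>k. expectation (\<lambda>\<omega>. past \<alpha> Q u k \<omega> * past \<alpha> Q (u + int h) k \<omega>)) \<longlonglongrightarrow> expectation (\<lambda>\<omega>. X u \<omega> * X (u + int h) \<omega>)"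
    by (intro sqint_inner_tendsto past_sqint X_sqint past_tendsto)
  moreover have "expectation (\<lambda>\<omega>. past \<alpha> Q u k \<omega> * past \<alpha> Q (u + int h) k \<omega>) = (\<Sum>i<k - h. \<alpha> i * \<alpha> (h + i) * cov_q i h)" for k
  proof -
    have "expectation (\<lambda>\<omega>. past \<alpha> Q u k \<omega> * past \<alpha> Q (u + int h) k \<omega>) =
      (\<Sum>i<k - h. expectation (\<lambda>\<omega>. \<alpha> i * \<alpha> (h + i) * (q u i \<omega> * q (u + int h) (h + i) \<omega>)))"
      unfolding past_eq_chaos_sum
      by (subst expectation_chaos_sum_mult[OF adapted_coeff_q(1) adapted_coeff_q(1)]) (simp add: mult_ac)
    then show ?thesis by (simp add: expectation_q_mult)
  qed
  moreover have "(\<lambda>k. \<Sum>i<k - h. \<alpha> i * \<alpha> (h + i) * cov_q i h) \<longlonglongrightarrow> autocov_X h"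
  proof -
    have "(\<lambda>i. \<alpha> i * \<alpha> (h + i) * cov_q i h) sums autocov_X h"
      unfolding autocov_X_def
      by (rule summable_sums, rule summable_rabs_cancel, rule summable_autocov, rule cov_q_bound[OF K])
    then have "(\<lambda>k. \<Sum>i<k. \<alpha> i * \<alpha> (h + i) * cov_q i h) \<longlonglongrightarrow> autocov_X h"
      unfolding sums_def .
    then show ?thesis by (rule filterlim_compose) (rule filterlim_minus_const_nat_at_top)
  qed
  ultimately show ?thesis using LIMSEQ_unique by simp
qed

definition linear_sum :: "int \<Rightarrow> nat \<Rightarrow> 'a \<Rightarrow> real" where
  "linear_sum t k = chaos_sum (\<lambda>i \<omega>. \<alpha> i) t k"

definition error_sum :: "int \<Rightarrow> nat \<Rightarrow> 'a \<Rightarrow> real" where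
  "error_sum t k = chaos_sum (\<lambda>i \<omega>. \<alpha> i * (q t i \<omega> - mean_Q)) t k"

lemma past_decomp: "past \<alpha> Q t k \<omega> = mean_Q * linear_sum t k \<omega> + error_sum t k \<omega>"
  unfolding past_eq_chaos_sum linear_sum_def error_sum_def chaos_sum_def
  by (simp add: sum_distrib_left sum.distrib[symmetric] algebra_simps)

lemma linear_sum_sqint: "linear_sum t k \<in> sqint M" and error_sum_sqint: "error_sum t k \<in> sqint M"
  unfolding linear_sum_def error_sum_def by (rule chaos_sum_sqint[OF adapted_coeff_q(3)] chaos_sum_sqint[OF adapted_coeff_q(2)])+

text \<open>The bound depends neither on the truncation k nor on the time u, so that k can tend to
  infinity while the number of summands of X stays fixed.\<close>

lemma expectation_error_sum_mult:
  "\<bar>expectation (\<lambda>\<omega>. error_sum u k \<omega> * error_sum (u + int h) k \<omega>)\<bar> \<le> error_bound h"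
proof -
  obtain K where K: "\<And>i h. \<bar>centred_cov_q i h\<bar> \<le> K" using centred_cov_q_bound by blast
  have "expectation (\<lambda>\<omega>. error_sum u k \<omega> * error_sum (u + int h) k \<omega>) =
      (\<Sum>i<k - h. expectation (\<lambda>\<omega>. \<alpha> i * \<alpha> (h + i) * ((q u i \<omega> - mean_Q) * (q (u + int h) (h + i) \<omega> - mean_Q))))"
    unfolding error_sum_def
    by (subst expectation_chaos_sum_mult[OF adapted_coeff_q(2) adapted_coeff_q(2)]) (simp add: mult_ac)
  also have "\<dots> = (\<Sum>i<k - h. \<alpha> i * \<alpha> (h + i) * centred_cov_q i h)"
    by (simp add: expectation_centred_q_mult)
  also have "\<bar>\<dots>\<bar> \<le> (\<Sum>i<k - h. \<bar>\<alpha> i * \<alpha> (h + i) * centred_cov_q i h\<bar>)" by (rule sum_abs)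
  also have "\<dots> \<le> (\<Sum>i. \<bar>\<alpha> i * \<alpha> (h + i) * centred_cov_q i h\<bar>)"
    by (rule sum_le_suminf[OF summable_autocov[OF K]]) auto
  finally show ?thesis by (simp add: error_bound_def abs_mult)
qed

lemma expectation_linear_sum_mult:
  "expectation (\<lambda>\<omega>. linear_sum u k \<omega> * linear_sum (u + int h) k \<omega>) = (\<Sum>i<k - h. \<alpha> i * \<alpha> (h + i))"
  unfolding linear_sum_def
  by (subst expectation_chaos_sum_mult[OF adapted_coeff_q(3) adapted_coeff_q(3)]) (simp add: prob_space)

lemma linear_sum_autocov_tendsto:
  "(\<lambda>k. expectation (\<lambda>\<omega>. linear_sum u k \<omega> * linear_sum (u + int h) k \<omega>)) \<longlonglongrightarrow> autocov_linear h"
proof -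
  have "summable (\<lambda>i. \<bar>\<alpha> i * \<alpha> (h + i) * 1\<bar>)"
    by (rule summable_autocov[of "\<lambda>i h. 1" 1]) simp
  from summable_sums[OF summable_rabs_cancel[OF this]]
  have "(\<lambda>i. \<alpha> i * \<alpha> (h + i)) sums autocov_linear h"
    unfolding autocov_linear_def by simp
  then have "(\<lambda>k. \<Sum>i<k. \<alpha> i * \<alpha> (h + i)) \<longlonglongrightarrow> autocov_linear h"
    unfolding sums_def .
  then show ?thesis
    unfolding expectation_linear_sum_mult
    by (rule filterlim_compose) (rule filterlim_minus_const_nat_at_top)
qed

end

section \<open>Characteristic functions of weighted sums\<close>

lemma cmod_iexp_diff_le: "cmod (iexp x - iexp y) \<le> \<bar>x - y\<bar>"
proof -
  have "iexp x - iexp y = iexp y * (iexp (x - y) - 1)"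
    by (simp add: algebra_simps flip: exp_add)
  then have "cmod (iexp x - iexp y) = cmod (iexp (x - y) - 1)"
    by (simp only: norm_mult norm_exp_i_times mult_1)
  also have "\<dots> \<le> \<bar>x - y\<bar>"
    using iexp_approx1[of "x - y" 0] by simp
  finally show ?thesis .
qed

context prob_space
begin

lemma integrable_iexp_real: "f \<in> borel_measurable M \<Longrightarrow> integrable M (\<lambda>\<omega>. iexp (f \<omega>))"
  by (rule integrable_iexp) auto

text \<open>Since x |-> exp(i x) is 1-Lipschitz on the reals, a replacement that is cheap in mean
  square is cheap for characteristic functions.\<close>

lemma expectation_iexp_diff_le:
  assumes "f \<in> sqint M" "g \<in> sqint M"
  shows "cmod ((\<integral>\<omega>. iexp (f \<omega>) \<partial>M) - (\<integral>\<omega>. iexp (g \<omega>) \<partial>M)) \<le> sqrt (expectation (\<lambda>\<omega>. (f \<omega> - g \<omega>)\<^sup>2))"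
proof -
  have m: "f \<in> borel_measurable M" "g \<in> borel_measurable M"
    using assms by (auto dest: sqintD)
  have "(\<integral>\<omega>. iexp (f \<omega>) \<partial>M) - (\<integral>\<omega>. iexp (g \<omega>) \<partial>M) = (\<integral>\<omega>. iexp (f \<omega>) - iexp (g \<omega>) \<partial>M)"
    using m by (intro Bochner_Integration.integral_diff[symmetric] integrable_iexp_real)
  also have "cmod \<dots> \<le> (\<integral>\<omega>. cmod (iexp (f \<omega>) - iexp (g \<omega>)) \<partial>M)" by (rule integral_norm_bound)
  also have "\<dots> \<le> expectation (\<lambda>\<omega>. \<bar>f \<omega> - g \<omega>\<bar>)"
    using assms m
    by (intro integral_mono integrable_norm Bochner_Integration.integrable_diff integrable_iexp_real
        integrable_abs sqint_integrable cmod_iexp_diff_le)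
  also have "\<dots> \<le> sqrt (expectation (\<lambda>\<omega>. (f \<omega> - g \<omega>)\<^sup>2))"
    by (intro expectation_abs_le_sqrt sqint_diff assms)
  finally show ?thesis .
qed

end

section \<open>Gaussian approximation for linear combinations of the innovations\<close>

lemma exp_minus_approx:
  assumes "0 \<le> (y::real)"
  shows "\<bar>exp (- y) - (1 - y)\<bar> \<le> y\<^sup>2"
proof -
  have "1 - y \<le> exp (- y)" using exp_ge_add_one_self[of "- y"] by simp
  moreover have "exp (- y) \<le> 1 / (1 + y)"
    using exp_ge_add_one_self[of y] assms by (simp add: exp_minus field_simps)
  moreover have "1 / (1 + y) \<le> 1 - y + y\<^sup>2"
  proof -
    \<comment> \<open>The product on the right equals 1 + y^3.\<close>
    have "1 \<le> (1 - y + y\<^sup>2) * (1 + y)"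
      using assms zero_le_power[of y 3] by (simp add: power2_eq_square power3_eq_cube algebra_simps)
    then show ?thesis using assms by (simp add: pos_divide_le_eq)
  qed
  ultimately show ?thesis by simp
qed

context iid_noise
begin

text \<open>With second moments only, the remainder of the Taylor expansion is min (6 x^2) (|u|
  |x|^3) instead of a cubic term; by dominated convergence its expectation vanishes with u. By
  identical distribution one \<delta> serves all t.\<close>

lemma char_zeta_approx:
  assumes "0 < \<epsilon>"
  shows "\<exists>\<delta>>0. \<forall>u t. \<bar>u\<bar> \<le> \<delta> \<longrightarrow> cmod ((\<integral>\<omega>. iexp (u * \<zeta> t \<omega>) \<partial>M) - exp (- u\<^sup>2 / 2)) \<le> \<epsilon> * u\<^sup>2"
proof -
  define \<phi> where "\<phi> u = expectation (\<lambda>x. min (6 * (\<zeta> 0 x)\<^sup>2) (\<bar>u\<bar> * \<bar>\<zeta> 0 x\<bar> ^ 3))" for u :: real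
  have int: "integrable M (\<lambda>x. min (6 * (\<zeta> 0 x)\<^sup>2) (\<bar>u\<bar> * \<bar>\<zeta> 0 x\<bar> ^ 3))" for u
    by (rule Bochner_Integration.integrable_bound[where f="\<lambda>x. 6 * (\<zeta> 0 x)\<^sup>2"])
      (use square_integrable_0 in auto)
  have "(\<lambda>n. \<phi> (1 / real (Suc n))) \<longlonglongrightarrow> expectation (\<lambda>x. 0)"
    unfolding \<phi>_def
  proof (rule integral_dominated_convergence[where w="\<lambda>x. 6 * (\<zeta> 0 x)\<^sup>2"])
    show "AE x in M. (\<lambda>n. min (6 * (\<zeta> 0 x)\<^sup>2) (\<bar>1 / real (Suc n)\<bar> * \<bar>\<zeta> 0 x\<bar> ^ 3)) \<longlonglongrightarrow> 0"
    proof (rule AE_I2)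
      fix x
      have "(\<lambda>n. 1 / real (Suc n)) \<longlonglongrightarrow> 0" by real_asymp
      then have "(\<lambda>n. min (6 * (\<zeta> 0 x)\<^sup>2) (\<bar>1 / real (Suc n)\<bar> * \<bar>\<zeta> 0 x\<bar> ^ 3)) \<longlonglongrightarrow> min (6 * (\<zeta> 0 x)\<^sup>2) (\<bar>0\<bar> * \<bar>\<zeta> 0 x\<bar> ^ 3)"
        by (intro tendsto_intros)
      then show "(\<lambda>n. min (6 * (\<zeta> 0 x)\<^sup>2) (\<bar>1 / real (Suc n)\<bar> * \<bar>\<zeta> 0 x\<bar> ^ 3)) \<longlonglongrightarrow> 0"
        by simp
    qed
  qed (use square_integrable_0 in auto)
  then have "(\<lambda>n. \<phi> (1 / real (Suc n))) \<longlonglongrightarrow> 0" by simp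
  from LIMSEQ_D[OF this assms] obtain n where "norm (\<phi> (1 / real (Suc n)) - 0) < \<epsilon>" by blast
  then have n: "\<phi> (1 / real (Suc n)) < \<epsilon>" unfolding real_norm_def by linarith
  \<comment> \<open>The first constraint controls the Taylor remainder; the other two bound the
    error u^4 / 4 of the exponential by \<epsilon> * u^2 / 4.\<close>
  define \<delta> where "\<delta> = min (1 / real (Suc n)) (min 1 \<epsilon>)"
  have \<delta>: "0 < \<delta>" unfolding \<delta>_def using assms by simp
  have "cmod ((\<integral>\<omega>. iexp (u * \<zeta> t \<omega>) \<partial>M) - exp (- u\<^sup>2 / 2)) \<le> \<epsilon> * u\<^sup>2" if u: "\<bar>u\<bar> \<le> \<delta>" for u t
  proof -
    have "\<phi> u \<le> \<phi> (1 / real (Suc n))"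
      unfolding \<phi>_def using u by (intro integral_mono int min.mono mult_right_mono) (auto simp: \<delta>_def)
    then have \<phi>u: "\<phi> u \<le> \<epsilon>" using n by simp
    have "(\<integral>\<omega>. iexp (u * \<zeta> t \<omega>) \<partial>M) = char (distr M borel (\<zeta> t)) u"
      by (simp add: char_def integral_distr)
    also have "\<dots> = char (distr M borel (\<zeta> 0)) u" by (subst ident) simp
    finally have ch: "(\<integral>\<omega>. iexp (u * \<zeta> t \<omega>) \<partial>M) = char (distr M borel (\<zeta> 0)) u" .
    have "cmod (char (distr M borel (\<zeta> 0)) u - (1 - u\<^sup>2 * 1 / 2)) \<le> u\<^sup>2 / 6 * \<phi> u"
      using char_approx3'[of "\<zeta> 0" 1 _ u] zeta_sqint[of 0] sqint_integrable[OF zeta_sqint[of 0]]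
      unfolding \<phi>_def by (simp add: mean_0 variance_1 square_integrable_0)
    also have "\<dots> \<le> u\<^sup>2 / 6 * \<epsilon>" using \<phi>u by (intro mult_left_mono) auto
    finally have 1: "cmod (char (distr M borel (\<zeta> 0)) u - complex_of_real (1 - u\<^sup>2 / 2)) \<le> u\<^sup>2 / 6 * \<epsilon>" by simp
    have "\<bar>exp (- (u\<^sup>2 / 2)) - (1 - u\<^sup>2 / 2)\<bar> \<le> (u\<^sup>2 / 2)\<^sup>2"
      by (rule exp_minus_approx) simp
    also have "\<dots> = u\<^sup>2 / 4 * (\<bar>u\<bar> * \<bar>u\<bar>)" by (simp add: power2_eq_square abs_mult_self_eq)
    also have "\<dots> \<le> u\<^sup>2 / 4 * (1 * \<epsilon>)"
      using u by (intro mult_left_mono mult_mono) (auto simp: \<delta>_def)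
    finally have "cmod (of_real (exp (- (u\<^sup>2 / 2)) - (1 - u\<^sup>2 / 2))) \<le> u\<^sup>2 / 4 * \<epsilon>"
      unfolding norm_of_real by simp
    then have 2: "cmod (complex_of_real (1 - u\<^sup>2 / 2) - complex_of_real (exp (- u\<^sup>2 / 2))) \<le> u\<^sup>2 / 4 * \<epsilon>"
      by (subst norm_minus_commute) (simp only: of_real_diff minus_divide_left)
    have "cmod ((\<integral>\<omega>. iexp (u * \<zeta> t \<omega>) \<partial>M) - exp (- u\<^sup>2 / 2)) \<le> u\<^sup>2 / 6 * \<epsilon> + u\<^sup>2 / 4 * \<epsilon>"
      unfolding ch by (rule norm_diff_triangle_le[OF 1 2])
    also have "\<dots> \<le> \<epsilon> * u\<^sup>2" using assms by (simp add: field_simps)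
    finally show ?thesis .
  qed
  then show ?thesis using \<delta> by blast
qed

text \<open>Products of factors of modulus at most 1 are compared factor by factor, so the errors
  add up. As \<delta> is independent of S and b, the estimate suits triangular arrays: uniform
  smallness of the coefficients takes the place of the Lindeberg condition.\<close>

lemma char_linear_combination:
  assumes "0 < \<epsilon>"
  shows "\<exists>\<delta>>0. \<forall>S b. finite S \<and> (\<forall>s\<in>S. \<bar>b s\<bar> \<le> \<delta>) \<longrightarrow>
    cmod ((\<integral>\<omega>. iexp (\<Sum>s\<in>S. b s * \<zeta> s \<omega>) \<partial>M) - exp (- (\<Sum>s\<in>S. (b s)\<^sup>2) / 2)) \<le> \<epsilon> * (\<Sum>s\<in>S. (b s)\<^sup>2)"
proof -
  obtain \<delta> where \<delta>: "0 < \<delta>"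
    "\<And>u t. \<bar>u\<bar> \<le> \<delta> \<Longrightarrow> cmod ((\<integral>\<omega>. iexp (u * \<zeta> t \<omega>) \<partial>M) - exp (- u\<^sup>2 / 2)) \<le> \<epsilon> * u\<^sup>2"
    using char_zeta_approx[OF assms] by blast
  have "cmod ((\<integral>\<omega>. iexp (\<Sum>s\<in>S. b s * \<zeta> s \<omega>) \<partial>M) - exp (- (\<Sum>s\<in>S. (b s)\<^sup>2) / 2)) \<le> \<epsilon> * (\<Sum>s\<in>S. (b s)\<^sup>2)"
    if S: "finite S" and b: "\<forall>s\<in>S. \<bar>b s\<bar> \<le> \<delta>" for S b
  proof -
    have "indep_vars (\<lambda>_. borel) (\<lambda>s \<omega>. b s * \<zeta> s \<omega>) S"
      by (rule indep_vars_compose2[OF indep_vars_subset[OF indep subset_UNIV]]) auto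
    from char_distr_sum[OF this, of 1]
    have "(\<integral>\<omega>. iexp (\<Sum>s\<in>S. b s * \<zeta> s \<omega>) \<partial>M) = (\<Prod>s\<in>S. \<integral>\<omega>. iexp (b s * \<zeta> s \<omega>) \<partial>M)"
      by (simp add: char_def integral_distr)
    moreover have "complex_of_real (exp (- (\<Sum>s\<in>S. (b s)\<^sup>2) / 2)) = (\<Prod>s\<in>S. exp (- (b s)\<^sup>2 / 2))"
      using S by (simp add: exp_sum sum_divide_distrib flip: sum_negf)
    ultimately have "cmod ((\<integral>\<omega>. iexp (\<Sum>s\<in>S. b s * \<zeta> s \<omega>) \<partial>M) - exp (- (\<Sum>s\<in>S. (b s)\<^sup>2) / 2))
      = cmod ((\<Prod>s\<in>S. \<integral>\<omega>. iexp (b s * \<zeta> s \<omega>) \<partial>M) - (\<Prod>s\<in>S. complex_of_real (exp (- (b s)\<^sup>2 / 2))))"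
      by simp
    also have "\<dots> \<le> (\<Sum>s\<in>S. cmod ((\<integral>\<omega>. iexp (b s * \<zeta> s \<omega>) \<partial>M) - exp (- (b s)\<^sup>2 / 2)))"
    proof (rule norm_prod_diff)
      show "cmod (\<integral>\<omega>. iexp (b s * \<zeta> s \<omega>) \<partial>M) \<le> 1" for s
        by (rule order_trans[OF integral_norm_bound]) (simp add: prob_space)
    qed simp
    also have "\<dots> \<le> (\<Sum>s\<in>S. \<epsilon> * (b s)\<^sup>2)" using b \<delta>(2) by (intro sum_mono) auto
    finally show ?thesis by (simp add: sum_distrib_left)
  qed
  then show ?thesis using \<delta>(1) by blast
qed

lemma expectation_linear_combination:
  assumes "finite S"
  shows "expectation (\<lambda>\<omega>. (\<Sum>s\<in>S. b s * \<zeta> s \<omega>)\<^sup>2) = (\<Sum>s\<in>S. (b s)\<^sup>2)"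
proof -
  have "expectation (\<lambda>\<omega>. (\<Sum>s\<in>S. b s * \<zeta> s \<omega>)\<^sup>2) = (\<Sum>s\<in>S. \<Sum>u\<in>S. expectation (\<lambda>\<omega>. (b s * \<zeta> s \<omega>) * (b u * \<zeta> u \<omega>)))"
    by (intro integral_sum_power2 sqint_cmult zeta_sqint)
  also have "\<dots> = (\<Sum>s\<in>S. \<Sum>u\<in>S. if u = s then b s * b u else 0)"
    by (intro sum.cong refl, subst orthogonal_terms) (auto simp: prob_space sqint_const)
  finally show ?thesis using assms by (simp add: power2_eq_square)
qed

end

text \<open>For stationary summands with partial sums S this is the polarization 2 E(S_k S_l) = E
  S_k^2 + E S_l^2 - E (S_k - S_l)^2, where the last variance depends on the distance of k and l
  only. It produces the covariance shape of fractional Brownian motion.\<close>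

lemma toeplitz_cross_sum:
  fixes r :: "nat \<Rightarrow> real"
  defines "V \<equiv> \<lambda>k. \<Sum>t<k. \<Sum>u<k. r (nat \<bar>int t - int u\<bar>)"
  shows "2 * (\<Sum>t<k. \<Sum>u<l. r (nat \<bar>int t - int u\<bar>)) = V k + V l - V (nat \<bar>int k - int l\<bar>)"
proof -
  have main: "2 * (\<Sum>t<l + m. \<Sum>u<l. r (nat \<bar>int t - int u\<bar>)) = V (l + m) + V l - V m" for l m
  proof -
    define R where "R t u = r (nat \<bar>int t - int u\<bar>)" for t u
    have split: "(\<Sum>t<l + m. f t) = (\<Sum>t<l. f t) + (\<Sum>t<m. f (l + t))" for f :: "nat \<Rightarrow> real"
      by (induction m) auto
    have sh: "R (l + t) (l + u) = R t u" for t u by (simp add: R_def)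
    have sym: "(\<Sum>t<l. \<Sum>u<m. R t (l + u)) = (\<Sum>t<m. \<Sum>u<l. R (l + t) u)"
      by (subst sum.swap) (simp add: R_def abs_minus_commute)
    have "V (l + m) = V l + (\<Sum>t<l. \<Sum>u<m. R t (l + u)) + ((\<Sum>t<m. \<Sum>u<l. R (l + t) u) + V m)"
      unfolding V_def R_def[symmetric] by (simp add: split sum.distrib sh)
    moreover have "(\<Sum>t<l + m. \<Sum>u<l. R t u) = V l + (\<Sum>t<m. \<Sum>u<l. R (l + t) u)"
      unfolding V_def R_def[symmetric] by (simp add: split)
    ultimately show ?thesis using sym unfolding R_def[symmetric] by simp
  qed
  show ?thesis
  proof (cases "l \<le> k")
    case True
    then have "nat \<bar>int k - int l\<bar> = k - l" by linarith
    then show ?thesis using main[of l "k - l"] True by simp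
  next
    case False
    have "(\<Sum>t<k. \<Sum>u<l. r (nat \<bar>int t - int u\<bar>)) = (\<Sum>t<l. \<Sum>u<k. r (nat \<bar>int t - int u\<bar>))"
      by (subst sum.swap) (simp add: abs_minus_commute)
    moreover have "nat \<bar>int k - int l\<bar> = l - k" using False by linarith
    ultimately show ?thesis using main[of k "l - k"] False by simp
  qed
qed

text \<open>If x > 0, the index k n tends to infinity and the limits compose. If x = 0, it may fail
  to do so, and boundedness of V k / k^p suffices, because the other factor tends to 0.\<close>

lemma tendsto_regular_compose:
  fixes V :: "nat \<Rightarrow> real"
  assumes p: "0 < p" and V0: "V 0 = 0" and V: "(\<lambda>k. V k / real k powr p) \<longlonglongrightarrow> \<kappa>"
    and k: "(\<lambda>n. real (k n) / real n) \<longlonglongrightarrow> x" and x: "0 \<le> x"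
  shows "(\<lambda>n. V (k n) / real n powr p) \<longlonglongrightarrow> \<kappa> * x powr p"
proof -
  have eq: "V (k n) / real n powr p = V (k n) / real (k n) powr p * (real (k n) / real n) powr p" for n
    by (cases "k n = 0") (auto simp: V0 powr_divide)
  have pw: "(\<lambda>n. (real (k n) / real n) powr p) \<longlonglongrightarrow> x powr p"
    using p x by (intro tendsto_powr2 k tendsto_const) auto
  show ?thesis
  proof (cases "x = 0")
    case True
    have "Bseq (\<lambda>k. V k / real k powr p)" using V by (intro convergent_imp_Bseq convergentI)
    then obtain B where B: "\<And>k. norm (V k / real k powr p) \<le> B" unfolding Bseq_def by blast
    have "(\<lambda>n. V (k n) / real n powr p) \<longlonglongrightarrow> 0"
    proof (rule Lim_null_comparison)
      show "\<forall>\<^sub>F n in sequentially. norm (V (k n) / real n powr p) \<le> B * (real (k n) / real n) powr p"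
      proof (rule always_eventually, rule allI)
        fix n
        show "norm (V (k n) / real n powr p) \<le> B * (real (k n) / real n) powr p"
          unfolding eq[of n] norm_mult by (rule mult_mono[OF B]) (use order_trans[OF norm_ge_zero B[of 0]] in auto)
      qed
      show "(\<lambda>n. B * (real (k n) / real n) powr p) \<longlonglongrightarrow> 0"
        using tendsto_mult_right_zero[of _ _ B] pw True p by simp
    qed
    then show ?thesis using True p by simp
  next
    case False
    have "filterlim (\<lambda>n. real (k n) / real n * real n) at_top sequentially"
      by (rule filterlim_tendsto_pos_mult_at_top[OF k _ filterlim_real_sequentially]) (use x False in simp)
    moreover have "\<forall>\<^sub>F n in sequentially. real (k n) / real n * real n = real (k n)"
      by (rule eventually_sequentiallyI[of 1]) simp
    ultimately have "filterlim (\<lambda>n. real (k n)) at_top sequentially"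
      by (rule filterlim_cong[THEN iffD1, rotated -1, OF _ refl refl])
    then have "filterlim k at_top sequentially"
      unfolding filterlim_at_top by (metis (mono_tags) eventually_mono of_nat_le_iff)
    from tendsto_mult[OF filterlim_compose[OF V this] pw]
    show ?thesis unfolding eq .
  qed
qed

section \<open>Finite-dimensional limits of the normalised partial sums\<close>

context projective_model
begin

lemma autocov_linear_0: "(\<Sum>i<k. (\<alpha> i)\<^sup>2) \<le> autocov_linear 0" "0 \<le> autocov_linear 0"
proof -
  have "summable (\<lambda>i. \<bar>\<alpha> i * \<alpha> (0 + i) * 1\<bar>)"
    by (rule summable_autocov[of "\<lambda>i h. 1" 1]) simp
  then have s: "summable (\<lambda>i. (\<alpha> i)\<^sup>2)" by (simp add: power2_eq_square)
  have eq: "autocov_linear 0 = (\<Sum>i. (\<alpha> i)\<^sup>2)" by (simp add: autocov_linear_def power2_eq_square)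
  show "(\<Sum>i<k. (\<alpha> i)\<^sup>2) \<le> autocov_linear 0" unfolding eq by (rule sum_le_suminf[OF s]) auto
  show "0 \<le> autocov_linear 0" unfolding eq by (rule suminf_nonneg[OF s]) simp
qed

text \<open>Extension by 0 lets the linear sums at different times be written over one common set of
  innovations, so that weights can be collected per innovation.\<close>

definition linear_coeff :: "nat \<Rightarrow> int \<Rightarrow> real" where
  "linear_coeff k j = (if 0 \<le> j \<and> j < int k then \<alpha> (nat j) else 0)"

lemma linear_sum_eq:
  assumes "0 \<le> t" "t \<le> int n"
  shows "linear_sum t k \<omega> = (\<Sum>s\<in>{- int k..int n}. linear_coeff k (t - s) * \<zeta> s \<omega>)"
proof -
  have "linear_sum t k \<omega> = (\<Sum>s\<in>{t - int k<..t}. linear_coeff k (t - s) * \<zeta> s \<omega>)"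
    unfolding linear_sum_def chaos_sum_def linear_coeff_def
    by (rule sum.reindex_bij_witness[of _ "\<lambda>s. nat (t - s)" "\<lambda>i. t - int i"]) auto
  also have "\<dots> = (\<Sum>s\<in>{- int k..int n}. linear_coeff k (t - s) * \<zeta> s \<omega>)"
    by (rule sum.mono_neutral_left) (use assms in \<open>auto simp: linear_coeff_def\<close>)
  finally show ?thesis .
qed

text \<open>A single innovation enters the n linear sums with distinct coefficients of the sequence
  \<alpha>. The bound is uniform in n, k and s, and by Cauchy-Schwarz it keeps the collected weight
  of each innovation small.\<close>

lemma linear_coeff_sum_squares:
  "(\<Sum>t<n. (linear_coeff k (int (Suc t) - s))\<^sup>2) \<le> autocov_linear 0"
proof -
  define T where "T = {t \<in> {..<n}. 0 \<le> int (Suc t) - s \<and> int (Suc t) - s < int k}"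
  have "(\<Sum>t<n. (linear_coeff k (int (Suc t) - s))\<^sup>2) = (\<Sum>t\<in>T. (\<alpha> (nat (int (Suc t) - s)))\<^sup>2)"
    unfolding T_def linear_coeff_def by (rule sum.mono_neutral_cong_right) auto
  also have "\<dots> = (\<Sum>i\<in>(\<lambda>t. nat (int (Suc t) - s)) ` T. (\<alpha> i)\<^sup>2)"
    by (rule sum.reindex[symmetric, unfolded comp_def]) (auto simp: inj_on_def T_def)
  also have "\<dots> \<le> (\<Sum>i<k. (\<alpha> i)\<^sup>2)"
    by (rule sum_mono2) (auto simp: T_def)
  finally show ?thesis using autocov_linear_0(1)[of k] by simp
qed

text \<open>Reduces an arbitrary pair of times to the ordered case by exchanging the factors. The
  predicate P is left open to cover both equalities and bounds.\<close>

lemma autocov_expectation: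
  fixes f :: "int \<Rightarrow> 'a \<Rightarrow> real"
  assumes P: "\<And>u h. P (expectation (\<lambda>\<omega>. f u \<omega> * f (u + int h) \<omega>)) h"
  shows "P (expectation (\<lambda>\<omega>. f (int (Suc t)) \<omega> * f (int (Suc u)) \<omega>)) (nat \<bar>int t - int u\<bar>)"
proof (cases "t \<le> u")
  case True
  then have "int (Suc u) = int (Suc t) + int (u - t)" "nat \<bar>int t - int u\<bar> = u - t" by auto
  then show ?thesis using P[of "int (Suc t)" "u - t"] by (simp only:)
next
  case False
  then have "int (Suc t) = int (Suc u) + int (t - u)" "nat \<bar>int t - int u\<bar> = t - u" by auto
  then show ?thesis using P[of "int (Suc u)" "t - u"] by (simp only: mult.commute)
qed

text \<open>Three comparisons at fixed n: the sum with its truncation to k innovations, whose error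
  vanishes as k grows; the truncation with its linear part, at a cost bounded uniformly in k; and
  the linear part with a Gaussian, which requires small weights.\<close>

lemma char_weighted_sum:
  assumes "0 < \<epsilon>"
  shows "\<exists>\<delta>>0. \<forall>n w. (\<Sum>t<n. (w t)\<^sup>2) \<le> \<delta> \<longrightarrow>
    cmod ((\<integral>\<omega>. iexp (\<Sum>t<n. w t * X (int (Suc t)) \<omega>) \<partial>M)
        - exp (- (mean_Q\<^sup>2 * (\<Sum>t<n. \<Sum>u<n. w t * w u * autocov_linear (nat \<bar>int t - int u\<bar>))) / 2))
    \<le> \<epsilon> * (mean_Q\<^sup>2 * (\<Sum>t<n. \<Sum>u<n. w t * w u * autocov_linear (nat \<bar>int t - int u\<bar>)))
      + sqrt (\<Sum>t<n. \<Sum>u<n. \<bar>w t\<bar> * \<bar>w u\<bar> * error_bound (nat \<bar>int t - int u\<bar>))"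
proof -
  obtain \<eta> where \<eta>: "0 < \<eta>" "\<And>S b. finite S \<Longrightarrow> (\<forall>s\<in>S. \<bar>b s\<bar> \<le> \<eta>) \<Longrightarrow>
    cmod ((\<integral>\<omega>. iexp (\<Sum>s\<in>S. b s * \<zeta> s \<omega>) \<partial>M) - exp (- (\<Sum>s\<in>S. (b s)\<^sup>2) / 2)) \<le> \<epsilon> * (\<Sum>s\<in>S. (b s)\<^sup>2)"
    using char_linear_combination[OF assms] by blast
  define A where "A = mean_Q\<^sup>2 * autocov_linear 0 + 1"
  have A: "0 < A" "mean_Q\<^sup>2 * autocov_linear 0 \<le> A"
    unfolding A_def using mult_nonneg_nonneg[OF zero_le_power2[of mean_Q] autocov_linear_0(2)] by auto
  \<comment> \<open>The squared weight of one innovation is at most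
    \<open>mean_Q\<^sup>2 * autocov_linear 0\<close> times the sum of the squared w, so this choice
    keeps the weight below \<eta>. The + 1 in \<open>A\<close> excludes division by 0.\<close>
  define \<delta> where "\<delta> = \<eta>\<^sup>2 / A"
  have \<delta>: "0 < \<delta>" unfolding \<delta>_def using \<eta>(1) A(1) by simp
  have "cmod ((\<integral>\<omega>. iexp (\<Sum>t<n. w t * X (int (Suc t)) \<omega>) \<partial>M)
        - exp (- (mean_Q\<^sup>2 * (\<Sum>t<n. \<Sum>u<n. w t * w u * autocov_linear (nat \<bar>int t - int u\<bar>))) / 2))
    \<le> \<epsilon> * (mean_Q\<^sup>2 * (\<Sum>t<n. \<Sum>u<n. w t * w u * autocov_linear (nat \<bar>int t - int u\<bar>)))
      + sqrt (\<Sum>t<n. \<Sum>u<n. \<bar>w t\<bar> * \<bar>w u\<bar> * error_bound (nat \<bar>int t - int u\<bar>))"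
    if w: "(\<Sum>t<n. (w t)\<^sup>2) \<le> \<delta>" for n w
  proof -
    define \<tau> where "\<tau> t = int (Suc t)" for t
    define V where "V = (\<Sum>t<n. \<Sum>u<n. w t * w u * autocov_linear (nat \<bar>int t - int u\<bar>))"
    define R where "R = (\<Sum>t<n. \<Sum>u<n. \<bar>w t\<bar> * \<bar>w u\<bar> * error_bound (nat \<bar>int t - int u\<bar>))"
    define U where "U \<omega> = (\<Sum>t<n. w t * X (\<tau> t) \<omega>)" for \<omega>
    define P where "P k \<omega> = (\<Sum>t<n. w t * past \<alpha> Q (\<tau> t) k \<omega>)" for k \<omega>
    define L where "L k \<omega> = mean_Q * (\<Sum>t<n. w t * linear_sum (\<tau> t) k \<omega>)" for k \<omega>
    define D where "D k = sqrt (expectation (\<lambda>\<omega>. (U \<omega> - P k \<omega>)\<^sup>2))" for k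
    define Vk where "Vk k = expectation (\<lambda>\<omega>. (\<Sum>t<n. w t * linear_sum (\<tau> t) k \<omega>)\<^sup>2)" for k
    have sq: "U \<in> sqint M" "P k \<in> sqint M" "L k \<in> sqint M" for k
      unfolding U_def[abs_def] P_def[abs_def] L_def[abs_def]
      by (intro sqint_sum sqint_cmult X_sqint past_sqint linear_sum_sqint)+
    have D_lim: "D \<longlonglongrightarrow> 0"
    proof -
      have "(\<lambda>k. expectation (\<lambda>\<omega>. (\<Sum>t<n. w t * (X (\<tau> t) \<omega> - past \<alpha> Q (\<tau> t) k \<omega>))\<^sup>2)) \<longlonglongrightarrow> 0"
      proof (rule sqint_sum_tendsto_0)
        show "(\<lambda>\<omega>. w t * (X (\<tau> t) \<omega> - past \<alpha> Q (\<tau> t) k \<omega>)) \<in> sqint M" for t k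
          by (intro sqint_cmult sqint_diff X_sqint past_sqint)
        show "(\<lambda>k. expectation (\<lambda>\<omega>. (w t * (X (\<tau> t) \<omega> - past \<alpha> Q (\<tau> t) k \<omega>))\<^sup>2)) \<longlonglongrightarrow> 0" for t
          unfolding power_mult_distrib using tendsto_mult_right_zero[OF past_tendsto] by simp
      qed
      moreover have "U \<omega> - P k \<omega> = (\<Sum>t<n. w t * (X (\<tau> t) \<omega> - past \<alpha> Q (\<tau> t) k \<omega>))" for k \<omega>
        unfolding U_def P_def by (simp add: sum_subtractf right_diff_distrib)
      ultimately have "(\<lambda>k. expectation (\<lambda>\<omega>. (U \<omega> - P k \<omega>)\<^sup>2)) \<longlonglongrightarrow> 0" by simp
      from tendsto_real_sqrt[OF this] show ?thesis unfolding D_def by simp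
    qed
    have Vk_lim: "Vk \<longlonglongrightarrow> V"
    proof -
      have eq: "Vk k = (\<Sum>t<n. \<Sum>u<n. w t * w u * expectation (\<lambda>\<omega>. linear_sum (\<tau> t) k \<omega> * linear_sum (\<tau> u) k \<omega>))" for k
      proof -
        have "Vk k = (\<Sum>t<n. \<Sum>u<n. expectation (\<lambda>\<omega>. (w t * linear_sum (\<tau> t) k \<omega>) * (w u * linear_sum (\<tau> u) k \<omega>)))"
          unfolding Vk_def by (intro integral_sum_power2 sqint_cmult linear_sum_sqint)
        also have "\<dots> = (\<Sum>t<n. \<Sum>u<n. expectation (\<lambda>\<omega>. (w t * w u) * (linear_sum (\<tau> t) k \<omega> * linear_sum (\<tau> u) k \<omega>)))"
          by (simp add: mult_ac)
        finally show ?thesis by simp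
      qed
      have "(\<lambda>k. expectation (\<lambda>\<omega>. linear_sum (\<tau> t) k \<omega> * linear_sum (\<tau> u) k \<omega>)) \<longlonglongrightarrow> autocov_linear (nat \<bar>int t - int u\<bar>)" for t u
      proof (cases "t \<le> u")
        case True
        then have "\<tau> u = \<tau> t + int (u - t)" "nat \<bar>int t - int u\<bar> = u - t" by (auto simp: \<tau>_def)
        then show ?thesis using linear_sum_autocov_tendsto[of "\<tau> t" "u - t"] by (simp only:)
      next
        case False
        then have "\<tau> t = \<tau> u + int (t - u)" "nat \<bar>int t - int u\<bar> = t - u" by (auto simp: \<tau>_def)
        then show ?thesis using linear_sum_autocov_tendsto[of "\<tau> u" "t - u"] by (simp only: mult.commute)
      qed
      then show ?thesis unfolding eq V_def by (intro tendsto_intros)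
    qed
    have PL: "sqrt (expectation (\<lambda>\<omega>. (P k \<omega> - L k \<omega>)\<^sup>2)) \<le> sqrt R" for k
    proof -
      have "P k \<omega> - L k \<omega> = (\<Sum>t<n. w t * error_sum (\<tau> t) k \<omega>)" for \<omega>
        unfolding P_def L_def past_decomp by (simp add: sum_distrib_left sum_subtractf[symmetric] algebra_simps)
      then have "expectation (\<lambda>\<omega>. (P k \<omega> - L k \<omega>)\<^sup>2) = expectation (\<lambda>\<omega>. (\<Sum>t<n. w t * error_sum (\<tau> t) k \<omega>)\<^sup>2)"
        by simp
      also have "\<dots> = (\<Sum>t<n. \<Sum>u<n. expectation (\<lambda>\<omega>. (w t * error_sum (\<tau> t) k \<omega>) * (w u * error_sum (\<tau> u) k \<omega>)))"
        by (intro integral_sum_power2 sqint_cmult error_sum_sqint)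
      also have "\<dots> = (\<Sum>t<n. \<Sum>u<n. expectation (\<lambda>\<omega>. (w t * w u) * (error_sum (\<tau> t) k \<omega> * error_sum (\<tau> u) k \<omega>)))"
        by (simp add: mult_ac)
      also have "\<dots> = (\<Sum>t<n. \<Sum>u<n. (w t * w u) * expectation (\<lambda>\<omega>. error_sum (\<tau> t) k \<omega> * error_sum (\<tau> u) k \<omega>))"
        by simp
      also have "\<dots> \<le> R"
        unfolding R_def
      proof (intro sum_mono)
        fix t u
        have "\<bar>expectation (\<lambda>\<omega>. error_sum (\<tau> t) k \<omega> * error_sum (\<tau> u) k \<omega>)\<bar> \<le> error_bound (nat \<bar>int t - int u\<bar>)"
          unfolding \<tau>_def
          by (rule autocov_expectation[where f="\<lambda>t. error_sum t k" and P="\<lambda>x h. \<bar>x\<bar> \<le> error_bound h", OF expectation_error_sum_mult])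
        then have "\<bar>w t * w u\<bar> * \<bar>expectation (\<lambda>\<omega>. error_sum (\<tau> t) k \<omega> * error_sum (\<tau> u) k \<omega>)\<bar> \<le> \<bar>w t * w u\<bar> * error_bound (nat \<bar>int t - int u\<bar>)"
          by (rule mult_left_mono) simp
        then show "(w t * w u) * expectation (\<lambda>\<omega>. error_sum (\<tau> t) k \<omega> * error_sum (\<tau> u) k \<omega>) \<le> \<bar>w t\<bar> * \<bar>w u\<bar> * error_bound (nat \<bar>int t - int u\<bar>)"
          unfolding abs_mult[symmetric] by (simp add: abs_le_iff)
      qed
      finally show ?thesis by simp
    qed
    have LG: "cmod ((\<integral>\<omega>. iexp (L k \<omega>) \<partial>M) - exp (- (mean_Q\<^sup>2 * Vk k) / 2)) \<le> \<epsilon> * (mean_Q\<^sup>2 * Vk k)" for k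
    proof -
      define S where "S = {- int k..int n}"
      define b where "b s = (\<Sum>t<n. w t * linear_coeff k (\<tau> t - s))" for s
      have lin: "(\<Sum>t<n. w t * linear_sum (\<tau> t) k \<omega>) = (\<Sum>s\<in>S. b s * \<zeta> s \<omega>)" for \<omega>
      proof -
        have "(\<Sum>t<n. w t * linear_sum (\<tau> t) k \<omega>) = (\<Sum>t<n. \<Sum>s\<in>S. w t * linear_coeff k (\<tau> t - s) * \<zeta> s \<omega>)"
        proof (rule sum.cong[OF refl])
          fix t assume "t \<in> {..<n}"
          then show "w t * linear_sum (\<tau> t) k \<omega> = (\<Sum>s\<in>S. w t * linear_coeff k (\<tau> t - s) * \<zeta> s \<omega>)"
            unfolding S_def by (subst linear_sum_eq[where n=n]) (auto simp: \<tau>_def sum_distrib_left mult_ac)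
        qed
        also have "\<dots> = (\<Sum>s\<in>S. b s * \<zeta> s \<omega>)"
          unfolding b_def by (subst sum.swap) (simp add: sum_distrib_right)
        finally show ?thesis .
      qed
      have Vk_eq: "Vk k = (\<Sum>s\<in>S. (b s)\<^sup>2)"
        unfolding Vk_def lin by (rule expectation_linear_combination) (simp add: S_def)
      have b_bound: "\<bar>mean_Q * b s\<bar> \<le> \<eta>" for s
      proof -
        have "(b s)\<^sup>2 \<le> (\<Sum>t<n. (w t)\<^sup>2) * (\<Sum>t<n. (linear_coeff k (\<tau> t - s))\<^sup>2)"
          unfolding b_def by (rule Cauchy_Schwarz_ineq_sum)
        also have "\<dots> \<le> \<delta> * autocov_linear 0"
          using w \<delta> linear_coeff_sum_squares unfolding \<tau>_def by (intro mult_mono) (auto intro: sum_nonneg)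
        finally have "mean_Q\<^sup>2 * (b s)\<^sup>2 \<le> mean_Q\<^sup>2 * (\<delta> * autocov_linear 0)"
          by (rule mult_left_mono) simp
        also have "\<dots> = \<delta> * (mean_Q\<^sup>2 * autocov_linear 0)" by simp
        also have "\<dots> \<le> \<delta> * A" using A(2) \<delta> by (intro mult_left_mono) auto
        also have "\<dots> = \<eta>\<^sup>2" unfolding \<delta>_def using A(1) by simp
        finally have "(mean_Q * b s)\<^sup>2 \<le> \<eta>\<^sup>2" by (simp add: power_mult_distrib)
        then show ?thesis using \<eta>(1) by (simp add: abs_le_square_iff[symmetric])
      qed
      have "L k \<omega> = (\<Sum>s\<in>S. (mean_Q * b s) * \<zeta> s \<omega>)" for \<omega>
        unfolding L_def lin by (simp add: sum_distrib_left mult_ac)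
      moreover have "mean_Q\<^sup>2 * Vk k = (\<Sum>s\<in>S. (mean_Q * b s)\<^sup>2)"
        unfolding Vk_eq by (simp add: sum_distrib_left power_mult_distrib)
      ultimately show ?thesis
        using \<eta>(2)[of S "\<lambda>s. mean_Q * b s"] b_bound by (simp add: S_def)
    qed
    have "cmod ((\<integral>\<omega>. iexp (U \<omega>) \<partial>M) - exp (- (mean_Q\<^sup>2 * V) / 2)) \<le> \<epsilon> * (mean_Q\<^sup>2 * V) + sqrt R"
    proof (rule LIMSEQ_le_const)
      have "(\<lambda>k. D k + sqrt R + \<epsilon> * (mean_Q\<^sup>2 * Vk k) + \<bar>exp (- (mean_Q\<^sup>2 * Vk k) / 2) - exp (- (mean_Q\<^sup>2 * V) / 2)\<bar>)
        \<longlonglongrightarrow> 0 + sqrt R + \<epsilon> * (mean_Q\<^sup>2 * V) + \<bar>exp (- (mean_Q\<^sup>2 * V) / 2) - exp (- (mean_Q\<^sup>2 * V) / 2)\<bar>"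
        by (intro tendsto_intros D_lim Vk_lim) simp_all
      then show "(\<lambda>k. D k + sqrt R + \<epsilon> * (mean_Q\<^sup>2 * Vk k) + \<bar>exp (- (mean_Q\<^sup>2 * Vk k) / 2) - exp (- (mean_Q\<^sup>2 * V) / 2)\<bar>)
        \<longlonglongrightarrow> \<epsilon> * (mean_Q\<^sup>2 * V) + sqrt R" by (simp add: add.commute)
      show "\<exists>N. \<forall>k\<ge>N. cmod ((\<integral>\<omega>. iexp (U \<omega>) \<partial>M) - exp (- (mean_Q\<^sup>2 * V) / 2))
        \<le> D k + sqrt R + \<epsilon> * (mean_Q\<^sup>2 * Vk k) + \<bar>exp (- (mean_Q\<^sup>2 * Vk k) / 2) - exp (- (mean_Q\<^sup>2 * V) / 2)\<bar>"
      proof (intro exI allI impI)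
        fix k
        have 1: "cmod ((\<integral>\<omega>. iexp (U \<omega>) \<partial>M) - (\<integral>\<omega>. iexp (P k \<omega>) \<partial>M)) \<le> D k"
          unfolding D_def by (rule expectation_iexp_diff_le[OF sq(1,2)])
        have 2: "cmod ((\<integral>\<omega>. iexp (P k \<omega>) \<partial>M) - (\<integral>\<omega>. iexp (L k \<omega>) \<partial>M)) \<le> sqrt R"
          by (rule order_trans[OF expectation_iexp_diff_le[OF sq(2,3)] PL])
        have 3: "cmod (complex_of_real (exp (- (mean_Q\<^sup>2 * Vk k) / 2)) - exp (- (mean_Q\<^sup>2 * V) / 2))
          \<le> \<bar>exp (- (mean_Q\<^sup>2 * Vk k) / 2) - exp (- (mean_Q\<^sup>2 * V) / 2)\<bar>"
          by (simp only: of_real_diff[symmetric] norm_of_real order_refl)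
        show "cmod ((\<integral>\<omega>. iexp (U \<omega>) \<partial>M) - exp (- (mean_Q\<^sup>2 * V) / 2))
          \<le> D k + sqrt R + \<epsilon> * (mean_Q\<^sup>2 * Vk k) + \<bar>exp (- (mean_Q\<^sup>2 * Vk k) / 2) - exp (- (mean_Q\<^sup>2 * V) / 2)\<bar>"
          by (rule norm_diff_triangle_le[OF norm_diff_triangle_le[OF norm_diff_triangle_le[OF 1 2] LG] 3])
      qed
    qed
    then show ?thesis unfolding U_def V_def R_def \<tau>_def .
  qed
  then show ?thesis using \<delta> by blast
qed

text \<open>The covariance of fractional Brownian motion with 2 H = 1 + 2 d.\<close>

definition limit_cov :: "real \<Rightarrow> real \<Rightarrow> real" where
  "limit_cov x y = (x powr (1 + 2 * d) + y powr (1 + 2 * d) - \<bar>x - y\<bar> powr (1 + 2 * d)) / 2"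

text \<open>A linear combination of partial sums is one weighted sum of the variables X, with
  weights of order n^(-1/2 - d). Their squares sum to order n^(-2 d), so the Gaussian comparison
  applies, and the error term is at most a multiple of \<open>E0 n / real n powr p\<close>, which
  tends to 0.\<close>

lemma finite_dim_char_tendsto:
  fixes k :: "nat \<Rightarrow> nat \<Rightarrow> nat"
  assumes k: "\<And>j. j < m \<Longrightarrow> (\<lambda>n. real (k j n) / real n) \<longlonglongrightarrow> x j" "\<And>j n. j < m \<Longrightarrow> k j n \<le> n"
    and x: "\<And>j. j < m \<Longrightarrow> 0 \<le> x j"
  shows "(\<lambda>n. \<integral>\<omega>. iexp (\<Sum>j<m. \<theta> j * (real n powr (- 1 / 2 - d) * (\<Sum>t<k j n. X (int (Suc t)) \<omega>))) \<partial>M)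
    \<longlonglongrightarrow> exp (- (mean_Q\<^sup>2 * (Beta d (1 - 2 * d) / (d * (1 + 2 * d)) *
        (\<Sum>i<m. \<Sum>j<m. \<theta> i * \<theta> j * limit_cov (x i) (x j)))) / 2)"
proof -
  define p where "p = 1 + 2 * d"
  have p: "0 < p" using d_pos by (simp add: p_def)
  define sc where "sc n = real n powr (- 1 / 2 - d)" for n
  have sc2: "sc n * sc n = 1 / real n powr p" for n
    unfolding sc_def p_def powr_add[symmetric] powr_minus_divide[symmetric] by (simp add: algebra_simps)
  have sc0: "0 \<le> sc n" for n by (simp add: sc_def)
  define \<kappa> where "\<kappa> = Beta d (1 - 2 * d) / (d * (1 + 2 * d))"
  define V0 where "V0 k = (\<Sum>t<k. \<Sum>u<k. autocov_linear (nat \<bar>int t - int u\<bar>))" for k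
  define E0 where "E0 k = (\<Sum>t<k. \<Sum>u<k. error_bound (nat \<bar>int t - int u\<bar>))" for k
  have V0: "(\<lambda>k. V0 k / real k powr p) \<longlonglongrightarrow> \<kappa>"
    unfolding V0_def \<kappa>_def p_def by (rule toeplitz_sum_asymp[OF d_pos autocov_linear_asymp])
  have E0: "(\<lambda>k. E0 k / real k powr p) \<longlonglongrightarrow> 0"
    using toeplitz_sum_asymp[OF d_pos error_bound_asymp] unfolding E0_def p_def by simp
  define w where "w n t = sc n * (\<Sum>j<m. if t < k j n then \<theta> j else 0)" for n t
  define \<Lambda> where "\<Lambda> = (\<Sum>j<m. \<bar>\<theta> j\<bar>)"
  have \<Lambda>: "0 \<le> \<Lambda>" unfolding \<Lambda>_def by (rule sum_nonneg) simp
  have w_bound: "\<bar>w n t\<bar> \<le> sc n * \<Lambda>" for n t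
  proof -
    have "\<bar>\<Sum>j<m. if t < k j n then \<theta> j else 0\<bar> \<le> \<Lambda>"
      unfolding \<Lambda>_def by (rule order_trans[OF sum_abs]) (auto intro: sum_mono)
    then show ?thesis unfolding w_def abs_mult using sc0[of n] by (auto intro!: mult_left_mono)
  qed
  have restrict: "(\<Sum>t<n. (if t < k j n then \<theta> j else 0) * f t) = \<theta> j * (\<Sum>t<k j n. f t)" if "j < m" for f n and j
  proof -
    have "(\<Sum>t<n. (if t < k j n then \<theta> j else 0) * f t) = (\<Sum>t\<in>{..<k j n}. \<theta> j * f t)"
      by (rule sum.mono_neutral_cong_right) (use k(2)[OF that, of n] in auto)
    then show ?thesis by (simp add: sum_distrib_left)
  qed
  have w_sum: "(\<Sum>t<n. w n t * f t) = (\<Sum>j<m. \<theta> j * (sc n * (\<Sum>t<k j n. f t)))" for n f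
  proof -
    have "(\<Sum>t<n. w n t * f t) = sc n * (\<Sum>j<m. \<Sum>t<n. (if t < k j n then \<theta> j else 0) * f t)"
      unfolding w_def sum_distrib_left sum_distrib_right by (subst sum.swap) (simp add: mult_ac)
    also have "\<dots> = sc n * (\<Sum>j<m. \<theta> j * (\<Sum>t<k j n. f t))"
      by (simp add: restrict)
    finally show ?thesis by (simp add: sum_distrib_left mult_ac)
  qed
  define V where "V n = (\<Sum>t<n. \<Sum>u<n. w n t * w n u * autocov_linear (nat \<bar>int t - int u\<bar>))" for n
  define R where "R n = (\<Sum>t<n. \<Sum>u<n. \<bar>w n t\<bar> * \<bar>w n u\<bar> * error_bound (nat \<bar>int t - int u\<bar>))" for n
  define s where "s = (\<Sum>i<m. \<Sum>j<m. \<theta> i * \<theta> j * limit_cov (x i) (x j))"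
  have V_lim: "V \<longlonglongrightarrow> \<kappa> * s"
  proof -
    have eq: "V n = (\<Sum>i<m. \<Sum>j<m. \<theta> i * \<theta> j * ((V0 (k i n) / real n powr p + V0 (k j n) / real n powr p
        - V0 (nat \<bar>int (k i n) - int (k j n)\<bar>) / real n powr p) / 2))" for n
    proof -
      have "V n = (\<Sum>t<n. w n t * (\<Sum>u<n. w n u * autocov_linear (nat \<bar>int t - int u\<bar>)))"
        unfolding V_def by (simp add: sum_distrib_left mult_ac)
      also have "\<dots> = (\<Sum>i<m. \<theta> i * (sc n * (\<Sum>t<k i n. \<Sum>j<m. \<theta> j * (sc n * (\<Sum>u<k j n. autocov_linear (nat \<bar>int t - int u\<bar>))))))"
        unfolding w_sum ..
      also have "\<dots> = (\<Sum>i<m. \<Sum>j<m. \<theta> i * \<theta> j * ((sc n * sc n) * (\<Sum>t<k i n. \<Sum>u<k j n. autocov_linear (nat \<bar>int t - int u\<bar>))))"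
      proof (rule sum.cong[OF refl])
        fix i
        show "\<theta> i * (sc n * (\<Sum>t<k i n. \<Sum>j<m. \<theta> j * (sc n * (\<Sum>u<k j n. autocov_linear (nat \<bar>int t - int u\<bar>))))) =
          (\<Sum>j<m. \<theta> i * \<theta> j * ((sc n * sc n) * (\<Sum>t<k i n. \<Sum>u<k j n. autocov_linear (nat \<bar>int t - int u\<bar>))))"
          by (subst sum.swap) (simp add: sum_distrib_left mult_ac)
      qed
      also have "\<dots> = (\<Sum>i<m. \<Sum>j<m. \<theta> i * \<theta> j * ((V0 (k i n) / real n powr p + V0 (k j n) / real n powr p
        - V0 (nat \<bar>int (k i n) - int (k j n)\<bar>) / real n powr p) / 2))"
      proof (intro sum.cong refl)
        fix i j
        have "(\<Sum>t<k i n. \<Sum>u<k j n. autocov_linear (nat \<bar>int t - int u\<bar>)) =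
          (V0 (k i n) + V0 (k j n) - V0 (nat \<bar>int (k i n) - int (k j n)\<bar>)) / 2"
          using toeplitz_cross_sum[of autocov_linear "k j n" "k i n"] unfolding V0_def by simp
        then show "\<theta> i * \<theta> j * ((sc n * sc n) * (\<Sum>t<k i n. \<Sum>u<k j n. autocov_linear (nat \<bar>int t - int u\<bar>))) =
          \<theta> i * \<theta> j * ((V0 (k i n) / real n powr p + V0 (k j n) / real n powr p
            - V0 (nat \<bar>int (k i n) - int (k j n)\<bar>) / real n powr p) / 2)"
          unfolding sc2 by (simp add: add_divide_distrib diff_divide_distrib)
      qed
      finally show ?thesis .
    qed
    have lim: "(\<lambda>n. V0 (l n) / real n powr p) \<longlonglongrightarrow> \<kappa> * y powr p"
      if "(\<lambda>n. real (l n) / real n) \<longlonglongrightarrow> y" "0 \<le> y" for l y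
      by (rule tendsto_regular_compose[OF p _ V0 that]) (simp add: V0_def)
    have "(\<lambda>n. real (nat \<bar>int (k i n) - int (k j n)\<bar>) / real n) \<longlonglongrightarrow> \<bar>x i - x j\<bar>" if "i < m" "j < m" for i j
    proof -
      have "real (nat \<bar>int (k i n) - int (k j n)\<bar>) / real n = \<bar>real (k i n) / real n - real (k j n) / real n\<bar>" for n
      proof -
        have "real (nat \<bar>int (k i n) - int (k j n)\<bar>) = \<bar>real (k i n) - real (k j n)\<bar>" by simp
        then show ?thesis by (simp add: abs_divide flip: diff_divide_distrib)
      qed
      then show ?thesis using that by (auto intro!: tendsto_intros k)
    qed
    then have "(\<lambda>n. \<Sum>i<m. \<Sum>j<m. \<theta> i * \<theta> j * ((V0 (k i n) / real n powr p + V0 (k j n) / real n powr p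
        - V0 (nat \<bar>int (k i n) - int (k j n)\<bar>) / real n powr p) / 2))
      \<longlonglongrightarrow> (\<Sum>i<m. \<Sum>j<m. \<theta> i * \<theta> j * ((\<kappa> * x i powr p + \<kappa> * x j powr p - \<kappa> * \<bar>x i - x j\<bar> powr p) / 2))"
      by (intro tendsto_intros lim k x) auto
    also have "(\<Sum>i<m. \<Sum>j<m. \<theta> i * \<theta> j * ((\<kappa> * x i powr p + \<kappa> * x j powr p - \<kappa> * \<bar>x i - x j\<bar> powr p) / 2)) = \<kappa> * s"
      unfolding s_def limit_cov_def p_def sum_distrib_left by (intro sum.cong refl) (simp add: algebra_simps)
    finally show ?thesis unfolding eq .
  qed
  have R_nonneg: "0 \<le> error_bound h" for h
    unfolding error_bound_def
    by (cases "summable (\<lambda>i. \<bar>\<alpha> i\<bar> * \<bar>\<alpha> (h + i)\<bar> * \<bar>centred_cov_q i h\<bar>)")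
      (auto intro: suminf_nonneg, metis expectation_error_sum_mult abs_ge_zero error_bound_def order_trans)
  have R_lim: "R \<longlonglongrightarrow> 0"
  proof (rule Lim_null_comparison)
    show "(\<lambda>n. \<Lambda> * \<Lambda> * (E0 n / real n powr p)) \<longlonglongrightarrow> 0"
      using tendsto_mult_right_zero[OF E0] .
    show "\<forall>\<^sub>F n in sequentially. norm (R n) \<le> \<Lambda> * \<Lambda> * (E0 n / real n powr p)"
    proof (rule always_eventually, rule allI)
      fix n
      have "0 \<le> R n" unfolding R_def using R_nonneg by (intro sum_nonneg mult_nonneg_nonneg) auto
      moreover have "R n \<le> (\<Sum>t<n. \<Sum>u<n. (sc n * \<Lambda>) * (sc n * \<Lambda>) * error_bound (nat \<bar>int t - int u\<bar>))"
        unfolding R_def using R_nonneg w_bound \<Lambda> sc0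
        by (intro sum_mono mult_right_mono mult_mono) auto
      moreover have "(\<Sum>t<n. \<Sum>u<n. (sc n * \<Lambda>) * (sc n * \<Lambda>) * error_bound (nat \<bar>int t - int u\<bar>)) = (sc n * sc n) * (\<Lambda> * \<Lambda>) * E0 n"
        unfolding E0_def by (simp add: sum_distrib_left mult_ac)
      ultimately show "norm (R n) \<le> \<Lambda> * \<Lambda> * (E0 n / real n powr p)"
        unfolding sc2 by simp
    qed
  qed
  have W_lim: "(\<lambda>n. \<Sum>t<n. (w n t)\<^sup>2) \<longlonglongrightarrow> 0"
  proof (rule Lim_null_comparison)
    show "\<forall>\<^sub>F n in sequentially. norm (\<Sum>t<n. (w n t)\<^sup>2) \<le> \<Lambda>\<^sup>2 * (real n / real n powr p)"
    proof (rule always_eventually, rule allI)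
      fix n
      have "(\<Sum>t<n. (w n t)\<^sup>2) \<le> (\<Sum>t<n. (sc n * \<Lambda>)\<^sup>2)"
        using w_bound[of n] sc0[of n] \<Lambda> by (intro sum_mono) (simp add: abs_le_square_iff[symmetric])
      also have "\<dots> = \<Lambda>\<^sup>2 * (real n * (sc n * sc n))" by (simp add: power2_eq_square mult_ac)
      finally show "norm (\<Sum>t<n. (w n t)\<^sup>2) \<le> \<Lambda>\<^sup>2 * (real n / real n powr p)"
        unfolding sc2 by (simp add: sum_nonneg)
    qed
    have "(\<lambda>n. real n / real n powr p) \<longlonglongrightarrow> 0"
      unfolding p_def using d_pos by real_asymp
    then show "(\<lambda>n. \<Lambda>\<^sup>2 * (real n / real n powr p)) \<longlonglongrightarrow> 0"
      by (rule tendsto_mult_right_zero)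
  qed
  define \<psi> where "\<psi> n = (\<integral>\<omega>. iexp (\<Sum>t<n. w n t * X (int (Suc t)) \<omega>) \<partial>M)" for n
  have main: "(\<lambda>n. \<psi> n - complex_of_real (exp (- (mean_Q\<^sup>2 * V n) / 2))) \<longlonglongrightarrow> 0"
  proof (rule LIMSEQ_I)
    fix r :: real assume r: "0 < r"
    \<comment> \<open>Scaled by the limit variance, so that the Gaussian comparison costs at most r
      / 4 in the limit; the + 1 covers variance 0.\<close>
    define \<epsilon> where "\<epsilon> = r / (4 * (\<bar>mean_Q\<^sup>2 * (\<kappa> * s)\<bar> + 1))"
    have \<epsilon>: "0 < \<epsilon>" unfolding \<epsilon>_def using r by (intro divide_pos_pos) auto
    obtain \<delta> where \<delta>: "0 < \<delta>" "\<And>n w. (\<Sum>t<n. (w t)\<^sup>2) \<le> \<delta> \<Longrightarrow>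
      cmod ((\<integral>\<omega>. iexp (\<Sum>t<n. w t * X (int (Suc t)) \<omega>) \<partial>M)
        - exp (- (mean_Q\<^sup>2 * (\<Sum>t<n. \<Sum>u<n. w t * w u * autocov_linear (nat \<bar>int t - int u\<bar>))) / 2))
      \<le> \<epsilon> * (mean_Q\<^sup>2 * (\<Sum>t<n. \<Sum>u<n. w t * w u * autocov_linear (nat \<bar>int t - int u\<bar>)))
      + sqrt (\<Sum>t<n. \<Sum>u<n. \<bar>w t\<bar> * \<bar>w u\<bar> * error_bound (nat \<bar>int t - int u\<bar>))"
      using char_weighted_sum[OF \<epsilon>] by blast
    have "(\<lambda>n. \<epsilon> * (mean_Q\<^sup>2 * V n) + sqrt (R n)) \<longlonglongrightarrow> \<epsilon> * (mean_Q\<^sup>2 * (\<kappa> * s)) + sqrt 0"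
      by (intro tendsto_intros V_lim R_lim)
    moreover have "\<epsilon> * (mean_Q\<^sup>2 * (\<kappa> * s)) + sqrt 0 < r"
    proof -
      define y where "y = mean_Q\<^sup>2 * (\<kappa> * s)"
      have "\<epsilon> * y \<le> \<epsilon> * (\<bar>y\<bar> + 1)" using \<epsilon> by (intro mult_left_mono) auto
      also have "\<dots> = r / 4" unfolding \<epsilon>_def y_def[symmetric]
        by (simp add: field_simps add_nonneg_eq_0_iff)
      finally show ?thesis using r unfolding y_def by simp
    qed
    ultimately have "\<forall>\<^sub>F n in sequentially. \<epsilon> * (mean_Q\<^sup>2 * V n) + sqrt (R n) < r"
      by (rule order_tendstoD(2))
    moreover have "\<forall>\<^sub>F n in sequentially. (\<Sum>t<n. (w n t)\<^sup>2) < \<delta>"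
      by (rule order_tendstoD(2)[OF W_lim \<delta>(1)])
    ultimately have "\<forall>\<^sub>F n in sequentially. norm (\<psi> n - complex_of_real (exp (- (mean_Q\<^sup>2 * V n) / 2)) - 0) < r"
    proof eventually_elim
      case (elim n)
      then show ?case using \<delta>(2)[of "w n" n] unfolding \<psi>_def V_def R_def by simp
    qed
    then show "\<exists>no. \<forall>n\<ge>no. norm (\<psi> n - complex_of_real (exp (- (mean_Q\<^sup>2 * V n) / 2)) - 0) < r"
      unfolding eventually_sequentially .
  qed
  have "(\<lambda>n. complex_of_real (exp (- (mean_Q\<^sup>2 * V n) / 2))) \<longlonglongrightarrow> complex_of_real (exp (- (mean_Q\<^sup>2 * (\<kappa> * s)) / 2))"
    by (intro tendsto_intros V_lim) simp
  from tendsto_add[OF main this]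
  have "\<psi> \<longlonglongrightarrow> complex_of_real (exp (- (mean_Q\<^sup>2 * (\<kappa> * s)) / 2))" by simp
  then show ?thesis
    unfolding \<psi>_def w_sum sc_def \<kappa>_def s_def .
qed

end

section \<open>Weak convergence in the Skorohod space\<close>

definition (in Metric_space) lip_bounded :: "('a \<Rightarrow> real) \<Rightarrow> bool" where
  "lip_bounded \<phi> \<longleftrightarrow> (\<exists>B. \<forall>x\<in>M. \<bar>\<phi> x\<bar> \<le> B) \<and> (\<exists>L\<ge>0. \<forall>x\<in>M. \<forall>y\<in>M. \<bar>\<phi> x - \<phi> y\<bar> \<le> L * d x y)"

text \<open>Inf-convolutions are Lipschitz and increase to a given bounded lower semicontinuous function. They reduce
  measurability and convergence in distribution to Lipschitz test functions.\<close>

context Metric_space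
begin

definition inf_conv :: "('a \<Rightarrow> real) \<Rightarrow> real \<Rightarrow> 'a \<Rightarrow> real" where
  "inf_conv \<psi> k x = (INF y\<in>M. \<psi> y + k * d x y)"

lemma inf_conv_lower:
  assumes B: "\<forall>x\<in>M. \<bar>\<psi> x\<bar> \<le> B" and k: "0 \<le> k" and x: "x \<in> M" and y: "y \<in> M"
  shows "inf_conv \<psi> k x \<le> \<psi> y + k * d x y"
  unfolding inf_conv_def
proof (rule cINF_lower[OF _ y])
  have "- B \<le> \<psi> y + k * d x y" if "y \<in> M" for y
    using B[rule_format, OF that] mult_nonneg_nonneg[OF k nonneg[of x y]] by (simp add: abs_le_iff)
  then show "bdd_below ((\<lambda>y. \<psi> y + k * d x y) ` M)" by (auto intro!: bdd_belowI)
qed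

lemma inf_conv_greatest:
  assumes "x \<in> M" "\<And>y. y \<in> M \<Longrightarrow> c \<le> \<psi> y + k * d x y"
  shows "c \<le> inf_conv \<psi> k x"
  unfolding inf_conv_def using assms by (intro cINF_greatest) auto

lemma inf_conv_le:
  assumes "\<forall>x\<in>M. \<bar>\<psi> x\<bar> \<le> B" "0 \<le> k" "x \<in> M"
  shows "inf_conv \<psi> k x \<le> \<psi> x"
  using inf_conv_lower[OF assms assms(3)] assms(3) by simp

lemma inf_conv_bound:
  assumes "\<forall>x\<in>M. \<bar>\<psi> x\<bar> \<le> B" "0 \<le> k" "x \<in> M"
  shows "\<bar>inf_conv \<psi> k x\<bar> \<le> B"
proof -
  have "- B \<le> inf_conv \<psi> k x"
  proof (rule inf_conv_greatest[OF assms(3)])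
    fix y assume "y \<in> M"
    then show "- B \<le> \<psi> y + k * d x y"
      using assms(1)[rule_format, of y] mult_nonneg_nonneg[OF assms(2) nonneg[of x y]]
      by (simp add: abs_le_iff)
  qed
  moreover have "inf_conv \<psi> k x \<le> B"
    using inf_conv_le[OF assms] assms(1,3) by (force simp: abs_le_iff)
  ultimately show ?thesis by simp
qed

lemma lip_bounded_inf_conv:
  assumes B: "\<forall>x\<in>M. \<bar>\<psi> x\<bar> \<le> B" and k: "0 \<le> k"
  shows "lip_bounded (inf_conv \<psi> k)"
proof -
  have le: "inf_conv \<psi> k x - k * d x y \<le> inf_conv \<psi> k y" if x: "x \<in> M" and y: "y \<in> M" for x y
  proof (rule inf_conv_greatest[OF y])
    fix z assume z: "z \<in> M"
    have "inf_conv \<psi> k x \<le> \<psi> z + k * d x z" by (rule inf_conv_lower[OF B k x z])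
    also have "\<dots> \<le> \<psi> z + k * (d x y + d y z)"
      using triangle[OF x y z] k by (simp add: mult_left_mono)
    finally show "inf_conv \<psi> k x - k * d x y \<le> \<psi> z + k * d y z" by (simp add: distrib_left)
  qed
  have "\<bar>inf_conv \<psi> k x - inf_conv \<psi> k y\<bar> \<le> k * d x y" if "x \<in> M" "y \<in> M" for x y
    using le[OF that] le[OF that(2,1)] by (simp add: commute[of y x] abs_le_iff)
  then show ?thesis
    unfolding lip_bounded_def using inf_conv_bound[OF B k] k by blast
qed

text \<open>Near x, lower semicontinuity bounds \<psi> from below. Outside a ball of radius r the
  penalty exceeds the oscillation 2 B as soon as k > 2 B / r.\<close>

lemma inf_conv_tendsto:
  fixes \<psi> :: "'a \<Rightarrow> real"
  assumes B: "\<forall>x\<in>M. \<bar>\<psi> x\<bar> \<le> B" and lsc: "\<And>c. openin mtopology {x \<in> M. c < \<psi> x}" and x: "x \<in> M"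
  shows "(\<lambda>k. inf_conv \<psi> (real k) x) \<longlonglongrightarrow> \<psi> x"
proof (rule LIMSEQ_I)
  fix \<epsilon> :: real assume \<epsilon>: "0 < \<epsilon>"
  have "openin mtopology {y \<in> M. \<psi> x - \<epsilon> / 2 < \<psi> y}" by (rule lsc)
  moreover have "x \<in> {y \<in> M. \<psi> x - \<epsilon> / 2 < \<psi> y}" using x \<epsilon> by simp
  ultimately obtain r where r: "0 < r" "mball x r \<subseteq> {y \<in> M. \<psi> x - \<epsilon> / 2 < \<psi> y}"
    unfolding openin_mtopology by blast
  obtain k0 where k0: "2 * B / r < real k0" using reals_Archimedean2 by blast
  have "norm (inf_conv \<psi> (real k) x - \<psi> x) < \<epsilon>" if "k \<ge> k0" for k
  proof -
    have "\<psi> x - \<epsilon> / 2 \<le> inf_conv \<psi> (real k) x"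
    proof (rule inf_conv_greatest[OF x])
      fix y assume y: "y \<in> M"
      show "\<psi> x - \<epsilon> / 2 \<le> \<psi> y + real k * d x y"
      proof (cases "d x y < r")
        case True
        then have "y \<in> mball x r" using x y by simp
        then have "\<psi> x - \<epsilon> / 2 < \<psi> y" using r(2) by blast
        moreover have "0 \<le> real k * d x y" by simp
        ultimately show ?thesis by linarith
      next
        case False
        have "2 * B / r < real k" using k0 that by simp
        then have "2 * B < real k * r" using r(1) by (simp add: pos_divide_less_eq)
        also have "\<dots> \<le> real k * d x y" using False by (intro mult_left_mono) auto
        finally have "2 * B < real k * d x y" .
        moreover have "\<psi> x \<le> B" "- B \<le> \<psi> y" using B x y by (auto simp: abs_le_iff)
        ultimately show ?thesis using \<epsilon> by linarith
      qed
    qed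
    moreover have "inf_conv \<psi> (real k) x \<le> \<psi> x" by (rule inf_conv_le[OF B _ x]) simp
    ultimately show ?thesis using \<epsilon> by simp
  qed
  then show "\<exists>k0. \<forall>k\<ge>k0. norm (inf_conv \<psi> (real k) x - \<psi> x) < \<epsilon>" by blast
qed

lemma measurable_lsc:
  fixes \<psi> :: "'a \<Rightarrow> real"
  assumes Y: "\<And>\<omega>. \<omega> \<in> space P \<Longrightarrow> Y \<omega> \<in> M"
    and lip: "\<And>\<phi>. lip_bounded \<phi> \<Longrightarrow> (\<lambda>\<omega>. \<phi> (Y \<omega>)) \<in> borel_measurable P"
    and B: "\<forall>x\<in>M. \<bar>\<psi> x\<bar> \<le> B" and lsc: "\<And>c. openin mtopology {x \<in> M. c < \<psi> x}"
  shows "(\<lambda>\<omega>. \<psi> (Y \<omega>)) \<in> borel_measurable P"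
proof (rule borel_measurable_LIMSEQ_real)
  show "(\<lambda>k. inf_conv \<psi> (real k) (Y \<omega>)) \<longlonglongrightarrow> \<psi> (Y \<omega>)" if "\<omega> \<in> space P" for \<omega>
    by (rule inf_conv_tendsto[OF B lsc Y[OF that]])
  show "(\<lambda>\<omega>. inf_conv \<psi> (real k) (Y \<omega>)) \<in> borel_measurable P" for k
    by (rule lip[OF lip_bounded_inf_conv[OF B]]) simp
qed

text \<open>Indicators of open sets are lower semicontinuous, hence pointwise limits of Lipschitz
  functions. The argument works on generators and does not involve separability.\<close>

lemma measurable_borel_algebraI:
  assumes Y: "\<And>\<omega>. \<omega> \<in> space P \<Longrightarrow> Y \<omega> \<in> M"
    and lip: "\<And>\<phi>. lip_bounded \<phi> \<Longrightarrow> (\<lambda>\<omega>. \<phi> (Y \<omega>)) \<in> borel_measurable P"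
  shows "Y \<in> P \<rightarrow>\<^sub>M borel_algebra mtopology"
  unfolding borel_algebra_def
proof (rule measurable_measure_of)
  show "{U. openin mtopology U} \<subseteq> Pow (topspace mtopology)"
    using openin_subset by blast
  show "Y \<in> space P \<rightarrow> topspace mtopology" using Y by simp
  fix U assume "U \<in> {U. openin mtopology U}"
  then have U: "openin mtopology U" by simp
  have "(\<lambda>\<omega>. indicat_real U (Y \<omega>)) \<in> borel_measurable P"
  proof (rule measurable_lsc[where Y=Y, OF Y lip])
    show "\<forall>x\<in>M. \<bar>indicat_real U x\<bar> \<le> 1" by (simp add: indicator_def)
    show "openin mtopology {x \<in> M. c < indicat_real U x}" for c
    proof -
      have "{x \<in> M. c < indicat_real U x} = (if c < 0 then M else if c < 1 then U else {})"
        using openin_subset[OF U] by (auto simp: indicator_def)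
      then show ?thesis using U openin_topspace[of mtopology] by simp
    qed
  qed auto
  then have "(\<lambda>\<omega>. indicat_real U (Y \<omega>)) -` {1} \<inter> space P \<in> sets P" by (rule measurable_sets) simp
  moreover have "(\<lambda>\<omega>. indicat_real U (Y \<omega>)) -` {1} \<inter> space P = Y -` U \<inter> space P"
    by (auto simp: indicator_def)
  ultimately show "Y -` U \<inter> space P \<in> sets P" by simp
qed

text \<open>One half of a portmanteau argument: \<psi> is replaced from below by a Lipschitz
  function of nearly the same expectation under the limit law. For continuous \<psi> the other half
  is this one applied to its negative.\<close>

lemma lower_limit_of_expectations:
  fixes \<psi> :: "'a \<Rightarrow> real"
  assumes P: "prob_space P" and N: "prob_space N"
    and Y: "\<And>n \<omega>. \<omega> \<in> space P \<Longrightarrow> Y n \<omega> \<in> M" and Z: "\<And>\<omega>. \<omega> \<in> space N \<Longrightarrow> Z \<omega> \<in> M"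
    and Y_meas: "\<And>\<phi> n. lip_bounded \<phi> \<Longrightarrow> (\<lambda>\<omega>. \<phi> (Y n \<omega>)) \<in> borel_measurable P"
    and Z_meas: "\<And>\<phi>. lip_bounded \<phi> \<Longrightarrow> (\<lambda>\<omega>. \<phi> (Z \<omega>)) \<in> borel_measurable N"
    and lim: "\<And>\<phi>. lip_bounded \<phi> \<Longrightarrow> (\<lambda>n. \<integral>\<omega>. \<phi> (Y n \<omega>) \<partial>P) \<longlonglongrightarrow> (\<integral>\<omega>. \<phi> (Z \<omega>) \<partial>N)"
    and B: "\<forall>x\<in>M. \<bar>\<psi> x\<bar> \<le> B" and lsc: "\<And>c. openin mtopology {x \<in> M. c < \<psi> x}"
    and \<epsilon>: "0 < \<epsilon>"
  shows "\<forall>\<^sub>F n in sequentially. (\<integral>\<omega>. \<psi> (Z \<omega>) \<partial>N) - \<epsilon> < (\<integral>\<omega>. \<psi> (Y n \<omega>) \<partial>P)"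
proof -
  interpret P: prob_space P by fact
  interpret N: prob_space N by fact
  have lipk: "lip_bounded (inf_conv \<psi> (real k))" for k
    by (rule lip_bounded_inf_conv[OF B]) simp
  have "(\<lambda>k. \<integral>\<omega>. inf_conv \<psi> (real k) (Z \<omega>) \<partial>N) \<longlonglongrightarrow> (\<integral>\<omega>. \<psi> (Z \<omega>) \<partial>N)"
  proof (rule integral_dominated_convergence[where w="\<lambda>_. B"])
    show "(\<lambda>\<omega>. \<psi> (Z \<omega>)) \<in> borel_measurable N" by (rule measurable_lsc[where Y=Z, OF Z Z_meas B lsc])
    show "AE \<omega> in N. (\<lambda>k. inf_conv \<psi> (real k) (Z \<omega>)) \<longlonglongrightarrow> \<psi> (Z \<omega>)"
      by (rule AE_I2) (rule inf_conv_tendsto[OF B lsc Z])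
    show "AE \<omega> in N. norm (inf_conv \<psi> (real k) (Z \<omega>)) \<le> B" for k
      using inf_conv_bound[OF B _ Z] by (intro AE_I2) simp
  qed (auto intro: Z_meas lipk)
  then have "\<forall>\<^sub>F k in sequentially. (\<integral>\<omega>. \<psi> (Z \<omega>) \<partial>N) - \<epsilon> < (\<integral>\<omega>. inf_conv \<psi> (real k) (Z \<omega>) \<partial>N)"
    using \<epsilon> by (intro order_tendstoD) auto
  then obtain k where k: "(\<integral>\<omega>. \<psi> (Z \<omega>) \<partial>N) - \<epsilon> < (\<integral>\<omega>. inf_conv \<psi> (real k) (Z \<omega>) \<partial>N)"
    unfolding eventually_sequentially by blast
  have "\<forall>\<^sub>F n in sequentially. (\<integral>\<omega>. \<psi> (Z \<omega>) \<partial>N) - \<epsilon> < (\<integral>\<omega>. inf_conv \<psi> (real k) (Y n \<omega>) \<partial>P)"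
    by (rule order_tendstoD(1)[OF lim[OF lipk] k])
  then show ?thesis
  proof eventually_elim
    case (elim n)
    have "(\<integral>\<omega>. inf_conv \<psi> (real k) (Y n \<omega>) \<partial>P) \<le> (\<integral>\<omega>. \<psi> (Y n \<omega>) \<partial>P)"
    proof (rule integral_mono)
      show "integrable P (\<lambda>\<omega>. inf_conv \<psi> (real k) (Y n \<omega>))"
        using inf_conv_bound[OF B _ Y] by (intro P.integrable_const_bound[where B=B] AE_I2 Y_meas lipk) simp
      show "integrable P (\<lambda>\<omega>. \<psi> (Y n \<omega>))"
        using B Y by (intro P.integrable_const_bound[where B=B] AE_I2 measurable_lsc[where Y="Y n", OF Y Y_meas B lsc]) auto
      show "inf_conv \<psi> (real k) (Y n \<omega>) \<le> \<psi> (Y n \<omega>)" if "\<omega> \<in> space P" for \<omega>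
        by (rule inf_conv_le[OF B _ Y[OF that]]) simp
    qed
    with elim show ?case by linarith
  qed
qed

lemma converges_in_distributionI:
  assumes P: "prob_space P" and N: "prob_space N"
    and Y: "\<And>n \<omega>. \<omega> \<in> space P \<Longrightarrow> Y n \<omega> \<in> M" and Z: "\<And>\<omega>. \<omega> \<in> space N \<Longrightarrow> Z \<omega> \<in> M"
    and Y_meas: "\<And>\<phi> n. lip_bounded \<phi> \<Longrightarrow> (\<lambda>\<omega>. \<phi> (Y n \<omega>)) \<in> borel_measurable P"
    and Z_meas: "\<And>\<phi>. lip_bounded \<phi> \<Longrightarrow> (\<lambda>\<omega>. \<phi> (Z \<omega>)) \<in> borel_measurable N"
    and lim: "\<And>\<phi>. lip_bounded \<phi> \<Longrightarrow> (\<lambda>n. \<integral>\<omega>. \<phi> (Y n \<omega>) \<partial>P) \<longlonglongrightarrow> (\<integral>\<omega>. \<phi> (Z \<omega>) \<partial>N)"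
  shows "converges_in_distribution mtopology P Y N Z"
  unfolding converges_in_distribution_def
proof (intro conjI allI impI)
  show "Y n \<in> P \<rightarrow>\<^sub>M borel_algebra mtopology" for n by (rule measurable_borel_algebraI[where Y="Y n", OF Y Y_meas])
  show "Z \<in> N \<rightarrow>\<^sub>M borel_algebra mtopology" by (rule measurable_borel_algebraI[where Y=Z, OF Z Z_meas])
  fix \<psi> :: "'a \<Rightarrow> real"
  assume "continuous_map mtopology euclideanreal \<psi> \<and> bounded (\<psi> ` topspace mtopology)"
  then have cont: "continuous_map mtopology euclideanreal \<psi>" and "bounded (\<psi> ` M)" by auto
  then obtain B where B: "\<forall>x\<in>M. \<bar>\<psi> x\<bar> \<le> B" by (auto simp: bounded_iff)
  then have B': "\<forall>x\<in>M. \<bar>- \<psi> x\<bar> \<le> B" by simp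
  have lsc: "openin mtopology {x \<in> M. c < \<psi> x}" for c
    using openin_continuous_map_preimage[OF cont, of "{c<..}"] by (simp add: open_greaterThan)
  have lsc': "openin mtopology {x \<in> M. c < - \<psi> x}" for c
    using openin_continuous_map_preimage[OF cont, of "{..<-c}"] by (simp add: open_lessThan less_minus_iff)
  note low = lower_limit_of_expectations[where Y=Y and Z=Z, OF P N Y Z Y_meas Z_meas lim]
  show "(\<lambda>n. \<integral>\<omega>. \<psi> (Y n \<omega>) \<partial>P) \<longlonglongrightarrow> (\<integral>\<omega>. \<psi> (Z \<omega>) \<partial>N)"
  proof (rule tendstoI)
    fix \<epsilon> :: real assume \<epsilon>: "0 < \<epsilon>"
    have "\<forall>\<^sub>F n in sequentially. (\<integral>\<omega>. \<psi> (Z \<omega>) \<partial>N) - \<epsilon> < (\<integral>\<omega>. \<psi> (Y n \<omega>) \<partial>P)"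
      by (rule low[OF _ _ _ _ _ B lsc \<epsilon>])
    moreover have "\<forall>\<^sub>F n in sequentially. (\<integral>\<omega>. - \<psi> (Z \<omega>) \<partial>N) - \<epsilon> < (\<integral>\<omega>. - \<psi> (Y n \<omega>) \<partial>P)"
      by (rule low[OF _ _ _ _ _ B' lsc' \<epsilon>])
    ultimately show "\<forall>\<^sub>F n in sequentially. dist (\<integral>\<omega>. \<psi> (Y n \<omega>) \<partial>P) (\<integral>\<omega>. \<psi> (Z \<omega>) \<partial>N) < \<epsilon>"
      by eventually_elim (auto simp: dist_real_def)
  qed
qed

end

section \<open>Continuous paths and step paths in the Skorohod space\<close>

lemma skorohod_dist_le_sup:
  assumes "f \<in> skorohod_space" "g \<in> skorohod_space" "0 \<le> e" "\<And>\<tau>. \<tau> \<in> {0..1} \<Longrightarrow> \<bar>f \<tau> - g \<tau>\<bar> \<le> e"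
  shows "skorohod_dist f g \<le> e"
proof (rule skorohod_dist_le[OF assms(1,2)])
  show "skorohod_close f g e"
    unfolding skorohod_close_def using assms(3,4) by (intro conjI bexI[OF _ id_time_change]) auto
qed

lemma continuous_path_in_skorohod_space:
  assumes "continuous_on {0..1} f"
  shows "restrict f {0..1} \<in> skorohod_space"
proof -
  have lim: "(restrict f {0..1} \<longlongrightarrow> f t) (at t within {0..1})" if "t \<in> {0..1}" for t
  proof -
    have "(f \<longlongrightarrow> f t) (at t within {0..1})" using assms that by (simp add: continuous_on_def)
    then show ?thesis
      by (rule Lim_transform_eventually) (auto simp: eventually_at_filter)
  qed
  have "(restrict f {0..1} \<longlongrightarrow> restrict f {0..1} t) (at_right t)" if t: "t \<in> {0..<1}" for t
  proof -
    have "at t within {t..1} = at_right t" using t by (simp add: at_within_Icc_at_right)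
    then show ?thesis using tendsto_within_subset[OF lim[of t], of "{t..1}"] t by auto
  qed
  moreover have "(restrict f {0..1} \<longlongrightarrow> f t) (at_left t)" if t: "t \<in> {0<..1}" for t
  proof -
    have "at t within {0..t} = at_left t" using t by (simp add: at_within_Icc_at_left)
    then show ?thesis using tendsto_within_subset[OF lim[of t], of "{0..t}"] t by auto
  qed
  ultimately show ?thesis unfolding skorohod_space_def using restrict_extensional[of f "{0..1}"] by blast
qed

text \<open>The path takes m + 1 values, the last one at time 1 only. For \<open>m = 0\<close> it is
  constant with value x 0.\<close>

definition step_path :: "nat \<Rightarrow> (nat \<Rightarrow> real) \<Rightarrow> real \<Rightarrow> real" where
  "step_path m x = (\<lambda>\<tau>\<in>{0..1}. x (nat \<lfloor>real m * \<tau>\<rfloor>))"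

lemma step_path_in_skorohod_space:
  assumes m: "0 < m"
  shows "step_path m x \<in> skorohod_space"
  unfolding skorohod_space_def
proof (intro CollectI conjI ballI)
  show "step_path m x \<in> extensional {0..1}" by (simp add: step_path_def)
  fix t :: real assume t: "t \<in> {0..<1}"
  define j where "j = \<lfloor>real m * t\<rfloor>"
  have "t < (j + 1) / real m"
    using m unfolding j_def by (simp add: pos_less_divide_eq mult.commute)
  then have "\<forall>\<^sub>F s in at_right t. s \<in> {t<..<min 1 ((j + 1) / real m)}"
    using t by (intro eventually_at_right_real) auto
  then have "\<forall>\<^sub>F s in at_right t. step_path m x s = step_path m x t"
  proof eventually_elim
    case (elim s)
    have "real m * t \<le> real m * s" using elim by (intro mult_left_mono) auto
    moreover have "real m * s < j + 1" using elim m by (simp add: pos_less_divide_eq mult.commute)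
    ultimately have "\<lfloor>real m * s\<rfloor> = j" unfolding j_def by linarith
    then show ?case using elim t by (simp add: step_path_def j_def)
  qed
  then show "(step_path m x \<longlongrightarrow> step_path m x t) (at_right t)" by (rule tendsto_eventually)
next
  fix t :: real assume t: "t \<in> {0<..1}"
  \<comment> \<open>At a jump time the left limit is the value of the preceding cell, hence the
    ceiling minus one instead of the floor.\<close>
  define j where "j = \<lceil>real m * t\<rceil> - 1"
  have j: "real_of_int j < real m * t" "real m * t \<le> j + 1" unfolding j_def by linarith+
  have "j / real m < t" using m j(1) by (simp add: pos_divide_less_eq mult.commute)
  then have "\<forall>\<^sub>F s in at_left t. s \<in> {max 0 (j / real m)<..<t}"
    using t by (intro eventually_at_left_real) auto
  then have "\<forall>\<^sub>F s in at_left t. step_path m x s = x (nat j)"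
  proof eventually_elim
    case (elim s)
    have "real m * s < real m * t" using elim m by simp
    moreover have "j < real m * s" using elim m by (simp add: pos_divide_less_eq mult.commute)
    ultimately have "\<lfloor>real m * s\<rfloor> = j" using j by linarith
    then show ?case using elim t by (simp add: step_path_def)
  qed
  then show "\<exists>l. (step_path m x \<longlongrightarrow> l) (at_left t)" by (blast intro: tendsto_eventually)
qed

lemma step_path_floor_le:
  assumes "\<tau> \<in> {0..1}"
  shows "nat \<lfloor>real m * \<tau>\<rfloor> \<le> m"
proof -
  have "real m * \<tau> \<le> real m" using assms by (simp add: mult_left_le)
  then have "\<lfloor>real m * \<tau>\<rfloor> \<le> int m" by linarith
  then show ?thesis by simp
qed

interpretation skorohod: Metric_space skorohod_space skorohod_dist
  by (rule Metric_space_skorohod)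

text \<open>The identity as time change bounds the Skorohod distance by the largest difference of
  the m + 1 values, and the sum of the differences dominates it. This turns path functionals into
  functions of random vectors.\<close>

lemma lip_bounded_step_path:
  assumes \<phi>: "skorohod.lip_bounded \<phi>" and m: "0 < m"
  obtains L B where "0 \<le> L" "\<And>x. \<bar>\<phi> (step_path m x)\<bar> \<le> B"
    "\<And>x y. \<bar>\<phi> (step_path m x) - \<phi> (step_path m y)\<bar> \<le> L * (\<Sum>j<Suc m. \<bar>x j - y j\<bar>)"
proof -
  obtain L B where L: "0 \<le> L" "\<forall>f\<in>skorohod_space. \<forall>g\<in>skorohod_space. \<bar>\<phi> f - \<phi> g\<bar> \<le> L * skorohod_dist f g"
    and B: "\<forall>f\<in>skorohod_space. \<bar>\<phi> f\<bar> \<le> B"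
    using \<phi> unfolding skorohod.lip_bounded_def by blast
  have "\<bar>\<phi> (step_path m x) - \<phi> (step_path m y)\<bar> \<le> L * (\<Sum>j<Suc m. \<bar>x j - y j\<bar>)" for x y
  proof -
    have "skorohod_dist (step_path m x) (step_path m y) \<le> (\<Sum>j<Suc m. \<bar>x j - y j\<bar>)"
    proof (rule skorohod_dist_le_sup)
      fix \<tau> :: real assume \<tau>: "\<tau> \<in> {0..1}"
      have "\<bar>x (nat \<lfloor>real m * \<tau>\<rfloor>) - y (nat \<lfloor>real m * \<tau>\<rfloor>)\<bar> \<le> (\<Sum>j<Suc m. \<bar>x j - y j\<bar>)"
        by (rule member_le_sum[where f="\<lambda>j. \<bar>x j - y j\<bar>"]) (use step_path_floor_le[OF \<tau>, of m] in auto)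
      then show "\<bar>step_path m x \<tau> - step_path m y \<tau>\<bar> \<le> (\<Sum>j<Suc m. \<bar>x j - y j\<bar>)"
        using \<tau> by (simp add: step_path_def)
    qed (auto intro: step_path_in_skorohod_space m sum_nonneg)
    then have "L * skorohod_dist (step_path m x) (step_path m y) \<le> L * (\<Sum>j<Suc m. \<bar>x j - y j\<bar>)"
      by (rule mult_left_mono) (rule L(1))
    then show ?thesis using L(2) step_path_in_skorohod_space[OF m] by (meson order_trans)
  qed
  then show ?thesis using that L(1) B step_path_in_skorohod_space[OF m] by blast
qed

text \<open>The bound makes \<psi> continuous in the product topology and blind to coordinates from
  m on; these can be set to 0, which requires no measurability of the corresponding V.\<close>

lemma measurable_finite_lipschitz:
  fixes \<psi> :: "(nat \<Rightarrow> real) \<Rightarrow> real"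
  assumes lip: "\<And>x y. \<bar>\<psi> x - \<psi> y\<bar> \<le> L * (\<Sum>j<m. \<bar>x j - y j\<bar>)"
    and V: "\<And>j. j < m \<Longrightarrow> V j \<in> borel_measurable P"
  shows "(\<lambda>\<omega>. \<psi> (\<lambda>j. V j \<omega>)) \<in> borel_measurable P"
proof -
  have "continuous_on UNIV \<psi>"
    unfolding continuous_on_def
  proof
    fix x :: "nat \<Rightarrow> real"
    have "((\<lambda>y. L * (\<Sum>j<m. \<bar>y j - x j\<bar>)) \<longlongrightarrow> L * (\<Sum>j<m. \<bar>x j - x j\<bar>)) (at x)"
    proof (intro tendsto_intros)
      fix j
      have "continuous_on UNIV (\<lambda>y :: nat \<Rightarrow> real. y j)" by (rule continuous_on_product_coordinates)
      then show "((\<lambda>y. y j) \<longlongrightarrow> x j) (at x)" by (simp add: continuous_on_def)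
    qed
    then have lim0: "((\<lambda>y. L * (\<Sum>j<m. \<bar>y j - x j\<bar>)) \<longlongrightarrow> 0) (at x)" by simp
    have "((\<lambda>y. \<psi> y - \<psi> x) \<longlongrightarrow> 0) (at x)"
      by (rule Lim_null_comparison[OF _ lim0], rule always_eventually, rule allI, unfold real_norm_def, rule lip)
    then show "(\<psi> \<longlongrightarrow> \<psi> x) (at x)" by (rule LIM_zero_cancel)
  qed
  then have [measurable]: "\<psi> \<in> borel_measurable borel" by (rule borel_measurable_continuous_onI)
  have "(\<lambda>\<omega> j. if j < m then V j \<omega> else 0) \<in> P \<rightarrow>\<^sub>M borel"
  proof (rule measurable_coordinatewise_then_product)
    show "(\<lambda>\<omega>. if j < m then V j \<omega> else 0) \<in> borel_measurable P" for j
      using V by (cases "j < m") auto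
  qed
  then have "(\<lambda>\<omega>. \<psi> (\<lambda>j. if j < m then V j \<omega> else 0)) \<in> borel_measurable P" by measurable
  moreover have "\<psi> (\<lambda>j. if j < m then V j \<omega> else 0) = \<psi> (\<lambda>j. V j \<omega>)" for \<omega>
    using lip[of "\<lambda>j. if j < m then V j \<omega> else 0" "\<lambda>j. V j \<omega>"] by simp
  ultimately show ?thesis by simp
qed

section \<open>Weak convergence of random vectors\<close>

text \<open>Real trigonometric polynomials: the phase b supplies the sines and avoids complex
  coefficients. Expectations of the generators are determined by characteristic functions.\<close>

inductive trig_poly :: "nat \<Rightarrow> ((nat \<Rightarrow> real) \<Rightarrow> real) \<Rightarrow> bool" for m where
  cos: "trig_poly m (\<lambda>x. cos ((\<Sum>j<m. \<theta> j * x j) + b))"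
| add: "trig_poly m f \<Longrightarrow> trig_poly m g \<Longrightarrow> trig_poly m (\<lambda>x. f x + g x)"
| scale: "trig_poly m f \<Longrightarrow> trig_poly m (\<lambda>x. c * f x)"

lemma trig_poly_const: "trig_poly m (\<lambda>x. c)"
  using trig_poly.scale[OF trig_poly.cos[of m "\<lambda>_. 0" 0], of c] by simp

text \<open>Closure under products comes from the product-to-sum formula for cosines; it makes the
  class an algebra, as Stone-Weierstrass requires.\<close>

lemma trig_poly_mult:
  assumes "trig_poly m f" "trig_poly m g"
  shows "trig_poly m (\<lambda>x. f x * g x)"
  using assms(1)
proof induction
  case (cos \<theta> b)
  show ?case using assms(2)
  proof induction
    case (cos \<theta>' b')
    have "trig_poly m (\<lambda>x. 1 / 2 * (cos ((\<Sum>j<m. (\<theta> j - \<theta>' j) * x j) + (b - b')) + cos ((\<Sum>j<m. (\<theta> j + \<theta>' j) * x j) + (b + b'))))"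
      by (intro trig_poly.intros)
    moreover have "1 / 2 * (cos ((\<Sum>j<m. (\<theta> j - \<theta>' j) * x j) + (b - b')) + cos ((\<Sum>j<m. (\<theta> j + \<theta>' j) * x j) + (b + b')))
      = cos ((\<Sum>j<m. \<theta> j * x j) + b) * cos ((\<Sum>j<m. \<theta>' j * x j) + b')" for x
    proof -
      have "(\<Sum>j<m. (\<theta> j - \<theta>' j) * x j) + (b - b') = ((\<Sum>j<m. \<theta> j * x j) + b) - ((\<Sum>j<m. \<theta>' j * x j) + b')"
        "(\<Sum>j<m. (\<theta> j + \<theta>' j) * x j) + (b + b') = ((\<Sum>j<m. \<theta> j * x j) + b) + ((\<Sum>j<m. \<theta>' j * x j) + b')"
        by (simp_all add: left_diff_distrib distrib_right sum_subtractf sum.distrib)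
      then show ?thesis by (simp only: cos_times_cos)
    qed
    ultimately show ?case by simp
  next
    case (add f g)
    then show ?case using trig_poly.add by (simp add: distrib_left)
  next
    case (scale f c)
    then show ?case using trig_poly.scale[of m _ c] by (simp add: mult.left_commute)
  qed
next
  case (add f g)
  then show ?case using trig_poly.add by (simp add: distrib_right)
next
  case (scale f c)
  then show ?case using trig_poly.scale[of m _ c] by (simp add: mult.assoc)
qed

lemma trig_poly_sin:
  assumes "j < m"
  shows "trig_poly m (\<lambda>x. sin (x j / K))"
proof -
  have "(\<Sum>i<m. (if i = j then 1 / K else 0) * x i) = x j / K" for x
  proof -
    have "(\<Sum>i<m. (if i = j then 1 / K else 0) * x i) = (\<Sum>i<m. if i = j then x i / K else 0)"
      by (rule sum.cong) auto
    then show ?thesis using assms by simp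
  qed
  then show ?thesis
    using trig_poly.cos[of m "\<lambda>i. if i = j then 1 / K else 0" "- (pi / 2)"]
    by (simp add: cos_diff)
qed

lemma (in prob_space) expectation_cos:
  assumes [measurable]: "U \<in> borel_measurable M"
  shows "expectation (\<lambda>\<omega>. cos (U \<omega> + b)) = Re (iexp b * (\<integral>\<omega>. iexp (U \<omega>) \<partial>M))"
proof -
  have int: "integrable M (\<lambda>\<omega>. iexp (U \<omega>))" by (rule integrable_iexp) auto
  have "iexp b * (\<integral>\<omega>. iexp (U \<omega>) \<partial>M) = (\<integral>\<omega>. iexp b * iexp (U \<omega>) \<partial>M)" using int by simp
  also have "Re \<dots> = expectation (\<lambda>\<omega>. Re (iexp b * iexp (U \<omega>)))" using int by (subst integral_Re) auto
  also have "(\<lambda>\<omega>. Re (iexp b * iexp (U \<omega>))) = (\<lambda>\<omega>. cos (U \<omega> + b))"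
    by (simp add: exp_add[symmetric] distrib_left[symmetric] Re_exp add.commute fun_eq_iff)
  finally show ?thesis by simp
qed

lemma (in prob_space) trig_poly_integrable:
  assumes "trig_poly m h" and V: "\<And>j. j < m \<Longrightarrow> V j \<in> borel_measurable M"
  shows "integrable M (\<lambda>\<omega>. h (\<lambda>j. V j \<omega>))"
  using assms(1)
proof induction
  case (cos \<theta> b)
  have "(\<lambda>\<omega>. (\<Sum>j<m. \<theta> j * V j \<omega>) + b) \<in> borel_measurable M"
    using V by (intro borel_measurable_add borel_measurable_sum borel_measurable_times) auto
  then show ?case by (intro integrable_const_bound[where B=1]) auto
qed auto

lemma trig_poly_tendsto:
  assumes P: "prob_space P" and N: "prob_space N" and h: "trig_poly m h"
    and V: "\<And>n j. j < m \<Longrightarrow> V n j \<in> borel_measurable P" and W: "\<And>j. j < m \<Longrightarrow> W j \<in> borel_measurable N"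
    and char: "\<And>\<theta>. (\<lambda>n. \<integral>\<omega>. iexp (\<Sum>j<m. \<theta> j * V n j \<omega>) \<partial>P) \<longlonglongrightarrow> (\<integral>\<omega>. iexp (\<Sum>j<m. \<theta> j * W j \<omega>) \<partial>N)"
  shows "(\<lambda>n. \<integral>\<omega>. h (\<lambda>j. V n j \<omega>) \<partial>P) \<longlonglongrightarrow> (\<integral>\<omega>. h (\<lambda>j. W j \<omega>) \<partial>N)"
proof -
  interpret P: prob_space P by fact
  interpret N: prob_space N by fact
  have i: "integrable P (\<lambda>\<omega>. f (\<lambda>j. V n j \<omega>))" "integrable N (\<lambda>\<omega>. f (\<lambda>j. W j \<omega>))" if "trig_poly m f" for f n
    using P.trig_poly_integrable[OF that, of "V n"] N.trig_poly_integrable[OF that, of W] V W by auto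
  show ?thesis using h
  proof induction
    case (cos \<theta> b)
    have 1: "(\<lambda>\<omega>. \<Sum>j<m. \<theta> j * V n j \<omega>) \<in> borel_measurable P" for n
      using V by (intro borel_measurable_sum borel_measurable_times) auto
    have 2: "(\<lambda>\<omega>. \<Sum>j<m. \<theta> j * W j \<omega>) \<in> borel_measurable N"
      using W by (intro borel_measurable_sum borel_measurable_times) auto
    show ?case
      unfolding P.expectation_cos[OF 1] N.expectation_cos[OF 2] by (intro tendsto_intros char)
  next
    case (add f g)
    then show ?case using i by (simp add: tendsto_add)
  next
    case (scale f c)
    then show ?case using i by (simp add: tendsto_mult_left)
  qed
qed

text \<open>The cube has infinitely many coordinates because the test functions are defined on
  sequences; compactness is Tychonoff's theorem.\<close>

lemma compact_cube: "compact (UNIV \<rightarrow>\<^sub>E {-1..1} :: (nat \<Rightarrow> real) set)"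
proof -
  have "compactin (product_topology (\<lambda>_::nat. euclideanreal) UNIV) (UNIV \<rightarrow>\<^sub>E {-1..1})"
    by (subst compactin_PiE) simp
  then show ?thesis by (simp add: euclidean_product_topology)
qed

text \<open>Composing with \<open>x \<mapsto> (sin (x\<^sub>j / K))\<^sub>j\<close> turns polynomials on a compact cube into trigonometric
  polynomials, so Stone-Weierstrass gives an approximation that is uniform on the whole space.\<close>

lemma trig_poly_approx:
  fixes \<psi> :: "(nat \<Rightarrow> real) \<Rightarrow> real"
  assumes lip: "\<And>x y. \<bar>\<psi> x - \<psi> y\<bar> \<le> L * (\<Sum>j<m. \<bar>x j - y j\<bar>)" and L: "0 \<le> L"
    and B: "\<And>x. \<bar>\<psi> x\<bar> \<le> B" and K: "0 < K" and \<epsilon>: "0 < \<epsilon>"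
  obtains h where "trig_poly m h" "\<And>x. \<bar>\<psi> x - h x\<bar> \<le> \<epsilon> + 2 * B / K\<^sup>2 * (\<Sum>j<m. (x j)\<^sup>2)"
proof -
  define S :: "(nat \<Rightarrow> real) set" where "S = (UNIV \<rightarrow>\<^sub>E {-1..1})"
  \<comment> \<open>Coordinates from m on are sent to 0, so that every coordinate projection becomes
    a sine or a constant and lies in the ring.\<close>
  define s where "s x j = (if j < m then sin (x j / K) else 0)" for x :: "nat \<Rightarrow> real" and j
  define G where "G y = \<psi> (\<lambda>j. K * arcsin (y j))" for y
  define R where "R = {g. continuous_on S g \<and> trig_poly m (\<lambda>x. g (s x))}"
  have coord: "continuous_on S (\<lambda>y :: nat \<Rightarrow> real. y j)" for j
    by (rule continuous_on_subset[OF continuous_on_product_coordinates]) simp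
  have sS: "s x \<in> S" for x unfolding S_def s_def by (auto simp: PiE_iff)
  have B0: "0 \<le> B" using B[of undefined] by simp
  interpret R: function_ring_on R S
  proof
    show "compact S" unfolding S_def by (rule compact_cube)
    show "continuous_on S f" if "f \<in> R" for f using that by (simp add: R_def)
    show "(\<lambda>x. f x + g x) \<in> R" if "f \<in> R" "g \<in> R" for f g
      using that unfolding R_def by (auto intro: continuous_on_add trig_poly.add)
    show "(\<lambda>x. f x * g x) \<in> R" if "f \<in> R" "g \<in> R" for f g
      using that unfolding R_def by (auto intro: continuous_on_mult trig_poly_mult)
    show "(\<lambda>_. c) \<in> R" for c unfolding R_def by (auto intro: trig_poly_const)
    show "\<exists>f\<in>R. f x \<noteq> f y" if xy: "x \<in> S" "y \<in> S" "x \<noteq> y" for x y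
    proof -
      obtain j where j: "x j \<noteq> y j" using xy(3) by auto
      have "(\<lambda>y. y j) \<in> R"
        unfolding R_def s_def using coord by (cases "j < m") (auto intro: trig_poly_sin trig_poly_const)
      then show ?thesis using j by (intro bexI[of _ "\<lambda>y. y j"]) auto
    qed
  qed
  have "continuous_on S G"
    unfolding continuous_on_def
  proof
    fix y assume y: "y \<in> S"
    have arc: "continuous_on S (\<lambda>y. arcsin (y j))" for j
      by (rule continuous_on_arcsin[OF coord]) (auto simp: S_def PiE_iff)
    have "((\<lambda>z. L * (\<Sum>j<m. \<bar>K * arcsin (z j) - K * arcsin (y j)\<bar>)) \<longlongrightarrow> L * (\<Sum>j<m. \<bar>K * arcsin (y j) - K * arcsin (y j)\<bar>)) (at y within S)"
      using arc y by (intro tendsto_intros) (simp add: continuous_on_def)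
    then have lim0: "((\<lambda>z. L * (\<Sum>j<m. \<bar>K * arcsin (z j) - K * arcsin (y j)\<bar>)) \<longlongrightarrow> 0) (at y within S)" by simp
    have "((\<lambda>z. G z - G y) \<longlongrightarrow> 0) (at y within S)"
      by (rule Lim_null_comparison[OF _ lim0], rule always_eventually, rule allI, unfold real_norm_def G_def, rule lip)
    then show "(G \<longlongrightarrow> G y) (at y within S)" by (rule LIM_zero_cancel)
  qed
  from R.Stone_Weierstrass_basic[OF this \<epsilon>]
  obtain g where g: "g \<in> R" "\<And>y. y \<in> S \<Longrightarrow> \<bar>G y - g y\<bar> < \<epsilon>" by blast
  \<comment> \<open>If all |x_j| are at most K, then x_j / K lies between -1 and 1, where arcsin
    inverts the sine, and the error is 0. Otherwise the error is at most 2 B, and the quadratic term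
    is at least as large.\<close>
  have near: "\<bar>\<psi> x - G (s x)\<bar> \<le> 2 * B / K\<^sup>2 * (\<Sum>j<m. (x j)\<^sup>2)" for x
  proof (cases "\<forall>j<m. \<bar>x j\<bar> \<le> K")
    case True
    have "K * arcsin (s x j) = x j" if j: "j < m" for j
    proof -
      have "\<bar>x j / K\<bar> \<le> 1" using True j K by (simp add: abs_divide)
      moreover have "1 \<le> pi / 2" using pi_ge_two by simp
      ultimately have "arcsin (sin (x j / K)) = x j / K" by (intro arcsin_sin) linarith+
      then show ?thesis using j K by (simp add: s_def)
    qed
    then have "\<bar>\<psi> x - G (s x)\<bar> \<le> 0"
      unfolding G_def using lip[of x "\<lambda>j. K * arcsin (s x j)"] by simp
    moreover have "0 \<le> 2 * B / K\<^sup>2 * (\<Sum>j<m. (x j)\<^sup>2)"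
      using B0 by (intro mult_nonneg_nonneg sum_nonneg) auto
    ultimately show ?thesis by simp
  next
    case False
    then obtain j where j: "j < m" "K < \<bar>x j\<bar>" by auto
    have "K\<^sup>2 \<le> (x j)\<^sup>2" using j(2) K by (simp add: abs_le_square_iff[symmetric])
    also have "\<dots> \<le> (\<Sum>j<m. (x j)\<^sup>2)" using j(1) by (intro member_le_sum) auto
    finally have "2 * B / K\<^sup>2 * K\<^sup>2 \<le> 2 * B / K\<^sup>2 * (\<Sum>j<m. (x j)\<^sup>2)"
      using B0 by (intro mult_left_mono) auto
    moreover have "\<bar>\<psi> x - G (s x)\<bar> \<le> 2 * B"
      using B[of x] B[of "\<lambda>j. K * arcsin (s x j)"] unfolding G_def by linarith
    ultimately show ?thesis using K by simp
  qed
  show ?thesis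
  proof (rule that)
    show "trig_poly m (\<lambda>x. g (s x))" using g(1) by (simp add: R_def)
    show "\<bar>\<psi> x - g (s x)\<bar> \<le> \<epsilon> + 2 * B / K\<^sup>2 * (\<Sum>j<m. (x j)\<^sup>2)" for x
      using near[of x] g(2)[OF sS[of x]] by linarith
  qed
qed

lemma (in prob_space) expectation_approx_le:
  assumes h: "trig_poly m h" "\<And>x. \<bar>\<psi> x - h x\<bar> \<le> \<epsilon> + c * (\<Sum>j<m. (x j)\<^sup>2)" and c: "0 \<le> c"
    and V: "\<And>j. j < m \<Longrightarrow> V j \<in> borel_measurable M" "\<And>j. j < m \<Longrightarrow> integrable M (\<lambda>\<omega>. (V j \<omega>)\<^sup>2)"
    and C: "\<And>j. j < m \<Longrightarrow> expectation (\<lambda>\<omega>. (V j \<omega>)\<^sup>2) \<le> C"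
    and \<psi>: "integrable M (\<lambda>\<omega>. \<psi> (\<lambda>j. V j \<omega>))"
  shows "\<bar>expectation (\<lambda>\<omega>. \<psi> (\<lambda>j. V j \<omega>)) - expectation (\<lambda>\<omega>. h (\<lambda>j. V j \<omega>))\<bar> \<le> \<epsilon> + c * (real m * C)"
proof -
  have hi: "integrable M (\<lambda>\<omega>. h (\<lambda>j. V j \<omega>))"
    by (rule trig_poly_integrable[OF h(1)]) (rule V(1))
  have "\<bar>expectation (\<lambda>\<omega>. \<psi> (\<lambda>j. V j \<omega>)) - expectation (\<lambda>\<omega>. h (\<lambda>j. V j \<omega>))\<bar>
      = \<bar>expectation (\<lambda>\<omega>. \<psi> (\<lambda>j. V j \<omega>) - h (\<lambda>j. V j \<omega>))\<bar>"
    using \<psi> hi by simp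
  also have "\<dots> \<le> expectation (\<lambda>\<omega>. \<bar>\<psi> (\<lambda>j. V j \<omega>) - h (\<lambda>j. V j \<omega>)\<bar>)"
    by (rule integral_abs_bound)
  also have "\<dots> \<le> expectation (\<lambda>\<omega>. \<epsilon> + c * (\<Sum>j<m. (V j \<omega>)\<^sup>2))"
    using \<psi> hi V(2)
    by (intro integral_mono h(2) integrable_abs Bochner_Integration.integrable_diff Bochner_Integration.integrable_add
        integrable_mult_right Bochner_Integration.integrable_sum) auto
  also have "\<dots> = \<epsilon> + c * expectation (\<lambda>\<omega>. \<Sum>j<m. (V j \<omega>)\<^sup>2)"
  proof -
    have "integrable M (\<lambda>\<omega>. \<Sum>j<m. (V j \<omega>)\<^sup>2)"
      by (rule Bochner_Integration.integrable_sum) (use V(2) in auto)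
    then show ?thesis by (simp add: prob_space)
  qed
  also have "expectation (\<lambda>\<omega>. \<Sum>j<m. (V j \<omega>)\<^sup>2) = (\<Sum>j<m. expectation (\<lambda>\<omega>. (V j \<omega>)\<^sup>2))"
    by (rule Bochner_Integration.integral_sum) (use V(2) in auto)
  also have "\<epsilon> + c * (\<Sum>j<m. expectation (\<lambda>\<omega>. (V j \<omega>)\<^sup>2)) \<le> \<epsilon> + c * (real m * C)"
    using sum_bounded_above[of "{..<m}" "\<lambda>j. expectation (\<lambda>\<omega>. (V j \<omega>)\<^sup>2)" C] C c
    by (auto intro!: mult_left_mono)
  finally show ?thesis .
qed

text \<open>A multivariate continuity theorem in which uniform second moments take the place of
  tightness: they control the expectation of the quadratic error in the trigonometric
  approximation.\<close>

lemma finite_dim_weak_convergence: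
  fixes \<psi> :: "(nat \<Rightarrow> real) \<Rightarrow> real"
  assumes P: "prob_space P" and N: "prob_space N"
    and V: "\<And>n j. j < m \<Longrightarrow> V n j \<in> borel_measurable P" "\<And>n j. j < m \<Longrightarrow> integrable P (\<lambda>\<omega>. (V n j \<omega>)\<^sup>2)"
      "\<And>n j. j < m \<Longrightarrow> (\<integral>\<omega>. (V n j \<omega>)\<^sup>2 \<partial>P) \<le> C"
    and W: "\<And>j. j < m \<Longrightarrow> W j \<in> borel_measurable N" "\<And>j. j < m \<Longrightarrow> integrable N (\<lambda>\<omega>. (W j \<omega>)\<^sup>2)"
      "\<And>j. j < m \<Longrightarrow> (\<integral>\<omega>. (W j \<omega>)\<^sup>2 \<partial>N) \<le> C"
    and char: "\<And>\<theta>. (\<lambda>n. \<integral>\<omega>. iexp (\<Sum>j<m. \<theta> j * V n j \<omega>) \<partial>P) \<longlonglongrightarrow> (\<integral>\<omega>. iexp (\<Sum>j<m. \<theta> j * W j \<omega>) \<partial>N)"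
    and lip: "\<And>x y. \<bar>\<psi> x - \<psi> y\<bar> \<le> L * (\<Sum>j<m. \<bar>x j - y j\<bar>)" and L: "0 \<le> L"
    and B: "\<And>x. \<bar>\<psi> x\<bar> \<le> B"
  shows "(\<lambda>n. \<integral>\<omega>. \<psi> (\<lambda>j. V n j \<omega>) \<partial>P) \<longlonglongrightarrow> (\<integral>\<omega>. \<psi> (\<lambda>j. W j \<omega>) \<partial>N)"
proof (rule LIMSEQ_I)
  interpret P: prob_space P by fact
  interpret N: prob_space N by fact
  fix r :: real assume r: "0 < r"
  have B0: "0 \<le> B" using B[of undefined] by simp
  \<comment> \<open>Together with K this makes the quadratic error at most r / 8 in expectation. The
    two approximations and the convergence for h then cost less than 5 r / 8 in total.\<close>
  define D where "D = 2 * B * (real m * \<bar>C\<bar>) + 1"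
  have D: "1 \<le> D" unfolding D_def using B0 by simp
  define K where "K = sqrt (8 * D / r)"
  have K: "0 < K" "K\<^sup>2 = 8 * D / r" unfolding K_def using D r by auto
  obtain h where h: "trig_poly m h" "\<And>x. \<bar>\<psi> x - h x\<bar> \<le> r / 8 + 2 * B / K\<^sup>2 * (\<Sum>j<m. (x j)\<^sup>2)"
    using trig_poly_approx[OF lip L B K(1), of "r / 8"] r by auto
  have c: "0 \<le> 2 * B / K\<^sup>2" using B0 by simp
  have "2 * B / K\<^sup>2 * (real m * \<bar>C\<bar>) = (D - 1) * r / (8 * D)"
    unfolding K(2) D_def by simp
  also have "\<dots> \<le> r / 8" using D r by (simp add: field_simps)
  finally have small: "2 * B / K\<^sup>2 * (real m * \<bar>C\<bar>) \<le> r / 8" .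
  have PV: "\<bar>(\<integral>\<omega>. \<psi> (\<lambda>j. V n j \<omega>) \<partial>P) - (\<integral>\<omega>. h (\<lambda>j. V n j \<omega>) \<partial>P)\<bar> \<le> r / 8 + 2 * B / K\<^sup>2 * (real m * \<bar>C\<bar>)" for n
  proof (rule P.expectation_approx_le[OF h c V(1,2)])
    show "integrable P (\<lambda>\<omega>. \<psi> (\<lambda>j. V n j \<omega>))"
      by (rule P.integrable_const_bound[where B=B]) (use B measurable_finite_lipschitz[OF lip V(1)] in auto)
    show "(\<integral>\<omega>. (V n j \<omega>)\<^sup>2 \<partial>P) \<le> \<bar>C\<bar>" if "j < m" for j using V(3)[OF that, of n] by linarith
  qed
  have NW: "\<bar>(\<integral>\<omega>. \<psi> (\<lambda>j. W j \<omega>) \<partial>N) - (\<integral>\<omega>. h (\<lambda>j. W j \<omega>) \<partial>N)\<bar> \<le> r / 8 + 2 * B / K\<^sup>2 * (real m * \<bar>C\<bar>)"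
  proof (rule N.expectation_approx_le[OF h c W(1,2)])
    show "integrable N (\<lambda>\<omega>. \<psi> (\<lambda>j. W j \<omega>))"
      by (rule N.integrable_const_bound[where B=B]) (use B measurable_finite_lipschitz[OF lip W(1)] in auto)
    show "(\<integral>\<omega>. (W j \<omega>)\<^sup>2 \<partial>N) \<le> \<bar>C\<bar>" if "j < m" for j using W(3)[OF that] by linarith
  qed
  have "(\<lambda>n. \<integral>\<omega>. h (\<lambda>j. V n j \<omega>) \<partial>P) \<longlonglongrightarrow> (\<integral>\<omega>. h (\<lambda>j. W j \<omega>) \<partial>N)"
    by (rule trig_poly_tendsto[OF P N h(1) V(1) W(1) char])
  from LIMSEQ_D[OF this, of "r / 8"] r obtain n0 where
    n0: "\<And>n. n \<ge> n0 \<Longrightarrow> \<bar>(\<integral>\<omega>. h (\<lambda>j. V n j \<omega>) \<partial>P) - (\<integral>\<omega>. h (\<lambda>j. W j \<omega>) \<partial>N)\<bar> < r / 8" by auto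
  have "norm ((\<integral>\<omega>. \<psi> (\<lambda>j. V n j \<omega>) \<partial>P) - (\<integral>\<omega>. \<psi> (\<lambda>j. W j \<omega>) \<partial>N)) < r" if "n \<ge> n0" for n
    using PV[of n] NW n0[OF that] small r unfolding real_norm_def by linarith
  then show "\<exists>no. \<forall>n\<ge>no. norm ((\<integral>\<omega>. \<psi> (\<lambda>j. V n j \<omega>) \<partial>P) - (\<integral>\<omega>. \<psi> (\<lambda>j. W j \<omega>) \<partial>N)) < r" by blast
qed

section \<open>Maximal inequality and Gaussian variables\<close>

text \<open>The factor of the second square can be taken close to 1. In the bisection a factor 2
  would be too large, because 2^(1 + 2 d) stays below 4 for d < 1 / 2.\<close>

lemma power2_add_weighted:
  fixes x y \<delta> :: real
  assumes "0 < \<delta>"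
  shows "(x + y)\<^sup>2 \<le> (1 + 1 / \<delta>) * x\<^sup>2 + (1 + \<delta>) * y\<^sup>2"
proof -
  have "0 \<le> (x - \<delta> * y)\<^sup>2 / \<delta>" using assms by simp
  also have "\<dots> = x\<^sup>2 / \<delta> - 2 * x * y + \<delta> * y\<^sup>2"
    using assms by (simp add: power2_eq_square field_simps)
  finally show ?thesis by (simp add: power2_sum algebra_simps)
qed

definition max_square :: "(nat \<Rightarrow> 'a \<Rightarrow> real) \<Rightarrow> nat \<Rightarrow> nat \<Rightarrow> 'a \<Rightarrow> real" where
  "max_square T a n \<omega> = Max ((\<lambda>k. (T (a + k) \<omega> - T a \<omega>)\<^sup>2) ` {..n})"

lemma max_square_ge: "k \<le> n \<Longrightarrow> (T (a + k) \<omega> - T a \<omega>)\<^sup>2 \<le> max_square T a n \<omega>"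
  unfolding max_square_def by (intro Max_ge) auto

lemma max_square_le:
  assumes "\<And>k. k \<le> n \<Longrightarrow> (T (a + k) \<omega> - T a \<omega>)\<^sup>2 \<le> c"
  shows "max_square T a n \<omega> \<le> c"
  unfolding max_square_def using assms by (intro Max.boundedI) auto

lemma max_square_nonneg: "0 \<le> max_square T a n \<omega>"
  using max_square_ge[of 0 n T a \<omega>] by simp

lemma integrable_max_square:
  assumes "\<And>k. T k \<in> sqint M"
  shows "integrable M (max_square T a n)"
proof (rule Bochner_Integration.integrable_bound)
  show "integrable M (\<lambda>\<omega>. \<Sum>k\<le>n. (T (a + k) \<omega> - T a \<omega>)\<^sup>2)"
    by (intro Bochner_Integration.integrable_sum sqintD sqint_diff assms)
  have "\<And>k. (\<lambda>\<omega>. (T (a + k) \<omega> - T a \<omega>)\<^sup>2) \<in> borel_measurable M"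
    by (intro borel_measurable_power sqintD(1) sqint_diff assms)
  then show "max_square T a n \<in> borel_measurable M"
    unfolding max_square_def[abs_def] by (intro borel_measurable_Max) auto
  have "max_square T a n \<omega> \<le> (\<Sum>k\<le>n. (T (a + k) \<omega> - T a \<omega>)\<^sup>2)" for \<omega>
    by (rule max_square_le, rule member_le_sum) auto
  then show "AE \<omega> in M. norm (max_square T a n \<omega>) \<le> norm (\<Sum>k\<le>n. (T (a + k) \<omega> - T a \<omega>)\<^sup>2)"
    by (intro AE_I2) (simp add: max_square_nonneg sum_nonneg)
qed

text \<open>Bisection: as \<open>1 + 2 d > 1\<close>, second moments of the increments suffice.\<close>

lemma maximal_inequality:
  assumes T: "\<And>k. T k \<in> sqint M" and C: "0 \<le> C" and d: "0 < d"
    and incr: "\<And>a k. (LINT \<omega>|M. (T (a + k) \<omega> - T a \<omega>)\<^sup>2) \<le> C * real k powr (1 + 2 * d)"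
  shows "\<exists>K\<ge>0. \<forall>p a. (LINT \<omega>|M. max_square T a (2 ^ p) \<omega>) \<le> K * (2 ^ p) powr (1 + 2 * d)"
proof -
  \<comment> \<open>Bisection multiplies the bound by 2 b, while doubling the length allows the
    growth 2 b^2. The slack between the two, available as b > 1, pays for the increment to the
    midpoint.\<close>
  define b where "b = 2 powr d"
  have b: "1 < b" unfolding b_def using d by simp
  have pw: "2 powr (1 + 2 * d) = 2 * b * b"
  proof -
    have "2 powr (1 + 2 * d) = 2 powr (1 + (d + d))" by (simp only: mult_2)
    also have "\<dots> = 2 powr 1 * (b * b)" unfolding b_def by (simp only: powr_add)
    finally show ?thesis by simp
  qed
  define \<delta> where "\<delta> = b - 1"
  have \<delta>: "0 < \<delta>" using b by (simp add: \<delta>_def)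
  \<comment> \<open>The first summand fills the slack 2 b (b - 1) K with the midpoint cost; the
    second covers blocks of length 1, where the induction starts.\<close>
  define K where "K = (1 + 1 / \<delta>) * C / (2 * b * (b - 1)) + C"
  have K0: "C \<le> K" "0 \<le> K"
  proof -
    have "0 \<le> (1 + 1 / \<delta>) * C / (2 * b * (b - 1))"
      using \<delta> b C by (intro divide_nonneg_nonneg mult_nonneg_nonneg) auto
    then show "C \<le> K" "0 \<le> K" unfolding K_def using C by auto
  qed
  have K: "(1 + 1 / \<delta>) * C + 2 * b * K \<le> 2 * b * b * K"
  proof -
    have "(1 + 1 / \<delta>) * C = (1 + 1 / \<delta>) * C / (2 * b * (b - 1)) * (2 * b * (b - 1))" using b by simp
    also have "\<dots> \<le> K * (2 * b * (b - 1))"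
      unfolding K_def using b C by (intro mult_right_mono) auto
    finally show ?thesis by (simp add: algebra_simps)
  qed
  note int = integrable_max_square[OF T]
  have "(LINT \<omega>|M. max_square T a (2 ^ p) \<omega>) \<le> K * (2 ^ p) powr (1 + 2 * d)" for p a
  proof (induction p arbitrary: a)
    case 0
    have "max_square T a (2 ^ 0) \<omega> \<le> (T (a + 1) \<omega> - T a \<omega>)\<^sup>2" for \<omega>
    proof (rule max_square_le)
      fix k :: nat assume "k \<le> 2 ^ 0"
      then have "k = 0 \<or> k = 1" by auto
      then show "(T (a + k) \<omega> - T a \<omega>)\<^sup>2 \<le> (T (a + 1) \<omega> - T a \<omega>)\<^sup>2" by auto
    qed
    then have "(LINT \<omega>|M. max_square T a (2 ^ 0) \<omega>) \<le> (LINT \<omega>|M. (T (a + 1) \<omega> - T a \<omega>)\<^sup>2)"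
      by (intro integral_mono int sqintD(2) sqint_diff T)
    also have "\<dots> \<le> C" using incr[of a 1] by simp
    also have "\<dots> \<le> K" by (rule K0)
    finally show ?case by simp
  next
    case (Suc p)
    define x where "x = (2 ^ p :: real) powr (1 + 2 * d)"
    have x: "0 \<le> x" by (simp add: x_def)
    \<comment> \<open>The maximum over both halves is bounded by their sum. Only indices in the
      second half pay for the increment to the midpoint, with 1 + \<delta> = b.\<close>
    have pt: "max_square T a (2 ^ Suc p) \<omega> \<le> b * (max_square T a (2 ^ p) \<omega> + max_square T (a + 2 ^ p) (2 ^ p) \<omega>)
      + (1 + 1 / \<delta>) * (T (a + 2 ^ p) \<omega> - T a \<omega>)\<^sup>2" for \<omega>
    proof (rule max_square_le)
      fix k :: nat assume k: "k \<le> 2 ^ Suc p"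
      let ?A = "max_square T a (2 ^ p) \<omega>" and ?B = "max_square T (a + 2 ^ p) (2 ^ p) \<omega>"
        and ?D = "T (a + 2 ^ p) \<omega> - T a \<omega>"
      have nn: "0 \<le> ?A" "0 \<le> ?B" "0 \<le> (1 + 1 / \<delta>) * ?D\<^sup>2"
        using max_square_nonneg \<delta> by auto
      show "(T (a + k) \<omega> - T a \<omega>)\<^sup>2 \<le> b * (?A + ?B) + (1 + 1 / \<delta>) * ?D\<^sup>2"
      proof (cases "k \<le> 2 ^ p")
        case True
        have "(T (a + k) \<omega> - T a \<omega>)\<^sup>2 \<le> 1 * ?A" using max_square_ge[OF True] by simp
        also have "\<dots> \<le> b * (?A + ?B)" using b nn by (intro mult_mono) auto
        finally show ?thesis using nn by simp
      next
        case False
        define l where "l = k - 2 ^ p"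
        have l: "k = 2 ^ p + l" "l \<le> 2 ^ p" using False k by (auto simp: l_def)
        have "(T (a + k) \<omega> - T a \<omega>)\<^sup>2 = (?D + (T (a + 2 ^ p + l) \<omega> - T (a + 2 ^ p) \<omega>))\<^sup>2"
          unfolding l(1) by (simp add: add.assoc)
        also have "\<dots> \<le> (1 + 1 / \<delta>) * ?D\<^sup>2 + (1 + \<delta>) * (T (a + 2 ^ p + l) \<omega> - T (a + 2 ^ p) \<omega>)\<^sup>2"
          by (rule power2_add_weighted[OF \<delta>])
        also have "\<dots> \<le> (1 + 1 / \<delta>) * ?D\<^sup>2 + (1 + \<delta>) * ?B"
          using max_square_ge[OF l(2), of T "a + 2 ^ p" \<omega>] \<delta> by (intro add_left_mono mult_left_mono) auto
        also have "\<dots> \<le> (1 + 1 / \<delta>) * ?D\<^sup>2 + b * (?A + ?B)"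
          using nn b unfolding \<delta>_def by (intro add_left_mono mult_mono) auto
        finally show ?thesis by simp
      qed
    qed
    have "(LINT \<omega>|M. max_square T a (2 ^ Suc p) \<omega>) \<le>
      (LINT \<omega>|M. b * (max_square T a (2 ^ p) \<omega> + max_square T (a + 2 ^ p) (2 ^ p) \<omega>) + (1 + 1 / \<delta>) * (T (a + 2 ^ p) \<omega> - T a \<omega>)\<^sup>2)"
      using pt by (intro integral_mono int Bochner_Integration.integrable_add integrable_mult_right sqintD(2) sqint_diff T)
    also have "\<dots> = b * ((LINT \<omega>|M. max_square T a (2 ^ p) \<omega>) + (LINT \<omega>|M. max_square T (a + 2 ^ p) (2 ^ p) \<omega>))
      + (1 + 1 / \<delta>) * (LINT \<omega>|M. (T (a + 2 ^ p) \<omega> - T a \<omega>)\<^sup>2)"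
      using int sqintD(2)[OF sqint_diff[OF T T]] by simp
    also have "\<dots> \<le> b * (K * x + K * x) + (1 + 1 / \<delta>) * (C * x)"
      using Suc.IH[of a] Suc.IH[of "a + 2 ^ p"] incr[of a "2 ^ p"] b \<delta> unfolding x_def
      by (intro add_mono mult_left_mono) auto
    also have "\<dots> = ((1 + 1 / \<delta>) * C + 2 * b * K) * x" by (simp add: algebra_simps)
    also have "\<dots> \<le> (2 * b * b * K) * x" by (rule mult_right_mono[OF K x])
    also have "\<dots> = K * (2 ^ Suc p) powr (1 + 2 * d)"
      unfolding x_def power_Suc by (simp add: powr_mult pw)
    finally show ?case .
  qed
  then show ?thesis using K0(2) by blast
qed

text \<open>Constants have no density and are treated separately; a centred one is 0 almost surely.
  Otherwise rescaling reduces the claim to the standard normal law.\<close>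

lemma gaussian_variable_char:
  assumes N: "prob_space N" and Y: "gaussian_variable N Y" and mean: "(LINT \<omega>|N. Y \<omega>) = 0"
  shows "Y \<in> sqint N" "(CLINT \<omega>|N. iexp (Y \<omega>)) = exp (- (LINT \<omega>|N. (Y \<omega>)\<^sup>2) / 2)"
proof -
  interpret prob_space N by fact
  consider (normal) \<mu> \<sigma> where "0 < \<sigma>" "distributed N lborel Y (normal_density \<mu> \<sigma>)"
    | (const) c where "Y \<in> borel_measurable N" "AE \<omega> in N. Y \<omega> = c"
    using Y unfolding gaussian_variable_def by blast
  then have "Y \<in> sqint N \<and> (CLINT \<omega>|N. iexp (Y \<omega>)) = exp (- (LINT \<omega>|N. (Y \<omega>)\<^sup>2) / 2)"
  proof cases
    case normal
    have \<mu>: "\<mu> = 0" using normal_distributed_expectation[OF normal] mean by simp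
    define U where "U \<omega> = Y \<omega> / \<sigma>" for \<omega>
    have U: "distributed N lborel U std_normal_density"
      using normal normal_standard_normal_convert[OF normal(1), of Y \<mu>] unfolding U_def \<mu> by simp
    have Um [measurable]: "U \<in> borel_measurable N" using distributed_measurable[OF U] by simp
    have law: "distr N borel U = std_normal_distribution"
      using distributed_distr_eq_density[OF U] by (simp cong: distr_cong)
    have YU: "Y \<omega> = \<sigma> * U \<omega>" for \<omega> unfolding U_def using normal(1) by simp
    have "integrable (distr N borel U) (\<lambda>x. x\<^sup>2)"
      unfolding law by (rule integrable_std_normal_distribution_moment)
    then have U2: "integrable N (\<lambda>\<omega>. (U \<omega>)\<^sup>2)" by (subst (asm) integrable_distr_eq) auto
    have "(LINT \<omega>|N. (U \<omega>)\<^sup>2) = (LINT x|distr N borel U. x\<^sup>2)" by (subst integral_distr) auto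
    also have "\<dots> = 1" unfolding law using std_normal_distribution_even_moments(1)[of 1] by (simp add: fact_numeral)
    finally have var: "(LINT \<omega>|N. (Y \<omega>)\<^sup>2) = \<sigma>\<^sup>2" unfolding YU power_mult_distrib by simp
    have "(CLINT \<omega>|N. iexp (Y \<omega>)) = char (distr N borel U) \<sigma>"
      unfolding char_def YU by (subst integral_distr) auto
    also have "\<dots> = exp (- (LINT \<omega>|N. (Y \<omega>)\<^sup>2) / 2)"
      unfolding law char_std_normal_distribution var by simp
    finally have "(CLINT \<omega>|N. iexp (Y \<omega>)) = exp (- (LINT \<omega>|N. (Y \<omega>)\<^sup>2) / 2)" .
    moreover have "(\<lambda>\<omega>. \<sigma> * U \<omega>) \<in> sqint N"
      by (intro sqint_cmult sqintI Um U2)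
    ultimately show ?thesis by (simp add: YU[abs_def])
  next
    case const
    have [measurable]: "Y \<in> borel_measurable N" by fact
    have "(LINT \<omega>|N. Y \<omega>) = (LINT \<omega>|N. c)"
      by (rule integral_cong_AE) (use const in auto)
    then have c: "c = 0" using mean by (simp add: prob_space)
    have "integrable N (\<lambda>\<omega>. (Y \<omega>)\<^sup>2) \<longleftrightarrow> integrable N (\<lambda>\<omega>. 0 :: real)"
      by (rule Bochner_Integration.integrable_cong_AE) (use const c in auto)
    then have "Y \<in> sqint N" by (intro sqintI) auto
    moreover have "(LINT \<omega>|N. (Y \<omega>)\<^sup>2) = (LINT \<omega>|N. 0)"
      by (rule integral_cong_AE) (use const c in auto)
    moreover have "(CLINT \<omega>|N. iexp (Y \<omega>)) = (CLINT \<omega>|N. 1)"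
      by (rule integral_cong_AE) (use const c in auto)
    ultimately show ?thesis by (simp add: prob_space)
  qed
  then show "Y \<in> sqint N" "(CLINT \<omega>|N. iexp (Y \<omega>)) = exp (- (LINT \<omega>|N. (Y \<omega>)\<^sup>2) / 2)" by auto
qed

section \<open>The functional limit theorem\<close>

text \<open>The maximal inequality is available for dyadic lengths; rounding a length up costs at
  most a factor 2.\<close>

lemma exists_power2_between:
  assumes "1 \<le> (x::real)"
  shows "\<exists>p::nat. x \<le> 2 ^ p \<and> 2 ^ p \<le> 2 * x"
proof -
  define p where "p = nat \<lceil>log 2 x\<rceil>"
  have l: "0 \<le> log 2 x" using assms by simp
  then have p: "log 2 x \<le> real p" "real p \<le> log 2 x + 1" unfolding p_def by linarith+
  have "2 powr log 2 x \<le> 2 powr real p" using p(1) by simp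
  then have "x \<le> 2 ^ p" using assms by (simp add: powr_realpow)
  moreover have "2 powr real p \<le> 2 powr (log 2 x + 1)" using p(2) by simp
  then have "2 ^ p \<le> 2 * x" using assms by (simp add: powr_realpow powr_add)
  ultimately show ?thesis by blast
qed

lemma real_nat_div_bounds:
  fixes a m :: nat
  shows "real (a div m) \<le> real a / real m" "real a / real m \<le> real (a div m) + 1"
  using floor_divide_of_nat_eq[of a m, where 'a=real] by linarith+

text \<open>The grid version freezes the sum at the index belonging to the last grid point before
  \<tau>. The true index is at most one cell of n / m steps later, plus 1 for rounding down.\<close>

lemma grid_index:
  fixes n m :: nat and \<tau> :: real
  assumes m: "0 < m" and \<tau>: "\<tau> \<in> {0..1}"
  defines "j \<equiv> nat \<lfloor>real m * \<tau>\<rfloor>" and "k \<equiv> nat \<lfloor>real n * \<tau>\<rfloor>"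
  shows "n * j div m \<le> k" "real (k - n * j div m) \<le> real n / real m + 1"
proof -
  have "0 \<le> real m * \<tau>" "0 \<le> real n * \<tau>" using \<tau> by auto
  then have j: "real j \<le> real m * \<tau>" "real m * \<tau> < real j + 1"
    and k: "real k \<le> real n * \<tau>" "real n * \<tau> < real k + 1"
    unfolding j_def k_def by linarith+
  have "real (n * j div m) \<le> real (n * j) / real m" by (rule real_nat_div_bounds)
  also have "\<dots> \<le> real n * \<tau>"
    using mult_left_mono[OF j(1), of "real n"] m by (simp add: pos_divide_le_eq mult_ac)
  finally have "real (n * j div m) < real k + 1" using k(2) by linarith
  then show le: "n * j div m \<le> k" by linarith
  have "real (n * j) / real m \<le> real (n * j div m) + 1"
    by (rule real_nat_div_bounds)
  moreover have "real n * \<tau> \<le> real n * (real j + 1) / real m"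
  proof -
    have "real n * (real m * \<tau>) \<le> real n * (real j + 1)" using j(2) by (intro mult_left_mono) auto
    then show ?thesis using m by (simp add: pos_le_divide_eq mult_ac)
  qed
  ultimately have "real k \<le> real (n * j div m) + 1 + real n / real m"
    using k(1) by (simp add: distrib_left add_divide_distrib)
  then show "real (k - n * j div m) \<le> real n / real m + 1" using le by (simp add: of_nat_diff)
qed

lemma grid_tendsto:
  fixes j m :: nat
  shows "(\<lambda>n. real (n * j div m) / real n) \<longlonglongrightarrow> real j / real m"
proof (rule LIMSEQ_I)
  fix r :: real assume r: "0 < r"
  obtain n0 :: nat where n0: "1 / r < real n0" using reals_Archimedean2 by blast
  have "norm (real (n * j div m) / real n - real j / real m) < r" if n: "n \<ge> Suc n0" for n
  proof -
    have n': "1 / r < real n" "0 < real n" using n0 n by auto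
    have "\<bar>real (n * j div m) - real (n * j) / real m\<bar> \<le> 1"
      using real_nat_div_bounds[of "n * j" m] by linarith
    then have "\<bar>real (n * j div m) - real (n * j) / real m\<bar> / real n \<le> 1 / real n"
      by (rule divide_right_mono) simp
    moreover have "\<bar>real (n * j div m) - real (n * j) / real m\<bar> / real n = \<bar>real (n * j div m) / real n - real j / real m\<bar>"
    proof -
      have "real (n * j div m) / real n - real j / real m = (real (n * j div m) - real (n * j) / real m) / real n"
        using n'(2) by (simp add: diff_divide_distrib)
      then show ?thesis by (simp add: abs_divide)
    qed
    moreover have "1 / real n < r" using n' r by (simp add: field_simps)
    ultimately show ?thesis by simp
  qed
  then show "\<exists>no. \<forall>n\<ge>no. norm (real (n * j div m) / real n - real j / real m) < r" by blast
qed

lemma grid_le: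
  fixes j m n :: nat
  assumes "j < Suc m"
  shows "n * j div m \<le> n"
proof (cases "m = 0")
  case False
  have "n * j div m \<le> n * m div m" using assms by (intro div_le_mono) simp
  then show ?thesis using False by simp
qed simp

section \<open>Partial sums of the solution and their comparison with grid versions\<close>

context projective_model
begin

definition partial_sum :: "nat \<Rightarrow> 'a \<Rightarrow> real" where
  "partial_sum k \<omega> = (\<Sum>t<k. X (int (Suc t)) \<omega>)"

lemma partial_sum_sqint: "partial_sum k \<in> sqint M"
  unfolding partial_sum_def[abs_def] by (intro sqint_sum X_sqint)

text \<open>By stationarity the second moment of an increment depends on its length only.
  Convergence of the normalised variances gives boundedness, and so a bound for every length, not
  only for large ones.\<close>

lemma partial_sum_increment:
  obtains C where "0 \<le> C"
    "\<And>a k. expectation (\<lambda>\<omega>. (partial_sum (a + k) \<omega> - partial_sum a \<omega>)\<^sup>2) \<le> C * real k powr (1 + 2 * d)"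
proof -
  define V where "V k = (\<Sum>t<k. \<Sum>u<k. autocov_X (nat \<bar>int t - int u\<bar>))" for k
  have "(\<lambda>k. V k / real k powr (1 + 2 * d)) \<longlonglongrightarrow> mean_Q\<^sup>2 * Beta d (1 - 2 * d) / (d * (1 + 2 * d))"
    unfolding V_def by (rule toeplitz_sum_asymp[OF d_pos autocov_X_asymp])
  then have "Bseq (\<lambda>k. V k / real k powr (1 + 2 * d))" by (intro convergent_imp_Bseq convergentI)
  then obtain C where C: "0 < C" "\<And>k. norm (V k / real k powr (1 + 2 * d)) \<le> C" unfolding Bseq_def by blast
  have VC: "V k \<le> C * real k powr (1 + 2 * d)" for k
  proof (cases "k = 0")
    case True
    then show ?thesis by (simp add: V_def)
  next
    case False
    have "V k / real k powr (1 + 2 * d) \<le> C" using C(2)[of k] unfolding real_norm_def by linarith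
    then show ?thesis using False by (simp add: pos_divide_le_eq)
  qed
  have "expectation (\<lambda>\<omega>. (partial_sum (a + k) \<omega> - partial_sum a \<omega>)\<^sup>2) = V k" for a k
  proof -
    have "partial_sum (a + k) \<omega> - partial_sum a \<omega> = (\<Sum>t<k. X (int (Suc (a + t))) \<omega>)" for \<omega>
      unfolding partial_sum_def by (induction k) auto
    then have "expectation (\<lambda>\<omega>. (partial_sum (a + k) \<omega> - partial_sum a \<omega>)\<^sup>2) =
      (\<Sum>t<k. \<Sum>u<k. expectation (\<lambda>\<omega>. X (int (Suc (a + t))) \<omega> * X (int (Suc (a + u))) \<omega>))"
      by (simp only:) (rule integral_sum_power2[OF X_sqint])
    also have "\<dots> = V k"
      unfolding V_def
    proof (intro sum.cong refl)
      fix t u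
      have "expectation (\<lambda>\<omega>. X (int (Suc (a + t))) \<omega> * X (int (Suc (a + u))) \<omega>) = autocov_X (nat \<bar>int (a + t) - int (a + u)\<bar>)"
        by (rule autocov_expectation[where f=X and P="\<lambda>x h. x = autocov_X h", OF expectation_X_mult])
      then show "expectation (\<lambda>\<omega>. X (int (Suc (a + t))) \<omega> * X (int (Suc (a + u))) \<omega>) = autocov_X (nat \<bar>int t - int u\<bar>)"
        by simp
    qed
    finally show ?thesis .
  qed
  then show ?thesis using that[of C] C(1) VC by simp
qed

lemma covariance_asymp:
  "((\<lambda>t::int. expectation (\<lambda>\<omega>. X 0 \<omega> * X t \<omega>) / real_of_int t powr (2 * d - 1))
      \<longlongrightarrow> mean_Q\<^sup>2 * Beta d (1 - 2 * d)) at_top"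
proof -
  have "filterlim nat at_top (at_top :: int filter)"
    unfolding filterlim_at_top
  proof
    fix Z :: nat
    show "\<forall>\<^sub>F t in at_top. Z \<le> nat t"
      using eventually_ge_at_top[of "int Z"] by eventually_elim simp
  qed
  from filterlim_compose[OF autocov_X_asymp this]
  have "((\<lambda>t::int. autocov_X (nat t) / real (nat t) powr (2 * d - 1)) \<longlongrightarrow> mean_Q\<^sup>2 * Beta d (1 - 2 * d)) at_top" .
  moreover have "\<forall>\<^sub>F t::int in at_top. autocov_X (nat t) / real (nat t) powr (2 * d - 1)
      = expectation (\<lambda>\<omega>. X 0 \<omega> * X t \<omega>) / real_of_int t powr (2 * d - 1)"
    using eventually_ge_at_top[of 0]
  proof eventually_elim
    case (elim t)
    then show ?case using expectation_X_mult[of 0 "nat t"] by simp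
  qed
  ultimately show ?thesis by (rule Lim_transform_eventually)
qed

definition scaled_sum :: "nat \<Rightarrow> nat \<Rightarrow> 'a \<Rightarrow> real" where
  "scaled_sum n k \<omega> = real n powr (- 1 / 2 - d) * partial_sum k \<omega>"

lemma scaled_sum_sqint: "scaled_sum n k \<in> sqint M"
  unfolding scaled_sum_def[abs_def] by (intro sqint_cmult partial_sum_sqint)

lemma step_path_scaled_sum:
  "(\<lambda>\<tau>\<in>{0..1}. real n powr (- 1 / 2 - d) * (\<Sum>t\<in>{1..\<lfloor>real n * \<tau>\<rfloor>}. X t \<omega>)) = step_path n (\<lambda>j. scaled_sum n j \<omega>)"
proof -
  have "(\<Sum>t\<in>{1..\<lfloor>y\<rfloor>}. X t \<omega>) = partial_sum (nat \<lfloor>y\<rfloor>) \<omega>" for y :: real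
    unfolding partial_sum_def
    by (rule sum.reindex_bij_witness[of _ "\<lambda>t. int (Suc t)" "\<lambda>t. nat (t - 1)"]) (auto, linarith?)
  then show ?thesis unfolding step_path_def scaled_sum_def by simp
qed

text \<open>Convergence in distribution demands a measurable path for every n, and this brings the
  index 0 under the results for positive m.\<close>

lemma step_path_0: "step_path 0 x = step_path 1 (\<lambda>_. x 0)"
  by (simp add: step_path_def)

lemma step_path_in_space: "step_path n x \<in> skorohod_space"
  using step_path_in_skorohod_space[of n x] step_path_in_skorohod_space[of 1 "\<lambda>_. x 0"] step_path_0[of x]
  by (cases "n = 0") auto

lemma lip_step_path_measurable:
  assumes \<phi>: "skorohod.lip_bounded \<phi>" and V: "\<And>j. V j \<in> borel_measurable P"
  shows "(\<lambda>\<omega>. \<phi> (step_path m (\<lambda>j. V j \<omega>))) \<in> borel_measurable P"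
proof -
  have pos: "(\<lambda>\<omega>. \<phi> (step_path m (\<lambda>j. V j \<omega>))) \<in> borel_measurable P" if m: "0 < m" and V: "\<And>j. V j \<in> borel_measurable P" for m V
  proof -
    obtain L B where "0 \<le> L" "\<And>x. \<bar>\<phi> (step_path m x)\<bar> \<le> B" and lip: "\<And>x y. \<bar>\<phi> (step_path m x) - \<phi> (step_path m y)\<bar> \<le> L * (\<Sum>j<Suc m. \<bar>x j - y j\<bar>)"
      using lip_bounded_step_path[OF \<phi> m] by blast
    show ?thesis by (rule measurable_finite_lipschitz[of "\<lambda>x. \<phi> (step_path m x)", OF lip V])
  qed
  show ?thesis
    using pos[of m V] pos[of 1 "\<lambda>_. V 0"] V step_path_0 by (cases "m = 0") auto
qed

text \<open>This plays the part of tightness. The two paths differ at most by the largest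
  fluctuation over m + 1 blocks of about n / m steps, and summing the maximal inequalities over the
  blocks gives the order m^(-2 d) for large n. One K serves all functionals and grids.\<close>

lemma discretization_error:
  "\<exists>K\<ge>0. \<forall>\<phi> L n m. (\<forall>f\<in>skorohod_space. \<forall>g\<in>skorohod_space. \<bar>\<phi> f - \<phi> g\<bar> \<le> L * skorohod_dist f g) \<longrightarrow> 0 \<le> L \<longrightarrow>
      skorohod.lip_bounded \<phi> \<longrightarrow> 0 < n \<longrightarrow> 0 < m \<longrightarrow>
      \<bar>expectation (\<lambda>\<omega>. \<phi> (step_path n (\<lambda>j. scaled_sum n j \<omega>)))
        - expectation (\<lambda>\<omega>. \<phi> (step_path m (\<lambda>j. scaled_sum n (n * j div m) \<omega>)))\<bar>
      \<le> L * sqrt (K * (real m + 1) * (2 / real m + 2 / real n) powr (1 + 2 * d))"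
proof -
  obtain C where C: "0 \<le> C"
    "\<And>a k. expectation (\<lambda>\<omega>. (partial_sum (a + k) \<omega> - partial_sum a \<omega>)\<^sup>2) \<le> C * real k powr (1 + 2 * d)"
    using partial_sum_increment by blast
  obtain K where K: "0 \<le> K"
    "\<And>p a. expectation (max_square partial_sum a (2 ^ p)) \<le> K * (2 ^ p) powr (1 + 2 * d)"
    using maximal_inequality[where T=partial_sum, OF partial_sum_sqint C(1) d_pos C(2)] by blast
  show ?thesis
  proof (intro exI[of _ K] conjI K(1) allI impI)
    fix \<phi> :: "(real \<Rightarrow> real) \<Rightarrow> real" and L :: real and n m :: nat
    assume lip: "\<forall>f\<in>skorohod_space. \<forall>g\<in>skorohod_space. \<bar>\<phi> f - \<phi> g\<bar> \<le> L * skorohod_dist f g" and L: "0 \<le> L"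
      and \<phi>: "skorohod.lip_bounded \<phi>" and n: "0 < n" and m: "0 < m"
    define sc where "sc = real n powr (- 1 / 2 - d)"
    have sc0: "0 \<le> sc" by (simp add: sc_def)
    have sc2: "sc\<^sup>2 = 1 / real n powr (1 + 2 * d)"
      unfolding sc_def power2_eq_square powr_add[symmetric] powr_minus_divide[symmetric] by (simp add: algebra_simps)
    \<comment> \<open>A dyadic length that covers the largest possible distance between an index and
      its grid index.\<close>
    obtain p :: nat where p: "real n / real m + 1 \<le> 2 ^ p" "2 ^ p \<le> 2 * (real n / real m + 1)"
      using exists_power2_between[of "real n / real m + 1"] by auto
    define S where "S \<omega> = (\<Sum>j<Suc m. max_square partial_sum (n * j div m) (2 ^ p) \<omega>)" for \<omega>
    have S0: "0 \<le> S \<omega>" for \<omega> unfolding S_def by (intro sum_nonneg max_square_nonneg)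
    have S_int: "integrable M S"
      unfolding S_def[abs_def] by (intro Bochner_Integration.integrable_sum integrable_max_square partial_sum_sqint)
    define E where "E \<omega> = sc * sqrt (S \<omega>)" for \<omega>
    have E2: "(E \<omega>)\<^sup>2 = sc\<^sup>2 * S \<omega>" for \<omega> using S0 by (simp add: E_def power_mult_distrib)
    have E0: "0 \<le> E \<omega>" for \<omega> unfolding E_def using sc0 S0 by simp
    have E_sq: "E \<in> sqint M"
    proof (rule sqintI)
      show "E \<in> borel_measurable M"
        unfolding E_def[abs_def] using borel_measurable_integrable[OF S_int] by measurable
      show "integrable M (\<lambda>\<omega>. (E \<omega>)\<^sup>2)" unfolding E2 using S_int by simp
    qed
    define F where "F \<omega> = step_path n (\<lambda>j. scaled_sum n j \<omega>)" for \<omega>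
    define G where "G \<omega> = step_path m (\<lambda>j. scaled_sum n (n * j div m) \<omega>)" for \<omega>
    have FG: "F \<omega> \<in> skorohod_space" "G \<omega> \<in> skorohod_space" for \<omega>
      unfolding F_def G_def by (rule step_path_in_space)+
    have dist: "skorohod_dist (F \<omega>) (G \<omega>) \<le> E \<omega>" for \<omega>
    proof (rule skorohod_dist_le_sup[OF FG E0])
      fix \<tau> :: real assume \<tau>: "\<tau> \<in> {0..1}"
      define j where "j = nat \<lfloor>real m * \<tau>\<rfloor>"
      define k where "k = nat \<lfloor>real n * \<tau>\<rfloor>"
      define a where "a = n * j div m"
      have ka: "a \<le> k" "real (k - a) \<le> real n / real m + 1"
        unfolding a_def j_def k_def by (rule grid_index[OF m \<tau>])+
      have "real (k - a) \<le> 2 ^ p" using ka(2) p(1) by linarith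
      then have "real (k - a) \<le> real (2 ^ p)" by (simp only: of_nat_power of_nat_numeral)
      then have kp: "k - a \<le> 2 ^ p" by (simp only: of_nat_le_iff)
      have j: "j < Suc m" unfolding j_def using step_path_floor_le[OF \<tau>] by (simp add: less_Suc_eq_le)
      have "(partial_sum k \<omega> - partial_sum a \<omega>)\<^sup>2 \<le> max_square partial_sum a (2 ^ p) \<omega>"
        using max_square_ge[OF kp, of partial_sum a \<omega>] ka(1) by simp
      also have "\<dots> \<le> S \<omega>"
        unfolding S_def a_def using j
        by (intro member_le_sum[where f="\<lambda>j. max_square partial_sum (n * j div m) (2 ^ p) \<omega>"] max_square_nonneg) auto
      finally have "\<bar>partial_sum k \<omega> - partial_sum a \<omega>\<bar> \<le> sqrt (S \<omega>)"
        using real_sqrt_le_mono by fastforce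
      then have "sc * \<bar>partial_sum k \<omega> - partial_sum a \<omega>\<bar> \<le> E \<omega>"
        unfolding E_def by (rule mult_left_mono[OF _ sc0])
      moreover have "F \<omega> \<tau> - G \<omega> \<tau> = sc * (partial_sum k \<omega> - partial_sum a \<omega>)"
        using \<tau> unfolding F_def G_def step_path_def scaled_sum_def sc_def k_def a_def j_def
        by (simp add: right_diff_distrib)
      ultimately show "\<bar>F \<omega> \<tau> - G \<omega> \<tau>\<bar> \<le> E \<omega>" using sc0 by (simp add: abs_mult)
    qed
    obtain B where B: "\<forall>f\<in>skorohod_space. \<bar>\<phi> f\<bar> \<le> B" using \<phi> unfolding skorohod.lip_bounded_def by blast
    have meas: "scaled_sum n k \<in> borel_measurable M" for k by (rule sqintD(1)[OF scaled_sum_sqint])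
    have int: "integrable M (\<lambda>\<omega>. \<phi> (F \<omega>))" "integrable M (\<lambda>\<omega>. \<phi> (G \<omega>))"
      unfolding F_def G_def
      by (rule integrable_const_bound[where B=B], use B step_path_in_space in simp, rule lip_step_path_measurable[OF \<phi> meas])+
    have "\<bar>expectation (\<lambda>\<omega>. \<phi> (F \<omega>)) - expectation (\<lambda>\<omega>. \<phi> (G \<omega>))\<bar> = \<bar>expectation (\<lambda>\<omega>. \<phi> (F \<omega>) - \<phi> (G \<omega>))\<bar>"
      using int by simp
    also have "\<dots> \<le> expectation (\<lambda>\<omega>. \<bar>\<phi> (F \<omega>) - \<phi> (G \<omega>)\<bar>)" by (rule integral_abs_bound)
    also have "\<dots> \<le> expectation (\<lambda>\<omega>. L * \<bar>E \<omega>\<bar>)"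
    proof (rule integral_mono)
      show "integrable M (\<lambda>\<omega>. \<bar>\<phi> (F \<omega>) - \<phi> (G \<omega>)\<bar>)" using int by simp
      show "integrable M (\<lambda>\<omega>. L * \<bar>E \<omega>\<bar>)" using sqint_integrable[OF E_sq] by simp
      fix \<omega>
      have "\<bar>\<phi> (F \<omega>) - \<phi> (G \<omega>)\<bar> \<le> L * skorohod_dist (F \<omega>) (G \<omega>)" using lip FG by blast
      also have "\<dots> \<le> L * \<bar>E \<omega>\<bar>" using dist[of \<omega>] L by (intro mult_left_mono) auto
      finally show "\<bar>\<phi> (F \<omega>) - \<phi> (G \<omega>)\<bar> \<le> L * \<bar>E \<omega>\<bar>" .
    qed
    also have "\<dots> = L * expectation (\<lambda>\<omega>. \<bar>E \<omega>\<bar>)" by simp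
    also have "\<dots> \<le> L * sqrt (expectation (\<lambda>\<omega>. (E \<omega>)\<^sup>2))"
      by (rule mult_left_mono[OF expectation_abs_le_sqrt[OF E_sq] L])
    also have "\<dots> \<le> L * sqrt (K * (real m + 1) * (2 / real m + 2 / real n) powr (1 + 2 * d))"
    proof (rule mult_left_mono[OF _ L], rule real_sqrt_le_mono)
      have "expectation (\<lambda>\<omega>. (E \<omega>)\<^sup>2) = sc\<^sup>2 * (\<Sum>j<Suc m. expectation (max_square partial_sum (n * j div m) (2 ^ p)))"
        unfolding E2 S_def using integrable_max_square[where T=partial_sum, OF partial_sum_sqint] by simp
      also have "\<dots> \<le> sc\<^sup>2 * (\<Sum>j<Suc m. K * (2 * (real n / real m + 1)) powr (1 + 2 * d))"
      proof (intro mult_left_mono sum_mono)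
        fix j
        have "expectation (max_square partial_sum (n * j div m) (2 ^ p)) \<le> K * (2 ^ p) powr (1 + 2 * d)" by (rule K(2))
        also have "\<dots> \<le> K * (2 * (real n / real m + 1)) powr (1 + 2 * d)"
          using p(2) K(1) d_pos by (intro mult_left_mono powr_mono2) auto
        finally show "expectation (max_square partial_sum (n * j div m) (2 ^ p)) \<le> K * (2 * (real n / real m + 1)) powr (1 + 2 * d)" .
      qed simp
      also have "\<dots> = K * (real m + 1) * ((2 * (real n / real m + 1)) powr (1 + 2 * d) / real n powr (1 + 2 * d))"
        unfolding sc2 by simp
      also have "(2 * (real n / real m + 1)) powr (1 + 2 * d) / real n powr (1 + 2 * d) = (2 * (real n / real m + 1) / real n) powr (1 + 2 * d)"
        by (rule powr_divide[symmetric])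
      also have "2 * (real n / real m + 1) / real n = 2 / real m + 2 / real n"
        using n m by (simp add: field_simps)
      finally show "expectation (\<lambda>\<omega>. (E \<omega>)\<^sup>2) \<le> K * (real m + 1) * (2 / real m + 2 / real n) powr (1 + 2 * d)" .
    qed
    finally show "\<bar>expectation (\<lambda>\<omega>. \<phi> (step_path n (\<lambda>j. scaled_sum n j \<omega>)))
        - expectation (\<lambda>\<omega>. \<phi> (step_path m (\<lambda>j. scaled_sum n (n * j div m) \<omega>)))\<bar>
      \<le> L * sqrt (K * (real m + 1) * (2 / real m + 2 / real n) powr (1 + 2 * d))"
      unfolding F_def G_def .
  qed
qed

lemma scaled_sum_second_moment:
  obtains C where "\<And>n k. k \<le> n \<Longrightarrow> expectation (\<lambda>\<omega>. (scaled_sum n k \<omega>)\<^sup>2) \<le> C"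
proof -
  obtain C where C: "0 \<le> C"
    "\<And>a k. expectation (\<lambda>\<omega>. (partial_sum (a + k) \<omega> - partial_sum a \<omega>)\<^sup>2) \<le> C * real k powr (1 + 2 * d)"
    using partial_sum_increment by blast
  have "expectation (\<lambda>\<omega>. (scaled_sum n k \<omega>)\<^sup>2) \<le> C" if "k \<le> n" for n k
  proof (cases "n = 0")
    case True
    then show ?thesis using C(1) by (simp add: scaled_sum_def)
  next
    case False
    have "expectation (\<lambda>\<omega>. (partial_sum k \<omega>)\<^sup>2) \<le> C * real k powr (1 + 2 * d)"
      using C(2)[of 0 k] by (simp add: partial_sum_def)
    also have "\<dots> \<le> C * real n powr (1 + 2 * d)"
      using that C(1) d_pos by (intro mult_left_mono powr_mono2) auto
    finally have *: "expectation (\<lambda>\<omega>. (partial_sum k \<omega>)\<^sup>2) \<le> C * real n powr (1 + 2 * d)" .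
    have "(real n powr (- 1 / 2 - d))\<^sup>2 = 1 / real n powr (1 + 2 * d)"
      unfolding power2_eq_square powr_add[symmetric] powr_minus_divide[symmetric] by (simp add: algebra_simps)
    then have "expectation (\<lambda>\<omega>. (scaled_sum n k \<omega>)\<^sup>2) = expectation (\<lambda>\<omega>. (partial_sum k \<omega>)\<^sup>2) / real n powr (1 + 2 * d)"
      unfolding scaled_sum_def power_mult_distrib by simp
    also have "\<dots> \<le> C" using * False by (simp add: pos_divide_le_eq)
    finally show ?thesis .
  qed
  then show ?thesis by (rule that)
qed

lemma Beta_nonneg: "0 \<le> Beta d (1 - 2 * d)"
  unfolding Beta_def using d_pos d_less by (intro divide_nonneg_nonneg mult_nonneg_nonneg Gamma_real_nonneg) auto

section \<open>The fractional Brownian limit and the passage from grids to paths\<close>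

context
  fixes N :: "'b measure" and B_H :: "real \<Rightarrow> 'b \<Rightarrow> real"
  assumes fBm: "fractional_brownian_motion N (d + 1 / 2) B_H"
begin

lemma prob_space_N: "prob_space N"
  using fBm by (simp add: fractional_brownian_motion_def)

lemma fBm_mean: "0 \<le> t \<Longrightarrow> (LINT \<omega>|N. B_H t \<omega>) = 0"
  using fBm by (simp add: fractional_brownian_motion_def)

lemma fBm_cov: "0 \<le> s \<Longrightarrow> 0 \<le> t \<Longrightarrow> (LINT \<omega>|N. B_H s \<omega> * B_H t \<omega>) = limit_cov s t"
  using fBm by (simp add: fractional_brownian_motion_def limit_cov_def abs_minus_commute add.commute distrib_left)

lemma fBm_gaussian: "finite T \<Longrightarrow> T \<subseteq> {0..} \<Longrightarrow> gaussian_variable N (\<lambda>\<omega>. \<Sum>t\<in>T. a t * B_H t \<omega>)"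
  using fBm by (simp add: fractional_brownian_motion_def)

text \<open>The covariance identity alone would not give this, as a Bochner integral of a
  non-integrable function is 0; Gaussianity of the single variable does.\<close>

lemma fBm_sqint: "0 \<le> t \<Longrightarrow> B_H t \<in> sqint N"
  using gaussian_variable_char(1)[OF prob_space_N _ fBm_mean, of t] fBm_gaussian[of "{t}" "\<lambda>_. 1"] by simp

definition limit_const :: real where
  "limit_const = sqrt (mean_Q\<^sup>2 * Beta d (1 - 2 * d)) / sqrt (d * (1 + 2 * d))"

lemma limit_const_power2: "limit_const\<^sup>2 = mean_Q\<^sup>2 * (Beta d (1 - 2 * d) / (d * (1 + 2 * d)))"
  unfolding limit_const_def using Beta_nonneg d_pos by (simp add: power_divide)

definition limit_path :: "'b \<Rightarrow> real \<Rightarrow> real" where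
  "limit_path \<omega> = (\<lambda>\<tau>\<in>{0..1}. limit_const * B_H \<tau> \<omega>)"

definition limit_grid :: "nat \<Rightarrow> nat \<Rightarrow> 'b \<Rightarrow> real" where
  "limit_grid m j \<omega> = limit_const * B_H (real j / real m) \<omega>"

lemma limit_grid_sqint: "limit_grid m j \<in> sqint N"
  unfolding limit_grid_def[abs_def] by (intro sqint_cmult fBm_sqint) simp

lemma limit_path_continuous:
  assumes "\<omega> \<in> space N"
  shows "continuous_on {0..1} (\<lambda>\<tau>. limit_const * B_H \<tau> \<omega>)"
proof -
  have "continuous_on {0..} (\<lambda>\<tau>. B_H \<tau> \<omega>)" using fBm assms by (simp add: fractional_brownian_motion_def)
  then have "continuous_on {0..1} (\<lambda>\<tau>. B_H \<tau> \<omega>)" by (rule continuous_on_subset) auto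
  then show ?thesis by (intro continuous_intros)
qed

lemma limit_path_in_space: "\<omega> \<in> space N \<Longrightarrow> limit_path \<omega> \<in> skorohod_space"
  unfolding limit_path_def by (rule continuous_path_in_skorohod_space[OF limit_path_continuous])

lemma limit_grid_char:
  "(CLINT \<omega>|N. iexp (\<Sum>j<Suc m. \<theta> j * limit_grid m j \<omega>)) =
    exp (- (mean_Q\<^sup>2 * (Beta d (1 - 2 * d) / (d * (1 + 2 * d)) *
        (\<Sum>i<Suc m. \<Sum>j<Suc m. \<theta> i * \<theta> j * limit_cov (real i / real m) (real j / real m)))) / 2)"
  if m: "0 < m"
proof -
  define T where "T = (\<lambda>j. real j / real m) ` {..<Suc m}"
  define Y where "Y \<omega> = (\<Sum>j<Suc m. \<theta> j * limit_grid m j \<omega>)" for \<omega>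
  have inj: "inj_on (\<lambda>j. real j / real m) {..<Suc m}" using m by (auto simp: inj_on_def)
  \<comment> \<open>Gaussianity is stated for weights on time points, whereas \<theta> is indexed by
    grid numbers; floor (t m) recovers the number j from t = j / m.\<close>
  have "(\<Sum>t\<in>T. (limit_const * \<theta> (nat \<lfloor>t * real m\<rfloor>)) * B_H t \<omega>) = Y \<omega>" for \<omega>
    unfolding T_def Y_def sum.reindex[OF inj] limit_grid_def using m
    by (intro sum.cong refl) (simp add: mult_ac)
  moreover have "finite T" "T \<subseteq> {0..}" unfolding T_def by auto
  ultimately have gauss: "gaussian_variable N Y"
    using fBm_gaussian[of T "\<lambda>t. limit_const * \<theta> (nat \<lfloor>t * real m\<rfloor>)"] by simp
  interpret N: prob_space N by (rule prob_space_N)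
  have mean: "(LINT \<omega>|N. Y \<omega>) = 0"
    unfolding Y_def limit_grid_def using N.sqint_integrable[OF fBm_sqint] by (simp add: fBm_mean)
  have "(LINT \<omega>|N. (Y \<omega>)\<^sup>2) = (\<Sum>i<Suc m. \<Sum>j<Suc m. LINT \<omega>|N. (\<theta> i * limit_grid m i \<omega>) * (\<theta> j * limit_grid m j \<omega>))"
    unfolding Y_def by (intro integral_sum_power2 sqint_cmult limit_grid_sqint)
  also have "\<dots> = (\<Sum>i<Suc m. \<Sum>j<Suc m. limit_const\<^sup>2 * (\<theta> i * \<theta> j * limit_cov (real i / real m) (real j / real m)))"
  proof (intro sum.cong refl)
    fix i j
    have "(LINT \<omega>|N. (\<theta> i * limit_grid m i \<omega>) * (\<theta> j * limit_grid m j \<omega>)) =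
      (LINT \<omega>|N. (limit_const\<^sup>2 * (\<theta> i * \<theta> j)) * (B_H (real i / real m) \<omega> * B_H (real j / real m) \<omega>))"
      unfolding limit_grid_def power2_eq_square by (simp add: mult_ac)
    also have "\<dots> = (limit_const\<^sup>2 * (\<theta> i * \<theta> j)) * limit_cov (real i / real m) (real j / real m)"
      by (simp add: fBm_cov)
    finally show "(LINT \<omega>|N. (\<theta> i * limit_grid m i \<omega>) * (\<theta> j * limit_grid m j \<omega>)) =
      limit_const\<^sup>2 * (\<theta> i * \<theta> j * limit_cov (real i / real m) (real j / real m))" by simp
  qed
  finally have "(LINT \<omega>|N. (Y \<omega>)\<^sup>2) = limit_const\<^sup>2 * (\<Sum>i<Suc m. \<Sum>j<Suc m. \<theta> i * \<theta> j * limit_cov (real i / real m) (real j / real m))"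
    by (simp only: sum_distrib_left)
  then show ?thesis
    using gaussian_variable_char(2)[OF prob_space_N gauss mean] unfolding limit_const_power2 Y_def by (simp only: mult.assoc)
qed

text \<open>Paths of the limit are uniformly continuous on the unit interval, so their grid versions
  converge uniformly, hence in the Skorohod distance. Measurability of Lipschitz functionals of the
  limit path follows from this as well.\<close>

lemma grid_tendsto_limit_path:
  assumes \<phi>: "skorohod.lip_bounded \<phi>" and \<omega>: "\<omega> \<in> space N"
  shows "(\<lambda>m. \<phi> (step_path m (\<lambda>j. limit_grid m j \<omega>))) \<longlonglongrightarrow> \<phi> (limit_path \<omega>)"
proof (rule LIMSEQ_I)
  fix r :: real assume r: "0 < r"
  obtain L where L: "0 \<le> L" "\<forall>f\<in>skorohod_space. \<forall>g\<in>skorohod_space. \<bar>\<phi> f - \<phi> g\<bar> \<le> L * skorohod_dist f g"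
    using \<phi> unfolding skorohod.lip_bounded_def by blast
  \<comment> \<open>Dividing by \<open>L + 1\<close> covers L = 0 and makes the final inequality
    strict.\<close>
  define s where "s = r / (L + 1)"
  have s: "0 < s" "L * s < r"
  proof -
    show "0 < s" unfolding s_def using r L(1) by simp
    have "L * s = r * (L / (L + 1))" unfolding s_def by simp
    also have "\<dots> < r * 1" using r L(1) by (intro mult_strict_left_mono) auto
    finally show "L * s < r" by simp
  qed
  have "uniformly_continuous_on {0..1} (\<lambda>\<tau>. limit_const * B_H \<tau> \<omega>)"
    by (rule compact_uniformly_continuous[OF limit_path_continuous[OF \<omega>]]) simp
  then obtain \<delta> where \<delta>: "0 < \<delta>" "\<And>x y. x \<in> {0..1} \<Longrightarrow> y \<in> {0..1} \<Longrightarrow> \<bar>y - x\<bar> < \<delta> \<Longrightarrow>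
      \<bar>limit_const * B_H y \<omega> - limit_const * B_H x \<omega>\<bar> < s"
    using s(1) unfolding uniformly_continuous_on_def dist_real_def by metis
  obtain m0 :: nat where m0: "1 / \<delta> < real m0" using reals_Archimedean2 by blast
  have "norm (\<phi> (step_path m (\<lambda>j. limit_grid m j \<omega>)) - \<phi> (limit_path \<omega>)) < r" if "m \<ge> Suc m0" for m
  proof -
    have m: "0 < real m" "1 / \<delta> < real m" using m0 that by auto
    have "skorohod_dist (step_path m (\<lambda>j. limit_grid m j \<omega>)) (limit_path \<omega>) \<le> s"
    proof (rule skorohod_dist_le_sup)
      fix \<tau> :: real assume \<tau>: "\<tau> \<in> {0..1}"
      define x where "x = real (nat \<lfloor>real m * \<tau>\<rfloor>) / real m"
      have "0 \<le> real m * \<tau>" using \<tau> by simp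
      then have "real (nat \<lfloor>real m * \<tau>\<rfloor>) \<le> real m * \<tau>" "real m * \<tau> < real (nat \<lfloor>real m * \<tau>\<rfloor>) + 1"
        by linarith+
      then have x: "x \<le> \<tau>" "\<tau> < x + 1 / real m"
        unfolding x_def using m(1) by (simp_all add: pos_divide_le_eq pos_less_divide_eq mult.commute flip: add_divide_distrib)
      have "0 \<le> x" unfolding x_def by simp
      moreover have "1 / real m < \<delta>" using m \<delta>(1) by (simp add: field_simps)
      ultimately have "\<bar>limit_const * B_H x \<omega> - limit_const * B_H \<tau> \<omega>\<bar> < s"
        using x \<tau> by (intro \<delta>(2)) auto
      then show "\<bar>step_path m (\<lambda>j. limit_grid m j \<omega>) \<tau> - limit_path \<omega> \<tau>\<bar> \<le> s"
        using \<tau> unfolding step_path_def limit_path_def limit_grid_def x_def by simp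
    qed (use s limit_path_in_space[OF \<omega>] step_path_in_space in auto)
    then have "L * skorohod_dist (step_path m (\<lambda>j. limit_grid m j \<omega>)) (limit_path \<omega>) \<le> L * s"
      by (rule mult_left_mono[OF _ L(1)])
    moreover have "\<bar>\<phi> (step_path m (\<lambda>j. limit_grid m j \<omega>)) - \<phi> (limit_path \<omega>)\<bar>
      \<le> L * skorohod_dist (step_path m (\<lambda>j. limit_grid m j \<omega>)) (limit_path \<omega>)"
      using L(2) limit_path_in_space[OF \<omega>] step_path_in_space by blast
    ultimately show ?thesis using s(2) unfolding real_norm_def by linarith
  qed
  then show "\<exists>no. \<forall>m\<ge>no. norm (\<phi> (step_path m (\<lambda>j. limit_grid m j \<omega>)) - \<phi> (limit_path \<omega>)) < r" by blast
qed

lemma limit_path_measurable: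
  assumes "skorohod.lip_bounded \<phi>"
  shows "(\<lambda>\<omega>. \<phi> (limit_path \<omega>)) \<in> borel_measurable N"
proof (rule borel_measurable_LIMSEQ_real)
  show "(\<lambda>m. \<phi> (step_path m (\<lambda>j. limit_grid m j \<omega>))) \<longlonglongrightarrow> \<phi> (limit_path \<omega>)" if "\<omega> \<in> space N" for \<omega>
    by (rule grid_tendsto_limit_path[OF assms that])
  show "(\<lambda>\<omega>. \<phi> (step_path m (\<lambda>j. limit_grid m j \<omega>))) \<in> borel_measurable N" for m
    by (rule lip_step_path_measurable[OF assms sqintD(1)[OF limit_grid_sqint]])
qed

lemma grid_expectation_tendsto:
  assumes \<phi>: "skorohod.lip_bounded \<phi>" and m: "0 < m"
  shows "(\<lambda>n. expectation (\<lambda>\<omega>. \<phi> (step_path m (\<lambda>j. scaled_sum n (n * j div m) \<omega>))))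
    \<longlonglongrightarrow> (LINT \<omega>|N. \<phi> (step_path m (\<lambda>j. limit_grid m j \<omega>)))"
proof -
  obtain L B where L: "0 \<le> L" and B: "\<And>x. \<bar>\<phi> (step_path m x)\<bar> \<le> B"
    and lip: "\<And>x y. \<bar>\<phi> (step_path m x) - \<phi> (step_path m y)\<bar> \<le> L * (\<Sum>j<Suc m. \<bar>x j - y j\<bar>)"
    using lip_bounded_step_path[OF \<phi> m] by blast
  obtain C where C: "\<And>n k. k \<le> n \<Longrightarrow> expectation (\<lambda>\<omega>. (scaled_sum n k \<omega>)\<^sup>2) \<le> C"
    using scaled_sum_second_moment by blast
  \<comment> \<open>One constant bounds the second moments on both sides: those of the normalised
    sums, uniformly in n, and those of the finitely many limit variables.\<close>
  define D where "D = Max (insert C ((\<lambda>j. LINT \<omega>|N. (limit_grid m j \<omega>)\<^sup>2) ` {..<Suc m}))"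
  have CD: "C \<le> D" unfolding D_def by (intro Max_ge) auto
  have WD: "(LINT \<omega>|N. (limit_grid m j \<omega>)\<^sup>2) \<le> D" if "j < Suc m" for j
    unfolding D_def using that by (intro Max_ge) auto
  show ?thesis
  proof (rule finite_dim_weak_convergence[where \<psi>="\<lambda>x. \<phi> (step_path m x)" and m="Suc m" and C=D,
        OF prob_space_axioms prob_space_N])
    show "scaled_sum n (n * j div m) \<in> borel_measurable M" "integrable M (\<lambda>\<omega>. (scaled_sum n (n * j div m) \<omega>)\<^sup>2)" for n j
      by (rule sqintD[OF scaled_sum_sqint])+
    show "expectation (\<lambda>\<omega>. (scaled_sum n (n * j div m) \<omega>)\<^sup>2) \<le> D" if "j < Suc m" for n j
      by (rule order_trans[OF C CD]) (rule grid_le[OF that])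
    show "limit_grid m j \<in> borel_measurable N" "integrable N (\<lambda>\<omega>. (limit_grid m j \<omega>)\<^sup>2)" for j
      by (rule sqintD[OF limit_grid_sqint])+
    show "(LINT \<omega>|N. (limit_grid m j \<omega>)\<^sup>2) \<le> D" if "j < Suc m" for j by (rule WD[OF that])
    show "(\<lambda>n. CLINT \<omega>|M. iexp (\<Sum>j<Suc m. \<theta> j * scaled_sum n (n * j div m) \<omega>))
        \<longlonglongrightarrow> (CLINT \<omega>|N. iexp (\<Sum>j<Suc m. \<theta> j * limit_grid m j \<omega>))" for \<theta>
      unfolding limit_grid_char[OF m] scaled_sum_def partial_sum_def
      by (rule finite_dim_char_tendsto[OF grid_tendsto grid_le]) auto
  qed (rule lip L B)+
qed

text \<open>Two limits in the right order: on a fixed grid n tends to infinity by convergence of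
  random vectors, while the passage from grids to paths has an error controlled uniformly for large
  n.\<close>

theorem functional_limit:
  "converges_in_distribution skorohod_topology M
    (\<lambda>n \<omega>. \<lambda>\<tau>\<in>{0..1}. real n powr (- 1 / 2 - d) * (\<Sum>t\<in>{1..\<lfloor>real n * \<tau>\<rfloor>}. X t \<omega>)) N limit_path"
  unfolding skorohod_topology_def step_path_scaled_sum
proof (rule skorohod.converges_in_distributionI[OF prob_space_axioms prob_space_N])
  show "step_path n (\<lambda>j. scaled_sum n j \<omega>) \<in> skorohod_space" for n \<omega> by (rule step_path_in_space)
  show "limit_path \<omega> \<in> skorohod_space" if "\<omega> \<in> space N" for \<omega> by (rule limit_path_in_space[OF that])
  fix \<phi> :: "(real \<Rightarrow> real) \<Rightarrow> real" assume \<phi>: "skorohod.lip_bounded \<phi>"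
  show "(\<lambda>\<omega>. \<phi> (step_path n (\<lambda>j. scaled_sum n j \<omega>))) \<in> borel_measurable M" for n
    by (rule lip_step_path_measurable[OF \<phi> sqintD(1)[OF scaled_sum_sqint]])
  show "(\<lambda>\<omega>. \<phi> (limit_path \<omega>)) \<in> borel_measurable N" by (rule limit_path_measurable[OF \<phi>])
  obtain L where L: "0 \<le> L" "\<forall>f\<in>skorohod_space. \<forall>g\<in>skorohod_space. \<bar>\<phi> f - \<phi> g\<bar> \<le> L * skorohod_dist f g"
    using \<phi> unfolding skorohod.lip_bounded_def by blast
  obtain B where B: "\<forall>f\<in>skorohod_space. \<bar>\<phi> f\<bar> \<le> B" using \<phi> unfolding skorohod.lip_bounded_def by blast
  obtain K where K_all: "\<forall>\<phi> L n m. (\<forall>f\<in>skorohod_space. \<forall>g\<in>skorohod_space. \<bar>\<phi> f - \<phi> g\<bar> \<le> L * skorohod_dist f g) \<longrightarrow> 0 \<le> L \<longrightarrow>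
      skorohod.lip_bounded \<phi> \<longrightarrow> 0 < n \<longrightarrow> 0 < m \<longrightarrow>
      \<bar>expectation (\<lambda>\<omega>. \<phi> (step_path n (\<lambda>j. scaled_sum n j \<omega>)))
        - expectation (\<lambda>\<omega>. \<phi> (step_path m (\<lambda>j. scaled_sum n (n * j div m) \<omega>)))\<bar>
      \<le> L * sqrt (K * (real m + 1) * (2 / real m + 2 / real n) powr (1 + 2 * d))"
    using discretization_error by blast
  note K_bound = K_all[THEN spec, THEN spec, THEN spec, THEN spec, THEN mp, OF L(2), THEN mp, OF L(1), THEN mp, OF \<phi>, rule_format]
  interpret N: prob_space N by (rule prob_space_N)
  define I where "I = (LINT \<omega>|N. \<phi> (limit_path \<omega>))"
  define J where "J m = (LINT \<omega>|N. \<phi> (step_path m (\<lambda>j. limit_grid m j \<omega>)))" for m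
  have J_lim: "J \<longlonglongrightarrow> I"
    unfolding J_def I_def
  proof (rule integral_dominated_convergence[where w="\<lambda>_. B"])
    show "AE \<omega> in N. (\<lambda>m. \<phi> (step_path m (\<lambda>j. limit_grid m j \<omega>))) \<longlonglongrightarrow> \<phi> (limit_path \<omega>)"
      by (rule AE_I2) (rule grid_tendsto_limit_path[OF \<phi>])
    show "(\<lambda>\<omega>. \<phi> (step_path m (\<lambda>j. limit_grid m j \<omega>))) \<in> borel_measurable N" for m
      by (rule lip_step_path_measurable[OF \<phi> sqintD(1)[OF limit_grid_sqint]])
  qed (use B step_path_in_space limit_path_measurable[OF \<phi>] in auto)
  \<comment> \<open>The discretization bound after n has tended to infinity. It vanishes as m grows
    because the exponent 1 + 2 d exceeds 1.\<close>
  define A where "A m = L * sqrt (K * (real m + 1) * (2 / real m) powr (1 + 2 * d))" for m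
  have A_lim: "A \<longlonglongrightarrow> 0"
  proof -
    have "(\<lambda>m. (real m + 1) * (2 / real m) powr (1 + 2 * d)) \<longlonglongrightarrow> 0" using d_pos by real_asymp
    then have "(\<lambda>m. L * sqrt (K * ((real m + 1) * (2 / real m) powr (1 + 2 * d)))) \<longlonglongrightarrow> L * sqrt (K * 0)"
      by (intro tendsto_intros)
    then show ?thesis unfolding A_def by (simp add: mult.assoc)
  qed
  show "(\<lambda>n. expectation (\<lambda>\<omega>. \<phi> (step_path n (\<lambda>j. scaled_sum n j \<omega>)))) \<longlonglongrightarrow> (LINT \<omega>|N. \<phi> (limit_path \<omega>))"
    unfolding I_def[symmetric]
  proof (rule tendstoI)
    fix r :: real assume r: "0 < r"
    have "\<forall>\<^sub>F m in sequentially. A m < r / 3" using A_lim r by (intro order_tendstoD(2)) auto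
    moreover have "\<forall>\<^sub>F m in sequentially. dist (J m) I < r / 3" using J_lim r by (intro tendstoD) auto
    moreover have "\<forall>\<^sub>F m in sequentially. 0 < m" by (rule eventually_gt_at_top)
    ultimately have "\<forall>\<^sub>F m in sequentially. A m < r / 3 \<and> dist (J m) I < r / 3 \<and> 0 < m"
      by eventually_elim simp
    \<comment> \<open>The grid is fixed here, before n grows: it must be fine enough both for the
      limit process and for the limiting discretization bound.\<close>
    then obtain m where m: "A m < r / 3" "dist (J m) I < r / 3" "0 < m"
      unfolding eventually_sequentially by blast
    define An where "An n = L * sqrt (K * (real m + 1) * (2 / real m + 2 / real n) powr (1 + 2 * d))" for n
    have "(\<lambda>n. 2 / real n) \<longlonglongrightarrow> 0" by real_asymp
    then have "An \<longlonglongrightarrow> L * sqrt (K * (real m + 1) * (2 / real m + 0) powr (1 + 2 * d))"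
      unfolding An_def using m(3) by (intro tendsto_intros) auto
    then have "An \<longlonglongrightarrow> A m" by (simp add: A_def)
    then have "\<forall>\<^sub>F n in sequentially. An n < r / 3" using m(1) by (rule order_tendstoD(2))
    moreover have "\<forall>\<^sub>F n in sequentially. dist (expectation (\<lambda>\<omega>. \<phi> (step_path m (\<lambda>j. scaled_sum n (n * j div m) \<omega>)))) (J m) < r / 3"
      using grid_expectation_tendsto[OF \<phi> m(3)] r unfolding J_def by (intro tendstoD) auto
    moreover have "\<forall>\<^sub>F n::nat in sequentially. 0 < n" by (rule eventually_gt_at_top)
    ultimately show "\<forall>\<^sub>F n in sequentially. dist (expectation (\<lambda>\<omega>. \<phi> (step_path n (\<lambda>j. scaled_sum n j \<omega>)))) I < r"
    proof eventually_elim
      case (elim n)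
      show ?case
        using K_bound[OF elim(3) m(3)] elim(1,2) m(2) unfolding An_def dist_real_def by linarith
    qed
  qed
qed

end

end

theorem theorem8p2:
  fixes M :: "'a measure" and N :: "'b measure"
    and \<zeta> X :: "int \<Rightarrow> 'a \<Rightarrow> real"
    and \<alpha> :: "nat \<Rightarrow> real" and Q :: "real \<Rightarrow> real"
    and B_H :: "real \<Rightarrow> 'b \<Rightarrow> real"
    and c0 c1 d :: real
  assumes "prob_space M"
    and "prob_space.indep_vars M (\<lambda>_. borel) \<zeta> UNIV"
    and "\<forall>t. distr M borel (\<zeta> t) = distr M borel (\<zeta> 0)"
    and "integrable M (\<lambda>\<omega>. (\<zeta> 0 \<omega>)\<^sup>2)"
    and "(\<integral>\<omega>. \<zeta> 0 \<omega> \<partial>M) = 0"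
    and "(\<integral>\<omega>. (\<zeta> 0 \<omega>)\<^sup>2 \<partial>M) = 1"
    and "Q \<in> borel_measurable borel"
    and "0 \<le> c0" and "0 \<le> c1"
    and "\<forall>x. (Q x)\<^sup>2 \<le> c0\<^sup>2 + c1\<^sup>2 * x\<^sup>2"
    and "0 < d" and "d < 1 / 2"
    and "(\<lambda>k. \<alpha> k / real k powr (d - 1)) \<longlonglongrightarrow> 1"
    and "projective_solution M \<zeta> \<alpha> (\<lambda>i j. 1) Q X"
    and "((\<lambda>s. \<integral>\<omega>. (Q (noise_cond_exp M \<zeta> s 0 (X 0) \<omega>) - Q (X 0 \<omega>))\<^sup>2 \<partial>M) \<longlongrightarrow> 0) at_bot"
    and "fractional_brownian_motion N (d + 1 / 2) B_H"
  shows "((\<lambda>t::int. (\<integral>\<omega>. X 0 \<omega> * X t \<omega> \<partial>M) / real_of_int t powr (2 * d - 1))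
            \<longlongrightarrow> (\<integral>\<omega>. Q (X 0 \<omega>) \<partial>M)\<^sup>2 * Beta d (1 - 2 * d)) at_top
         \<and> converges_in_distribution skorohod_topology
            M (\<lambda>n \<omega>. \<lambda>\<tau>\<in>{0..1}. real n powr (- 1 / 2 - d) * (\<Sum>t\<in>{1..\<lfloor>real n * \<tau>\<rfloor>}. X t \<omega>))
            N (\<lambda>\<omega>. \<lambda>\<tau>\<in>{0..1}.
                 sqrt ((\<integral>\<omega>'. Q (X 0 \<omega>') \<partial>M)\<^sup>2 * Beta d (1 - 2 * d)) / sqrt (d * (1 + 2 * d)) *
                 B_H \<tau> \<omega>)"
proof -
  interpret prob_space M by fact
  interpret projective_model M \<zeta> X \<alpha> Q c0 c1 d
    by unfold_locales (use assms in auto)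
  show ?thesis
    using covariance_asymp functional_limit[OF assms(16)]
    unfolding mean_Q_def limit_path_def[OF assms(16), abs_def] limit_const_def[OF assms(16)] by simp
qed

end
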